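(* Let $q$ be a prime power and let $G=1+\mathfrak{a}$ be a pattern group over $\mathbb{F}_q$ with pattern algebra $\mathfrak{a}$. Then the number of (complex) irreducible characters of $G$ of degree $q$ equals the number of coadjoint orbits of $G$ on $\mathfrak{a}^*$ of cardinality $q^2$.
   Context: A closed set $D\subseteq\{(i,j):1\le i<j\le n\}$ is one such that $(i,j),(j,k)\in D$ implies $(i,k)\in D$; the pattern algebra $\mathfrak{a}=\mathfrak{g}_D$ is the $\mathbb{F}_q$-span of the elementary matrices $E_{ij}$, $(i,j)\in D$, and $G=1+\mathfrak{a}$ is the pattern group. The coadjoint action of $G$ on $\mathfrak{a}^*$ is $(\mathrm{Ad}^*(g)\lambda)(X)=\lambda(g^{-1}Xg)$ for $g\in G$, $\lambda\in\mathfrak{a}^*$, $X\in\mathfrak{a}$. *)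

theory Defs
  imports "Jordan_Normal_Form.Matrix"
begin

definition closed_pattern :: "nat \<Rightarrow> (nat \<times> nat) set \<Rightarrow> bool" where
  "closed_pattern n D \<longleftrightarrow>
     D \<subseteq> {(i, j). i < j \<and> j < n} \<and>
     (\<forall>i j k. (i, j) \<in> D \<longrightarrow> (j, k) \<in> D \<longrightarrow> (i, k) \<in> D)"

definition pattern_algebra :: "nat \<Rightarrow> (nat \<times> nat) set \<Rightarrow> 'f::field mat set" where
  "pattern_algebra n D =
     {A \<in> carrier_mat n n. \<forall>i<n. \<forall>j<n. (i, j) \<notin> D \<longrightarrow> A $$ (i, j) = 0}"

definition pattern_group :: "nat \<Rightarrow> (nat \<times> nat) set \<Rightarrow> 'f::field mat monoid" where
  "pattern_group n D =
     \<lparr> carrier = {1\<^sub>m n + A | A. A \<in> pattern_algebra n D},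
       mult = (*), one = 1\<^sub>m n \<rparr>"

definition pattern_dual :: "nat \<Rightarrow> (nat \<times> nat) set \<Rightarrow> ('f::field mat \<Rightarrow> 'f) set" where
  "pattern_dual n D =
     {l. (\<forall>X\<in>pattern_algebra n D. \<forall>Y\<in>pattern_algebra n D. l (X + Y) = l X + l Y) \<and>
         (\<forall>c. \<forall>X\<in>pattern_algebra n D. l (c \<cdot>\<^sub>m X) = c * l X) \<and>
         (\<forall>X. X \<notin> pattern_algebra n D \<longrightarrow> l X = 0)}"

definition coadjoint :: "nat \<Rightarrow> (nat \<times> nat) set \<Rightarrow> 'f::field mat \<Rightarrow> ('f mat \<Rightarrow> 'f) \<Rightarrow> ('f mat \<Rightarrow> 'f)" where
  "coadjoint n D g l =
     (\<lambda>X. if X \<in> pattern_algebra n D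
          then l (inv\<^bsub>pattern_group n D\<^esub> g * X * g) else 0)"

definition coadjoint_orbit :: "nat \<Rightarrow> (nat \<times> nat) set \<Rightarrow> ('f::field mat \<Rightarrow> 'f) \<Rightarrow> ('f mat \<Rightarrow> 'f) set" where
  "coadjoint_orbit n D l = {coadjoint n D g l | g. g \<in> carrier (pattern_group n D)}"

definition coadjoint_orbits :: "nat \<Rightarrow> (nat \<times> nat) set \<Rightarrow> ('f::field mat \<Rightarrow> 'f) set set" where
  "coadjoint_orbits n D = coadjoint_orbit n D ` pattern_dual n D"

definition mat_trace :: "'a::comm_ring_1 mat \<Rightarrow> 'a" where
  "mat_trace A = (\<Sum>i<dim_row A. A $$ (i, i))"

definition complex_rep :: "('g, 'b) monoid_scheme \<Rightarrow> nat \<Rightarrow> ('g \<Rightarrow> complex mat) \<Rightarrow> bool" where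
  "complex_rep G d \<rho> \<longleftrightarrow>
     (\<forall>g\<in>carrier G. \<rho> g \<in> carrier_mat d d) \<and>
     \<rho> \<one>\<^bsub>G\<^esub> = 1\<^sub>m d \<and>
     (\<forall>g\<in>carrier G. \<forall>h\<in>carrier G. \<rho> (g \<otimes>\<^bsub>G\<^esub> h) = \<rho> g * \<rho> h)"

definition invariant_subspace :: "('g, 'b) monoid_scheme \<Rightarrow> nat \<Rightarrow> ('g \<Rightarrow> complex mat) \<Rightarrow> complex vec set \<Rightarrow> bool" where
  "invariant_subspace G d \<rho> W \<longleftrightarrow>
     W \<subseteq> carrier_vec d \<and> 0\<^sub>v d \<in> W \<and>
     (\<forall>v\<in>W. \<forall>w\<in>W. v + w \<in> W) \<and> (\<forall>c. \<forall>v\<in>W. c \<cdot>\<^sub>v v \<in> W) \<and>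
     (\<forall>g\<in>carrier G. \<forall>w\<in>W. \<rho> g *\<^sub>v w \<in> W)"

definition irreducible_rep :: "('g, 'b) monoid_scheme \<Rightarrow> nat \<Rightarrow> ('g \<Rightarrow> complex mat) \<Rightarrow> bool" where
  "irreducible_rep G d \<rho> \<longleftrightarrow> complex_rep G d \<rho> \<and> d > 0 \<and>
     (\<forall>W. invariant_subspace G d \<rho> W \<longrightarrow> W = {0\<^sub>v d} \<or> W = carrier_vec d)"

definition character :: "('g, 'b) monoid_scheme \<Rightarrow> ('g \<Rightarrow> complex mat) \<Rightarrow> 'g \<Rightarrow> complex" where
  "character G \<rho> = (\<lambda>g. if g \<in> carrier G then mat_trace (\<rho> g) else 0)"

definition irr_chars_of_degree :: "('g, 'b) monoid_scheme \<Rightarrow> nat \<Rightarrow> ('g \<Rightarrow> complex) set" where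
  "irr_chars_of_degree G d = {character G \<rho> | \<rho>. irreducible_rep G d \<rho>}"

end

theory Submission
  imports Defs "Jordan_Normal_Form.Spectral_Radius" "HOL-Algebra.Multiplicative_Group"
begin

text \<open>Both sides only see the quotient of the algebra \<open>a\<close> by \<open>a\<^sup>3\<close>. Over a path \<open>i < j < k < l\<close> in
  \<open>D\<close> a representation that is nontrivial on \<open>1 + u E\<^sub>i\<^sub>l\<close> contains \<open>q\<^sup>2\<close> distinct characters of
  an abelian subgroup and so has degree at least \<open>q\<^sup>2\<close>; similarly a functional that is nonzero on
  \<open>E\<^sub>i\<^sub>l\<close> has an orbit of size more than \<open>q\<^sup>2\<close>. Modulo \<open>1 + a\<^sup>3\<close> the group has class two: an
  irreducible character with central character \<open>w\<close> on \<open>1 + a\<^sup>2\<close> vanishes outside the radical \<open>R\<close>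
  of the commutator form of \<open>w\<close>, is a multiple of an extension of \<open>w\<close> on \<open>R\<close>, and has degree
  \<open>|G : R|\<^sup>1\<^sup>/\<^sup>2\<close>. There are \<open>|R : 1 + a\<^sup>2|\<close> such extensions. On the other side,
  composition with a nontrivial additive character \<open>\<psi>\<close> of the field identifies functionals with additive
  characters of \<open>a\<close>; each \<open>w\<close> is the restriction of \<open>|a : a\<^sup>2|\<close> of them, and their orbits have
  size \<open>|G : R|\<close>. For degree \<open>q\<close> and orbit size \<open>q\<^sup>2\<close> the two counts agree.\<close>

section \<open>Extending linear characters\<close>

text \<open>The map 1 + A -> A plays the part of a logarithm in every characteristic: modulo
  \<open>a3\<close> it turns the product on \<open>Z\<close> into the sum on \<open>a2\<close>, and
  the commutator of 1 + A and 1 + B is 1 + (A B - B A). So a single form on the algebra, sending A,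
  B to w (1 + (A B - B A)), governs both the group and the functionals. Its radical is closed under
  field scalars, because a scalar can be moved from A to B; it is a subspace and not merely a
  subgroup. Index q^2 then means codimension two, and the radical enlarged by one line is a maximal
  isotropic subspace of index q, from which the characters of degree q are induced.

  The thresholds differ on the two sides. For characters a degree of at least q^2 is already too
  large. For functionals the orbit size q^2 itself has to be excluded over a path of length three,
  so a third independent direction is required and the bound becomes q^3.

  No bijection between characters and orbits is built: both cardinalities, multiplied by q^2 |a2|,
  equal |a1| times the number of those w whose radical has index q^2.\<close>

definition lin_chars :: "('g, 'b) monoid_scheme \<Rightarrow> 'g set \<Rightarrow> ('g \<Rightarrow> complex) set" where
  "lin_chars G H = {w. (\<forall>x\<in>H. w x \<noteq> 0) \<and> (\<forall>x. x \<notin> H \<longrightarrow> w x = 0) \<and>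
     (\<forall>x\<in>H. \<forall>y\<in>H. w (x \<otimes>\<^bsub>G\<^esub> y) = w x * w y)}"

text \<open>The value 0 outside the domain, imposed by \<open>lin_chars\<close>, makes every
  character of \<open>K\<close> a single function, so that \<open>card\<close> counts extensions and
  nothing else.\<close>

definition lin_exts :: "('g, 'b) monoid_scheme \<Rightarrow> ('g \<Rightarrow> complex) \<Rightarrow> 'g set \<Rightarrow> 'g set \<Rightarrow> ('g \<Rightarrow> complex) set" where
  "lin_exts G w0 H K = {w \<in> lin_chars G K. \<forall>h\<in>H. w h = w0 h}"

lemma lin_charsI:
  assumes "\<And>x. x \<in> H \<Longrightarrow> w x \<noteq> 0" "\<And>x. x \<notin> H \<Longrightarrow> w x = 0"
    "\<And>x y. x \<in> H \<Longrightarrow> y \<in> H \<Longrightarrow> w (x \<otimes>\<^bsub>G\<^esub> y) = w x * w y"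
  shows "w \<in> lin_chars G H"
  using assms by (auto simp: lin_chars_def)

lemma lin_chars_nz: "w \<in> lin_chars G H \<Longrightarrow> x \<in> H \<Longrightarrow> w x \<noteq> 0"
  by (auto simp: lin_chars_def)

lemma lin_chars_out: "w \<in> lin_chars G H \<Longrightarrow> x \<notin> H \<Longrightarrow> w x = 0"
  by (auto simp: lin_chars_def)

lemma lin_chars_mult:
  "w \<in> lin_chars G H \<Longrightarrow> x \<in> H \<Longrightarrow> y \<in> H \<Longrightarrow> w (x \<otimes>\<^bsub>G\<^esub> y) = w x * w y"
  by (auto simp: lin_chars_def)

section \<open>Adjoining one element at a time\<close>

context group
begin

text \<open>Left translation by x is injective on the finite set \<open>H\<close>, hence onto, so x
  = x e and x y = 1 have solutions in \<open>H\<close>. All subgroups of matrices below are obtained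
  this way, without computing inverses.\<close>

lemma finite_subgroupI:
  assumes "finite H" "H \<subseteq> carrier G" "H \<noteq> {}"
    and closed: "\<And>x y. x \<in> H \<Longrightarrow> y \<in> H \<Longrightarrow> x \<otimes> y \<in> H"
  shows "subgroup H G"
proof (rule subgroupI)
  fix x assume x: "x \<in> H"
  then have xc: "x \<in> carrier G" using assms by auto
  have "inj_on (\<lambda>y. x \<otimes> y) H"
    using assms(2) xc by (intro inj_onI) (metis Units_eq Units_l_cancel subsetD)
  moreover have "(\<lambda>y. x \<otimes> y) ` H \<subseteq> H" using closed x by auto
  ultimately have sur: "(\<lambda>y. x \<otimes> y) ` H = H"
    using assms(1) endo_inj_surj by blast
  then obtain e where e: "e \<in> H" "x \<otimes> e = x" using x by (metis imageE)
  then have "e = \<one>" using xc assms(2) by (metis l_cancel_one r_one subsetD)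
  then obtain y where y: "y \<in> H" "x \<otimes> y = \<one>" using sur e by (metis imageE)
  then have "y = inv x" using xc assms(2)
    by (metis inv_equality inv_inv subsetD)
  then show "inv x \<in> H" using y by simp
qed (use assms in auto)

lemma lin_chars_one:
  assumes "w \<in> lin_chars G H" "subgroup H G"
  shows "w \<one> = 1"
proof -
  have 1: "\<one> \<in> H" using assms subgroup.one_closed by blast
  have "w (\<one> \<otimes> \<one>) = w \<one> * w \<one>" using assms 1 lin_chars_mult by metis
  then show ?thesis using lin_chars_nz[OF assms(1) 1] by simp
qed

lemma lin_chars_inv:
  assumes "w \<in> lin_chars G H" "subgroup H G" "x \<in> H"
  shows "w (inv x) = inverse (w x)"
proof -
  have "w (x \<otimes> inv x) = w x * w (inv x)"
    using assms lin_chars_mult subgroup.m_inv_closed by metis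
  moreover have "x \<otimes> inv x = \<one>" using assms(2,3) subgroup.mem_carrier r_inv by metis
  ultimately have "w x * w (inv x) = 1" using lin_chars_one[OF assms(1,2)] by simp
  then show ?thesis by (metis inverse_unique)
qed

lemma lin_chars_pow:
  assumes "w \<in> lin_chars G H" "subgroup H G" "x \<in> H"
  shows "w (x [^] (k::nat)) = w x ^ k"
proof (induction k)
  case 0 then show ?case using lin_chars_one[OF assms(1,2)] by simp
next
  case (Suc k)
  have "x [^] k \<in> H" using assms(2,3)
    by (induction k) (auto simp: subgroup.one_closed subgroup.m_closed)
  then show ?case using Suc lin_chars_mult[OF assms(1) _ assms(3)] by simp
qed

lemma lin_chars_restrict:
  assumes "w \<in> lin_chars G K" "subgroup H G" "H \<subseteq> K"
  shows "(\<lambda>x. if x \<in> H then w x else 0) \<in> lin_chars G H"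
  using assms subgroup.m_closed[OF assms(2)] by (intro lin_charsI) (auto simp: lin_chars_def subset_eq)

text \<open>\<open>comm\<close> says that \<open>g\<close> normalises \<open>H\<close> and fixes
  \<open>w0\<close>. Then \<open>K\<close> is the union of the cosets g^k H, and m is the least
  positive exponent with g^m in \<open>H\<close>. An extension is determined by its value c at
  \<open>g\<close>, and c can be any of the m complex roots of c^m = w0 (g^m). The last clause,
  minimality of \<open>K\<close>, keeps the construction inside a prescribed larger
  subgroup.\<close>

lemma card_lin_exts_step:
  assumes fin: "finite (carrier G)" and H: "subgroup H G" and g: "g \<in> carrier G"
    and w0: "w0 \<in> lin_chars G H"
    and comm: "\<And>h. h \<in> H \<Longrightarrow> \<exists>h'\<in>H. h \<otimes> g = g \<otimes> h' \<and> w0 h' = w0 h"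
  obtains K m where "subgroup K G" "H \<subseteq> K" "g \<in> K" "card K = m * card H" "m > 0"
    "finite (lin_exts G w0 H K)" "card (lin_exts G w0 H K) = m"
    "\<And>L. subgroup L G \<Longrightarrow> H \<subseteq> L \<Longrightarrow> g \<in> L \<Longrightarrow> K \<subseteq> L"
proof -
  have HC: "\<And>h. h \<in> H \<Longrightarrow> h \<in> carrier G" using H subgroup.mem_carrier by metis
  have Hm: "\<And>x y. x \<in> H \<Longrightarrow> y \<in> H \<Longrightarrow> x \<otimes> y \<in> H" using H subgroup.m_closed by metis
  have finH: "finite H" using fin HC by (meson finite_subset subsetI)
  define m where "m = (LEAST k::nat. k > 0 \<and> g [^] k \<in> H)"
  have ex: "\<exists>k::nat. k > 0 \<and> g [^] k \<in> H"
  proof -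
    have "g [^] Coset.order G = \<one>" using g pow_order_eq_1 by blast
    moreover have "Coset.order G > 0" using fin order_gt_0_iff_finite by blast
    ultimately show ?thesis using subgroup.one_closed[OF H] by metis
  qed
  have m: "m > 0" "g [^] m \<in> H" unfolding m_def using LeastI_ex[OF ex] by auto
  have mmin: "\<And>k. 0 < k \<Longrightarrow> k < m \<Longrightarrow> g [^] k \<notin> H"
    unfolding m_def using not_less_Least by blast
  have gp: "\<And>k::nat. g [^] k \<in> carrier G" using g by simp
  have gmp: "(g [^] m) [^] (k::nat) \<in> H" for k
    by (induction k) (auto simp: subgroup.one_closed[OF H] Hm m)
  have split: "g [^] (k::nat) = g [^] (k mod m) \<otimes> (g [^] m) [^] (k div m)" for k
    using g by (simp add: nat_pow_pow nat_pow_mult)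
  have modin: "g [^] (k::nat) \<in> H \<Longrightarrow> m dvd k" for k
  proof -
    assume "g [^] k \<in> H"
    then have "g [^] (k mod m) \<otimes> (g [^] m) [^] (k div m) \<in> H" using split by metis
    then have "g [^] (k mod m) \<otimes> (g [^] m) [^] (k div m) \<otimes> inv ((g [^] m) [^] (k div m)) \<in> H"
      using gmp Hm subgroup.m_inv_closed[OF H] by blast
    then have "g [^] (k mod m) \<in> H" using gp by (simp add: m_assoc)
    then have "k mod m = 0" using mmin m(1) by (meson mod_less_divisor not_gr_zero)
    then show "m dvd k" by auto
  qed
  have commk: "\<exists>h'\<in>H. h \<otimes> g [^] (k::nat) = g [^] k \<otimes> h' \<and> w0 h' = w0 h" if "h \<in> H" for h k
    using that
  proof (induction k)
    case 0 then show ?case using HC by auto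
  next
    case (Suc k)
    then obtain h' where h': "h' \<in> H" "h \<otimes> g [^] k = g [^] k \<otimes> h'" "w0 h' = w0 h" by blast
    obtain h'' where h'': "h'' \<in> H" "h' \<otimes> g = g \<otimes> h''" "w0 h'' = w0 h'" using comm h'(1) by blast
    have "h \<otimes> g [^] Suc k = (h \<otimes> g [^] k) \<otimes> g" using g HC[OF Suc.prems] by (simp add: m_assoc)
    also have "\<dots> = g [^] k \<otimes> (h' \<otimes> g)" using h' HC g by (simp add: m_assoc)
    also have "\<dots> = g [^] Suc k \<otimes> h''" using h'' HC g by (simp add: m_assoc)
    finally show ?case using h' h'' by auto
  qed
  define K where "K = {g [^] (k::nat) \<otimes> h | k h. h \<in> H}"
  have KC: "K \<subseteq> carrier G" using K_def g HC by auto
  have HK: "H \<subseteq> K"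
  proof
    fix h assume "h \<in> H"
    then have "h = g [^] (0::nat) \<otimes> h" using HC by simp
    then show "h \<in> K" unfolding K_def using \<open>h \<in> H\<close> by blast
  qed
  have prodK: "\<exists>h''\<in>H. (g [^] (i::nat) \<otimes> h) \<otimes> (g [^] (j::nat) \<otimes> h') = g [^] (i + j) \<otimes> (h'' \<otimes> h') \<and> w0 h'' = w0 h"
    if hh: "h \<in> H" "h' \<in> H" for i j h h'
  proof -
    obtain h'' where h'': "h'' \<in> H" "h \<otimes> g [^] j = g [^] j \<otimes> h''" "w0 h'' = w0 h"
      using commk[OF hh(1)] by blast
    have "(g [^] i \<otimes> h) \<otimes> (g [^] j \<otimes> h') = g [^] i \<otimes> (h \<otimes> g [^] j) \<otimes> h'"
      using that HC gp by (simp add: m_assoc)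
    also have "\<dots> = (g [^] i \<otimes> g [^] j) \<otimes> (h'' \<otimes> h')"
      using that HC gp h'' by (simp add: m_assoc)
    finally show ?thesis using h'' g by (auto simp: nat_pow_mult)
  qed
  have Ksub: "subgroup K G"
  proof (rule finite_subgroupI)
    show "finite K" using KC fin finite_subset by blast
    show "K \<noteq> {}" using HK subgroup.one_closed[OF H] by auto
    fix x y assume "x \<in> K" "y \<in> K"
    then obtain i h j h' where "x = g [^] (i::nat) \<otimes> h" "h \<in> H" "y = g [^] (j::nat) \<otimes> h'" "h' \<in> H"
      unfolding K_def by blast
    then show "x \<otimes> y \<in> K" using prodK[of h h' i j] Hm unfolding K_def by blast
  qed (rule KC)
  have gK: "g \<in> K"
  proof -
    have "g = g [^] (1::nat) \<otimes> \<one>" using g by simp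
    then show ?thesis unfolding K_def using subgroup.one_closed[OF H] by blast
  qed
  have gpK: "g [^] (k::nat) \<in> K" for k
    by (induction k) (auto simp: subgroup.one_closed[OF Ksub] subgroup.m_closed[OF Ksub] gK)
  \<comment> \<open>Two factorisations of one element differ by a power of g^m moved from one factor
    to the other. This yields both the uniqueness of exponents below m and the independence of the
    values of \<open>w\<close> further down.\<close>
  have eqD: "\<exists>l. j = i + m * l \<and> h = (g [^] m) [^] l \<otimes> h'"
    if "g [^] i \<otimes> h = g [^] j \<otimes> h'" "i \<le> j" "h \<in> H" "h' \<in> H" for i j :: nat and h h'
  proof -
    have "g [^] j = g [^] i \<otimes> g [^] (j - i)" using that(2) g by (simp add: nat_pow_mult)
    then have "g [^] i \<otimes> h = g [^] i \<otimes> (g [^] (j - i) \<otimes> h')" using that gp HC by (simp add: m_assoc)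
    then have h: "h = g [^] (j - i) \<otimes> h'" using gp HC that by simp
    then have "h \<otimes> inv h' = g [^] (j - i)" using gp HC that by (simp add: m_assoc)
    then have "g [^] (j - i) \<in> H" using that Hm subgroup.m_inv_closed[OF H] by metis
    then obtain l where "j - i = m * l" using modin by blast
    then show ?thesis using h that(2) g by (intro exI[of _ l]) (auto simp: nat_pow_pow)
  qed
  have bij: "bij_betw (\<lambda>(i, h). g [^] (i::nat) \<otimes> h) ({..<m} \<times> H) K"
  proof (rule bij_betw_imageI)
    have *: "i = j \<and> h = h'" if ij: "i \<le> j" "i < m" "j < m" "h \<in> H" "h' \<in> H"
       "g [^] i \<otimes> h = g [^] j \<otimes> h'" for i j :: nat and h h'
    proof -
      obtain l where l: "j = i + m * l" "h = (g [^] m) [^] l \<otimes> h'" using eqD ij by blast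
      then have "l = 0" using that by (cases l) auto
      then show ?thesis using l HC that by simp
    qed
    show "inj_on (\<lambda>(i, h). g [^] (i::nat) \<otimes> h) ({..<m} \<times> H)"
    proof (rule inj_onI, clarsimp)
      fix i h j h' assume a: "i < m" "h \<in> H" "j < m" "h' \<in> H" "g [^] i \<otimes> h = g [^] j \<otimes> h'"
      show "i = j \<and> h = h'"
      proof (cases "i \<le> j")
        case True then show ?thesis using * a by blast
      next
        case False then show ?thesis using *[of j i h' h] a by simp
      qed
    qed
    show "(\<lambda>(i, h). g [^] (i::nat) \<otimes> h) ` ({..<m} \<times> H) = K"
    proof
      show "(\<lambda>(i, h). g [^] (i::nat) \<otimes> h) ` ({..<m} \<times> H) \<subseteq> K" unfolding K_def by auto
      show "K \<subseteq> (\<lambda>(i, h). g [^] (i::nat) \<otimes> h) ` ({..<m} \<times> H)"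
      proof
        fix x assume "x \<in> K"
        then obtain k h where x: "x = g [^] (k::nat) \<otimes> h" "h \<in> H" unfolding K_def by blast
        then have "x = g [^] (k mod m) \<otimes> ((g [^] m) [^] (k div m) \<otimes> h)"
          using split[of k] gp HC by (simp add: m_assoc)
        moreover have "(g [^] m) [^] (k div m) \<otimes> h \<in> H" using gmp x Hm by blast
        ultimately show "x \<in> (\<lambda>(i, h). g [^] (i::nat) \<otimes> h) ` ({..<m} \<times> H)"
          using m(1) by (intro image_eqI[of _ _ "(k mod m, (g [^] m) [^] (k div m) \<otimes> h)"]) auto
      qed
    qed
  qed
  have cardK: "card K = m * card H"
    using bij_betw_same_card[OF bij] by (simp add: card_cartesian_product)
  have w0m: "w0 (g [^] m) \<noteq> 0" using lin_chars_nz w0 m by metis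
  have wK: "w (g [^] (k::nat) \<otimes> h) = w g ^ k * w0 h" if "w \<in> lin_exts G w0 H K" "h \<in> H" for w k h
    using that lin_chars_mult[of w G K "g [^] k" h] lin_chars_pow[OF _ Ksub gK, of w k] HK gpK
    unfolding lin_exts_def by auto
  have bijw: "bij_betw (\<lambda>w. w g) (lin_exts G w0 H K) {c. c ^ m = w0 (g [^] m)}"
  proof (rule bij_betw_imageI)
    show "inj_on (\<lambda>w. w g) (lin_exts G w0 H K)"
    proof (rule inj_onI)
      fix w w' assume a: "w \<in> lin_exts G w0 H K" "w' \<in> lin_exts G w0 H K" "w g = w' g"
      show "w = w'"
      proof
        fix x
        show "w x = w' x"
        proof (cases "x \<in> K")
          case True
          then obtain k h where "x = g [^] (k::nat) \<otimes> h" "h \<in> H" unfolding K_def by blast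
          then show ?thesis using wK[OF a(1)] wK[OF a(2)] a(3) by simp
        next
          case False
          then show ?thesis using a unfolding lin_exts_def by (auto simp: lin_chars_out)
        qed
      qed
    qed
    show "(\<lambda>w. w g) ` lin_exts G w0 H K = {c. c ^ m = w0 (g [^] m)}"
    proof (intro equalityI subsetI)
      fix c assume "c \<in> (\<lambda>w. w g) ` lin_exts G w0 H K"
      then obtain w where w: "w \<in> lin_exts G w0 H K" "c = w g" by blast
      then have "w (g [^] m) = w g ^ m" using lin_chars_pow[OF _ Ksub gK] unfolding lin_exts_def by blast
      then show "c \<in> {c. c ^ m = w0 (g [^] m)}" using w m unfolding lin_exts_def by auto
    next
      fix c assume "c \<in> {c. c ^ m = w0 (g [^] m)}"
      then have c: "c ^ m = w0 (g [^] m)" by simp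
      then have c0: "c \<noteq> 0" using w0m m(1) by (auto simp: power_0_left)
      \<comment> \<open>The description picks the value c^k w0 h of any factorisation of x; fact
        \<open>**\<close> shows that all factorisations give the same one, because c^m = w0
        (g^m).\<close>
      define w where "w x = (if x \<in> K then (THE z. \<exists>k h. h \<in> H \<and> x = g [^] (k::nat) \<otimes> h \<and> z = c ^ k * w0 h) else 0)" for x
      have *: "c ^ i * w0 h = c ^ j * w0 h'" if ij: "i \<le> j" "h \<in> H" "h' \<in> H"
        "g [^] i \<otimes> h = g [^] j \<otimes> h'" for i j :: nat and h h'
      proof -
        obtain l where l: "j = i + m * l" "h = (g [^] m) [^] l \<otimes> h'" using eqD ij by blast
        have "w0 h = w0 (g [^] m) ^ l * w0 h'"
          using l(2) lin_chars_mult[OF w0 gmp that(3)] lin_chars_pow[OF w0 H m(2)] by simp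
        then show ?thesis using l(1) c by (simp add: power_add power_mult)
      qed
      have **: "c ^ i * w0 h = c ^ j * w0 h'" if "h \<in> H" "h' \<in> H"
        "g [^] i \<otimes> h = g [^] j \<otimes> h'" for i j :: nat and h h'
        using *[of i j h h'] *[of j i h' h] that by (metis nat_le_linear)
      have wv: "w (g [^] (k::nat) \<otimes> h) = c ^ k * w0 h" if "h \<in> H" for k h
      proof -
        have "(THE z. \<exists>k' h'. h' \<in> H \<and> g [^] k \<otimes> h = g [^] (k'::nat) \<otimes> h' \<and> z = c ^ k' * w0 h') = c ^ k * w0 h"
        proof (rule the_equality)
          fix z assume "\<exists>k' h'. h' \<in> H \<and> g [^] k \<otimes> h = g [^] (k'::nat) \<otimes> h' \<and> z = c ^ k' * w0 h'"
          then obtain k' h' where "h' \<in> H" "g [^] k \<otimes> h = g [^] (k'::nat) \<otimes> h'" "z = c ^ k' * w0 h'"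
            by blast
          then show "z = c ^ k * w0 h" using **[of h h' k k'] that by simp
        qed (use that in blast)
        moreover have "g [^] k \<otimes> h \<in> K" unfolding K_def using that by blast
        ultimately show ?thesis unfolding w_def by simp
      qed
      have "w \<in> lin_chars G K"
      proof (rule lin_charsI)
        fix x assume "x \<in> K"
        then obtain k h where "x = g [^] (k::nat) \<otimes> h" "h \<in> H" unfolding K_def by blast
        then show "w x \<noteq> 0" using wv c0 lin_chars_nz[OF w0] by simp
      next
        fix x y assume "x \<in> K" "y \<in> K"
        then obtain i h j h' where xy: "x = g [^] (i::nat) \<otimes> h" "h \<in> H" "y = g [^] (j::nat) \<otimes> h'" "h' \<in> H"
          unfolding K_def by blast
        then obtain h'' where h'': "h''\<in>H" "x \<otimes> y = g [^] (i + j) \<otimes> (h'' \<otimes> h')" "w0 h'' = w0 h"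
          using prodK by blast
        then have "w (x \<otimes> y) = c ^ (i + j) * (w0 h * w0 h')"
          using wv Hm xy lin_chars_mult[OF w0] by simp
        then show "w (x \<otimes> y) = w x * w y" using xy wv by (simp add: power_add)
      qed (simp add: w_def)
      moreover have "w h = w0 h" if "h \<in> H" for h
        using wv[OF that, of 0] HC[OF that] by simp
      moreover have "w g = c" using wv[OF subgroup.one_closed[OF H], of 1] g lin_chars_one[OF w0 H] by simp
      ultimately show "c \<in> (\<lambda>w. w g) ` lin_exts G w0 H K"
        unfolding lin_exts_def by (intro image_eqI[of _ _ w]) auto
    qed
  qed
  have "finite {c::complex. c ^ m = w0 (g [^] m)}" using m(1) w0m finite_nth_roots by blast
  then have fe: "finite (lin_exts G w0 H K)" using bij_betw_finite[OF bijw] by simp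
  have ce: "card (lin_exts G w0 H K) = m"
    using bij_betw_same_card[OF bijw] card_nth_roots[OF w0m m(1)] by simp
  have "K \<subseteq> L" if L: "subgroup L G" "H \<subseteq> L" "g \<in> L" for L
  proof -
    have "g [^] (k::nat) \<in> L" for k using L
      by (induction k) (auto simp: subgroup.one_closed subgroup.m_closed)
    then show ?thesis unfolding K_def using L by (auto simp: subgroup.m_closed)
  qed
  then show ?thesis using that[OF Ksub HK gK cardK m(1) fe ce] by blast
qed

text \<open>Induction on |K| - |H|, adjoining an element of \<open>K\<close> outside
  \<open>H\<close>. Since commutators of \<open>K\<close> lie in the kernel of \<open>w0\<close>,
  the hypotheses survive for every extension to the larger H'. Restriction maps the extensions to
  \<open>K\<close> onto those to H', with fibres of size |K : H'|, so the indices multiply.\<close>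

lemma card_lin_exts:
  assumes fin: "finite (carrier G)" and H: "subgroup H G" and K: "subgroup K G" "H \<subseteq> K"
    and w0: "w0 \<in> lin_chars G H"
    and comm: "\<And>x y. x \<in> K \<Longrightarrow> y \<in> K \<Longrightarrow> \<exists>c\<in>H. x \<otimes> y = y \<otimes> x \<otimes> c \<and> w0 c = 1"
  shows "finite (lin_exts G w0 H K) \<and> card (lin_exts G w0 H K) * card H = card K"
  using H K(2) w0 comm
proof (induction "card K - card H" arbitrary: H w0 rule: less_induct)
  case less
  note H = less.prems(1) and HK = less.prems(2) and w0 = less.prems(3) and comm = less.prems(4)
  have KC: "K \<subseteq> carrier G" using K subgroup.subset by blast
  have finK: "finite K" using KC fin finite_subset by blast
  show ?case
  proof (cases "H = K")
    case True
    then have "lin_exts G w0 H K = {w0}"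
      using w0 unfolding lin_exts_def lin_chars_def by fastforce
    then show ?thesis using True by simp
  next
    case False
    then obtain g where g: "g \<in> K" "g \<notin> H" using HK by blast
    have cg: "\<exists>h'\<in>H. h \<otimes> g = g \<otimes> h' \<and> w0 h' = w0 h" if h: "h \<in> H" for h
    proof -
      obtain c where c: "c \<in> H" "h \<otimes> g = g \<otimes> h \<otimes> c" "w0 c = 1" using comm[of h g] h HK g by blast
      have "h \<otimes> g = g \<otimes> (h \<otimes> c)" using c h HK g KC by (simp add: m_assoc subset_eq)
      moreover have "w0 (h \<otimes> c) = w0 h" using lin_chars_mult[OF w0 h c(1)] c by simp
      ultimately show ?thesis using subgroup.m_closed[OF H h c(1)] by blast
    qed
    have gC: "g \<in> carrier G" using g KC by blast
    obtain H' m where H': "subgroup H' G" "H \<subseteq> H'" "g \<in> H'" "card H' = m * card H" "m > 0"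
      "finite (lin_exts G w0 H H')" "card (lin_exts G w0 H H') = m"
      "\<And>L. subgroup L G \<Longrightarrow> H \<subseteq> L \<Longrightarrow> g \<in> L \<Longrightarrow> H' \<subseteq> L"
      by (rule card_lin_exts_step[OF fin H gC w0 cg]) (assumption | blast)+
    have H'K: "H' \<subseteq> K" using H'(8) K(1) HK g by blast
    have "H \<subset> H'" using H' g by auto
    then have lt: "card H < card H'" using finK H'K by (meson finite_subset psubset_card_mono)
    have "card H' \<le> card K" using finK H'K card_mono by blast
    then have less': "card K - card H' < card K - card H" using lt by linarith
    have IH: "finite (lin_exts G w1 H' K) \<and> card (lin_exts G w1 H' K) * card H' = card K"
      if w1: "w1 \<in> lin_exts G w0 H H'" for w1
    proof (rule less.hyps[OF less' H'(1) H'K])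
      show "w1 \<in> lin_chars G H'" using w1 lin_exts_def by blast
      fix x y assume "x \<in> K" "y \<in> K"
      then obtain c where "c \<in> H" "x \<otimes> y = y \<otimes> x \<otimes> c" "w0 c = 1" using comm by blast
      then show "\<exists>c\<in>H'. x \<otimes> y = y \<otimes> x \<otimes> c \<and> w1 c = 1" using H'(2) w1 unfolding lin_exts_def by fastforce
    qed
    have Un: "lin_exts G w0 H K = (\<Union>w1\<in>lin_exts G w0 H H'. lin_exts G w1 H' K)"
    proof (intro equalityI subsetI)
      fix w assume w: "w \<in> lin_exts G w0 H K"
      let ?w1 = "\<lambda>x. if x \<in> H' then w x else 0"
      have "?w1 \<in> lin_exts G w0 H H'"
        using w lin_chars_restrict[OF _ H'(1) H'K] H'(2) unfolding lin_exts_def by auto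
      moreover have "w \<in> lin_exts G ?w1 H' K" using w unfolding lin_exts_def by auto
      ultimately show "w \<in> (\<Union>w1\<in>lin_exts G w0 H H'. lin_exts G w1 H' K)" by blast
    next
      fix w assume "w \<in> (\<Union>w1\<in>lin_exts G w0 H H'. lin_exts G w1 H' K)"
      then show "w \<in> lin_exts G w0 H K" using H'(2) unfolding lin_exts_def by fastforce
    qed
    have disj: "lin_exts G w1 H' K \<inter> lin_exts G w2 H' K = {}"
      if "w1 \<in> lin_exts G w0 H H'" "w2 \<in> lin_exts G w0 H H'" "w1 \<noteq> w2" for w1 w2
    proof (rule ccontr)
      assume "lin_exts G w1 H' K \<inter> lin_exts G w2 H' K \<noteq> {}"
      then have "\<forall>h\<in>H'. w1 h = w2 h" unfolding lin_exts_def by auto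
      moreover have "\<forall>h. h \<notin> H' \<longrightarrow> w1 h = w2 h"
        using that unfolding lin_exts_def by (metis (no_types, lifting) lin_chars_out mem_Collect_eq)
      ultimately show False using that(3) by blast
    qed
    have "card (lin_exts G w0 H K) = (\<Sum>w1\<in>lin_exts G w0 H H'. card (lin_exts G w1 H' K))"
      unfolding Un using H'(6) IH disj by (intro card_UN_disjoint) auto
    then have "card (lin_exts G w0 H K) * card H' = (\<Sum>w1\<in>lin_exts G w0 H H'. card (lin_exts G w1 H' K) * card H')"
      by (simp add: sum_distrib_right)
    also have "\<dots> = m * card K" using IH H'(7) by simp
    finally have "card (lin_exts G w0 H K) * card H * m = card K * m" using H'(4) by (simp add: ac_simps)
    then have "card (lin_exts G w0 H K) * card H = card K" using H'(5) by simp
    moreover have "finite (lin_exts G w0 H K)" unfolding Un using H'(6) IH by blast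
    ultimately show ?thesis by blast
  qed
qed

end

section \<open>Complex representations of finite groups\<close>

lemma mat_trace_comm:
  assumes "A \<in> carrier_mat n n" "B \<in> carrier_mat n n"
  shows "mat_trace (A * B) = mat_trace (B * A)"
proof -
  have "mat_trace (A * B) = (\<Sum>i<n. \<Sum>k<n. A $$ (i, k) * B $$ (k, i))"
    using assms by (auto simp: mat_trace_def scalar_prod_def atLeast0LessThan intro!: sum.cong)
  also have "\<dots> = (\<Sum>k<n. \<Sum>i<n. B $$ (k, i) * A $$ (i, k))"
    by (subst sum.swap) (simp add: mult.commute)
  also have "\<dots> = mat_trace (B * A)"
    using assms by (auto simp: mat_trace_def scalar_prod_def atLeast0LessThan intro!: sum.cong)
  finally show ?thesis .
qed

lemma index_mult_mat_sum:
  assumes "A \<in> carrier_mat d d" "B \<in> carrier_mat d d" "a < d" "b < d"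
  shows "(A * B) $$ (a, b) = (\<Sum>k<d. A $$ (a, k) * B $$ (k, b))"
  using assms by (auto simp: scalar_prod_def atLeast0LessThan intro!: sum.cong)

lemma index_mult_vec_sum:
  assumes "A \<in> carrier_mat d d" "v \<in> carrier_vec d" "a < d"
  shows "(A *\<^sub>v v) $ a = (\<Sum>k<d. A $$ (a, k) * v $ k)"
  using assms by (auto simp: scalar_prod_def atLeast0LessThan intro!: sum.cong)

text \<open>A nonzero vector of minimal support is a multiple of a unit vector: otherwise a suitable
  combination of it with its image under one of the diagonal operators has smaller support.\<close>

lemma unit_vec_in_diag_invariant:
  fixes W :: "'a::field vec set" and D :: "'s \<Rightarrow> nat \<Rightarrow> 'a"
  assumes W: "W \<subseteq> carrier_vec m"
    and add: "\<And>v w. v \<in> W \<Longrightarrow> w \<in> W \<Longrightarrow> v + w \<in> W"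
    and smult: "\<And>c v. v \<in> W \<Longrightarrow> c \<cdot>\<^sub>v v \<in> W"
    and diag: "\<And>s v. s \<in> S \<Longrightarrow> v \<in> W \<Longrightarrow> vec m (\<lambda>i. D s i * v $ i) \<in> W"
    and sep: "\<And>i j. i < m \<Longrightarrow> j < m \<Longrightarrow> i \<noteq> j \<Longrightarrow> \<exists>s\<in>S. D s i \<noteq> D s j"
    and w: "w \<in> W" "w \<noteq> 0\<^sub>v m"
  shows "\<exists>i<m. unit_vec m i \<in> W"
  using w
proof (induction "card {i. i < m \<and> w $ i \<noteq> 0}" arbitrary: w rule: less_induct)
  case less
  have wc: "w \<in> carrier_vec m" using W less.prems by auto
  obtain i where i: "i < m" "w $ i \<noteq> 0" using less.prems(2) wc by (metis eq_vecI carrier_vecD index_zero_vec)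
  show ?case
  proof (cases "\<exists>j<m. j \<noteq> i \<and> w $ j \<noteq> 0")
    case True
    then obtain j where j: "j < m" "j \<noteq> i" "w $ j \<noteq> 0" by blast
    obtain s where s: "s \<in> S" "D s i \<noteq> D s j" using sep i j by metis
    define w' where "w' = vec m (\<lambda>k. D s k * w $ k) + (- D s i) \<cdot>\<^sub>v w"
    have w'W: "w' \<in> W" unfolding w'_def by (intro add smult diag s less.prems)
    have ix: "w' $ k = (D s k - D s i) * w $ k" if "k < m" for k
      using that wc unfolding w'_def by (simp add: algebra_simps)
    have "w' $ j \<noteq> 0" using ix j s by simp
    then have w'0: "w' \<noteq> 0\<^sub>v m" using j by auto
    have "{k. k < m \<and> w' $ k \<noteq> 0} \<subset> {k. k < m \<and> w $ k \<noteq> 0}"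
    proof
      show "{k. k < m \<and> w' $ k \<noteq> 0} \<subseteq> {k. k < m \<and> w $ k \<noteq> 0}"
        by (rule subsetI) (metis (mono_tags, lifting) ix mem_Collect_eq mult_zero_right)
      have "w' $ i = 0" using ix[OF i(1)] by simp
      then show "{k. k < m \<and> w' $ k \<noteq> 0} \<noteq> {k. k < m \<and> w $ k \<noteq> 0}" using i by blast
    qed
    then have "card {k. k < m \<and> w' $ k \<noteq> 0} < card {k. k < m \<and> w $ k \<noteq> 0}"
      by (intro psubset_card_mono) auto
    then show ?thesis using less.hyps w'W w'0 by blast
  next
    case False
    then have "unit_vec m i = inverse (w $ i) \<cdot>\<^sub>v w"
      using i wc by (intro eq_vecI) auto
    then show ?thesis using smult less.prems(1) i by metis
  qed
qed

lemma complex_repD: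
  assumes "complex_rep G d \<rho>"
  shows "g \<in> carrier G \<Longrightarrow> \<rho> g \<in> carrier_mat d d" "\<rho> \<one>\<^bsub>G\<^esub> = 1\<^sub>m d"
    "g \<in> carrier G \<Longrightarrow> h \<in> carrier G \<Longrightarrow> \<rho> (g \<otimes>\<^bsub>G\<^esub> h) = \<rho> g * \<rho> h"
  using assms by (auto simp: complex_rep_def)

text \<open>Schur's lemma over the complex numbers: an eigenspace of \<open>M\<close> is invariant
  and nonzero, hence the whole space; positive degree supplies an eigenvalue.\<close>

lemma schur_scalar:
  assumes irr: "irreducible_rep G d \<rho>" and M: "M \<in> carrier_mat d d"
    and comm: "\<And>g. g \<in> carrier G \<Longrightarrow> \<rho> g * M = M * \<rho> g"
  shows "\<exists>c. M = c \<cdot>\<^sub>m 1\<^sub>m d"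
proof -
  have rep: "complex_rep G d \<rho>" and d: "d > 0" using irr by (auto simp: irreducible_rep_def)
  obtain c where "eigenvalue M c" using spectrum_non_empty[OF M d] by (auto simp: spectrum_def)
  then obtain v where v: "v \<in> carrier_vec d" "v \<noteq> 0\<^sub>v d" "M *\<^sub>v v = c \<cdot>\<^sub>v v"
    using M by (auto simp: eigenvalue_def eigenvector_def)
  define W where "W = {w \<in> carrier_vec d. M *\<^sub>v w = c \<cdot>\<^sub>v w}"
  have "invariant_subspace G d \<rho> W"
    unfolding invariant_subspace_def
  proof (intro conjI ballI allI)
    show "W \<subseteq> carrier_vec d" by (auto simp: W_def)
    show "0\<^sub>v d \<in> W" using M by (auto simp: W_def)
    fix x y assume "x \<in> W" "y \<in> W"
    then show "x + y \<in> W" using M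
      by (auto simp: W_def mult_add_distrib_mat_vec smult_add_distrib_vec)
  next
    fix a x assume "x \<in> W"
    then show "a \<cdot>\<^sub>v x \<in> W" using M
      by (auto simp: W_def mult_mat_vec smult_smult_assoc mult.commute)
  next
    fix g x assume g: "g \<in> carrier G" and x: "x \<in> W"
    have R: "\<rho> g \<in> carrier_mat d d" using complex_repD(1)[OF rep g] .
    have xc: "x \<in> carrier_vec d" using x by (auto simp: W_def)
    have "M *\<^sub>v (\<rho> g *\<^sub>v x) = (M * \<rho> g) *\<^sub>v x" using assoc_mult_mat_vec[OF M R xc] by simp
    also have "\<dots> = \<rho> g *\<^sub>v (M *\<^sub>v x)" unfolding comm[OF g, symmetric] by (rule assoc_mult_mat_vec[OF R M xc])
    also have "\<dots> = c \<cdot>\<^sub>v (\<rho> g *\<^sub>v x)" using x R xc by (auto simp: W_def mult_mat_vec)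
    finally show "\<rho> g *\<^sub>v x \<in> W" using R xc by (auto simp: W_def)
  qed
  moreover have "W \<noteq> {0\<^sub>v d}" using v by (auto simp: W_def)
  ultimately have W: "W = carrier_vec d" using irr by (auto simp: irreducible_rep_def)
  have "M = c \<cdot>\<^sub>m 1\<^sub>m d"
  proof (rule eq_matI)
    fix i j assume "i < dim_row (c \<cdot>\<^sub>m 1\<^sub>m d)" "j < dim_col (c \<cdot>\<^sub>m 1\<^sub>m d)"
    then have ij: "i < d" "j < d" by auto
    have "unit_vec d j \<in> W" using W by simp
    then have e: "M *\<^sub>v unit_vec d j = c \<cdot>\<^sub>v unit_vec d j" by (auto simp: W_def)
    have "(M *\<^sub>v unit_vec d j) $ i = M $$ (i, j)" using M ij by (simp add: scalar_prod_right_unit)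
    moreover have "(c \<cdot>\<^sub>v unit_vec d j) $ i = (c \<cdot>\<^sub>m 1\<^sub>m d) $$ (i, j)" using ij by auto
    ultimately show "M $$ (i, j) = (c \<cdot>\<^sub>m 1\<^sub>m d) $$ (i, j)" using e by simp
  qed (use M in auto)
  then show ?thesis by blast
qed

context group
begin

text \<open>The norm relation for one irreducible character. The average of a matrix unit over the
  group commutes with the representation, so it is scalar, and its trace determines the scalar.
  Summing suitable entries of these averages gives the sum of products of traces.\<close>

lemma character_norm:
  assumes irr: "irreducible_rep G d \<rho>" and fin: "finite (carrier G)"
  shows "(\<Sum>g\<in>carrier G. mat_trace (\<rho> g) * mat_trace (\<rho> (inv g))) = of_nat (card (carrier G))"
proof -
  have rep: "complex_rep G d \<rho>" and d: "d > 0" using irr by (auto simp: irreducible_rep_def)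
  note R = complex_repD[OF rep]
  \<comment> \<open>Entrywise this is the sum over g of rho(g) E rho(g^-1), where E is the matrix
    unit at position (i, j).\<close>
  define P where "P i j = mat d d (\<lambda>(a, b). \<Sum>g\<in>carrier G. \<rho> g $$ (a, i) * \<rho> (inv g) $$ (j, b))" for i j
  have Pe: "P i j $$ (a, b) = (if a = b \<and> i = j then of_nat (card (carrier G)) / of_nat d else 0)"
    if ij: "i < d" "j < d" and ab: "a < d" "b < d" for i j a b
  proof -
    have Pc: "P i j \<in> carrier_mat d d" by (simp add: P_def)
    have "\<rho> h * P i j = P i j * \<rho> h" if h: "h \<in> carrier G" for h
    proof (rule eq_matI)
      fix a b assume "a < dim_row (P i j * \<rho> h)" "b < dim_col (P i j * \<rho> h)"
      then have ab: "a < d" "b < d" using Pc R(1)[OF h] by auto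
      have "(\<rho> h * P i j) $$ (a, b) = (\<Sum>k<d. \<rho> h $$ (a, k) * (\<Sum>g\<in>carrier G. \<rho> g $$ (k, i) * \<rho> (inv g) $$ (j, b)))"
        using index_mult_mat_sum[OF R(1)[OF h] Pc ab] ab by (simp add: P_def)
      also have "\<dots> = (\<Sum>g\<in>carrier G. (\<Sum>k<d. \<rho> h $$ (a, k) * \<rho> g $$ (k, i)) * \<rho> (inv g) $$ (j, b))"
        unfolding sum_distrib_left sum_distrib_right by (subst sum.swap) (simp only: mult.assoc)
      also have "\<dots> = (\<Sum>g\<in>carrier G. \<rho> (h \<otimes> g) $$ (a, i) * \<rho> (inv g) $$ (j, b))"
        using ab ij h by (intro sum.cong refl) (simp add: R(3) index_mult_mat_sum[OF R(1) R(1)])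
      also have "\<dots> = (\<Sum>g\<in>carrier G. \<rho> g $$ (a, i) * \<rho> (inv g \<otimes> h) $$ (j, b))"
        by (rule sum.reindex_bij_witness[of _ "\<lambda>g. inv h \<otimes> g" "\<lambda>g. h \<otimes> g"])
           (use h in \<open>auto simp: m_assoc[symmetric] inv_mult_group m_assoc\<close>)
      also have "\<dots> = (\<Sum>g\<in>carrier G. \<rho> g $$ (a, i) * (\<Sum>k<d. \<rho> (inv g) $$ (j, k) * \<rho> h $$ (k, b)))"
        using ab ij h by (intro sum.cong refl) (simp add: R(3) index_mult_mat_sum[OF R(1) R(1)])
      also have "\<dots> = (\<Sum>k<d. (\<Sum>g\<in>carrier G. \<rho> g $$ (a, i) * \<rho> (inv g) $$ (j, k)) * \<rho> h $$ (k, b))"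
        unfolding sum_distrib_left sum_distrib_right by (subst sum.swap) (simp only: mult.assoc)
      also have "\<dots> = (P i j * \<rho> h) $$ (a, b)"
        using index_mult_mat_sum[OF Pc R(1)[OF h] ab] ab by (simp add: P_def)
      finally show "(\<rho> h * P i j) $$ (a, b) = (P i j * \<rho> h) $$ (a, b)" .
    qed (use Pc R(1)[OF h] in auto)
    then obtain c where c: "P i j = c \<cdot>\<^sub>m 1\<^sub>m d" using schur_scalar[OF irr Pc] by blast
    \<comment> \<open>The trace of \<open>P i j\<close> is computed a second time: cyclically,
      rho(g^-1) meets rho(g) and their product is the identity.\<close>
    have "of_nat d * c = (\<Sum>a<d. P i j $$ (a, a))" unfolding c by simp
    also have "\<dots> = (\<Sum>a<d. \<Sum>g\<in>carrier G. \<rho> (inv g) $$ (j, a) * \<rho> g $$ (a, i))"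
      using ij by (simp add: P_def mult.commute)
    also have "\<dots> = (\<Sum>g\<in>carrier G. \<Sum>a<d. \<rho> (inv g) $$ (j, a) * \<rho> g $$ (a, i))"
      by (rule sum.swap)
    also have "\<dots> = (\<Sum>g\<in>carrier G. \<rho> (inv g \<otimes> g) $$ (j, i))"
    proof (rule sum.cong[OF refl])
      fix g assume g: "g \<in> carrier G"
      then show "(\<Sum>a<d. \<rho> (inv g) $$ (j, a) * \<rho> g $$ (a, i)) = \<rho> (inv g \<otimes> g) $$ (j, i)"
        unfolding R(3)[OF inv_closed[OF g] g]
        using index_mult_mat_sum[OF R(1)[OF inv_closed[OF g]] R(1)[OF g] ij(2,1)] by simp
    qed
    also have "\<dots> = (\<Sum>g\<in>carrier G. if i = j then 1 else 0)"
      using ij by (intro sum.cong refl) (auto simp: R(2))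
    finally have "of_nat d * c = (if i = j then of_nat (card (carrier G)) else 0)" by simp
    then have "c = (if i = j then of_nat (card (carrier G)) / of_nat d else 0)"
      using d by (auto simp: field_simps)
    then show ?thesis using c ab by auto
  qed
  have "(\<Sum>g\<in>carrier G. mat_trace (\<rho> g) * mat_trace (\<rho> (inv g)))
      = (\<Sum>g\<in>carrier G. \<Sum>a<d. \<Sum>b<d. \<rho> g $$ (a, a) * \<rho> (inv g) $$ (b, b))"
  proof (rule sum.cong[OF refl])
    fix g assume g: "g \<in> carrier G"
    have "dim_row (\<rho> g) = d" "dim_row (\<rho> (inv g)) = d" using R(1) g by (meson carrier_matD inv_closed)+
    then show "mat_trace (\<rho> g) * mat_trace (\<rho> (inv g)) = (\<Sum>a<d. \<Sum>b<d. \<rho> g $$ (a, a) * \<rho> (inv g) $$ (b, b))"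
      by (simp add: mat_trace_def sum_product)
  qed
  also have "\<dots> = (\<Sum>a<d. \<Sum>b<d. P a b $$ (a, b))"
    by (subst sum.swap, rule sum.cong[OF refl], subst sum.swap) (simp add: P_def)
  also have "\<dots> = (\<Sum>a<d. \<Sum>b<d. if b = a then of_nat (card (carrier G)) / of_nat d else 0)"
    by (intro sum.cong refl) (auto simp: Pe)
  also have "\<dots> = of_nat (card (carrier G))" using d by simp
  finally show ?thesis .
qed

section \<open>Fourier analysis on abelian subgroups\<close>

lemma lin_chars_triv:
  assumes "subgroup E G" shows "(\<lambda>x. if x \<in> E then 1 else 0) \<in> lin_chars G E"
  using subgroup.m_closed[OF assms] by (intro lin_charsI) auto

text \<open>The count is that of the extensions of the trivial character of the trivial subgroup.
  For separation, let \<open>H\<close> be the common kernel of all characters of \<open>E\<close>: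
  every character of \<open>E\<close> extends the trivial character of \<open>H\<close>, so there
  are |E : H| of them as well as |E|, and \<open>H\<close> is trivial.\<close>

lemma abelian_lin_chars:
  assumes fin: "finite (carrier G)" and E: "subgroup E G"
    and comm: "\<And>x y. x \<in> E \<Longrightarrow> y \<in> E \<Longrightarrow> x \<otimes> y = y \<otimes> x"
  shows "finite (lin_chars G E)" "card (lin_chars G E) = card E"
    "\<And>x. x \<in> E \<Longrightarrow> x \<noteq> \<one> \<Longrightarrow> \<exists>w\<in>lin_chars G E. w x \<noteq> 1"
proof -
  have EC: "E \<subseteq> carrier G" using E subgroup.subset by blast
  let ?t = "\<lambda>H x. if x \<in> H then 1 else (0::complex)"
  have cnt: "finite (lin_exts G (?t H) H E) \<and> card (lin_exts G (?t H) H E) * card H = card E"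
    if H: "subgroup H G" "H \<subseteq> E" for H
  proof (rule card_lin_exts[OF fin H(1) E H(2) lin_chars_triv[OF H(1)]])
    fix x y assume xy: "x \<in> E" "y \<in> E"
    have "y \<otimes> x \<otimes> \<one> = y \<otimes> x" using xy EC by (simp add: subset_eq)
    then have "x \<otimes> y = y \<otimes> x \<otimes> \<one>" using comm[OF xy] by simp
    then show "\<exists>c\<in>H. x \<otimes> y = y \<otimes> x \<otimes> c \<and> ?t H c = 1"
      using subgroup.one_closed[OF H(1)] by force
  qed
  have 1: "lin_exts G (?t {\<one>}) {\<one>} E = lin_chars G E"
    using lin_chars_one E by (auto simp: lin_exts_def)
  have tE: "{\<one>} \<subseteq> E" using subgroup.one_closed[OF E] by simp
  show f: "finite (lin_chars G E)" and c: "card (lin_chars G E) = card E"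
    using cnt[OF triv_subgroup tE] 1 by auto
  define H where "H = {x \<in> E. \<forall>w\<in>lin_chars G E. w x = 1}"
  have H: "subgroup H G"
  proof (rule finite_subgroupI)
    show "finite H" using EC fin by (auto simp: H_def intro: finite_subset)
    show "H \<subseteq> carrier G" using EC by (auto simp: H_def)
    show "H \<noteq> {}" using lin_chars_one E subgroup.one_closed[OF E] by (auto simp: H_def)
    show "x \<otimes> y \<in> H" if "x \<in> H" "y \<in> H" for x y
      using that lin_chars_mult subgroup.m_closed[OF E] by (fastforce simp: H_def)
  qed
  have HE: "H \<subseteq> E" by (auto simp: H_def)
  have "lin_exts G (?t H) H E = lin_chars G E" by (auto simp: lin_exts_def H_def)
  then have "card (lin_chars G E) * card H = card E" using cnt[OF H HE] by simp
  moreover have "card E > 0" using E fin subgroup.finite_imp_card_positive by blast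
  ultimately have "card H = 1" using c by simp
  then have "H = {\<one>}" using subgroup.one_closed[OF H] by (metis card_1_singletonE singletonD)
  then show "\<exists>w\<in>lin_chars G E. w x \<noteq> 1" if "x \<in> E" "x \<noteq> \<one>" for x
    using that by (auto simp: H_def)
qed

text \<open>If y is not the identity, multiplication by a character w' with w' y different from 1
  permutes the characters and multiplies the sum by w' y.\<close>

lemma sum_lin_chars:
  assumes fin: "finite (carrier G)" and E: "subgroup E G"
    and comm: "\<And>x y. x \<in> E \<Longrightarrow> y \<in> E \<Longrightarrow> x \<otimes> y = y \<otimes> x"
    and y: "y \<in> E"
  shows "(\<Sum>w\<in>lin_chars G E. w y) = (if y = \<one> then of_nat (card E) else 0)"
proof (cases "y = \<one>")
  case True
  then have "(\<Sum>w\<in>lin_chars G E. w y) = (\<Sum>w\<in>lin_chars G E. 1)"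
    using lin_chars_one[OF _ E] by (intro sum.cong refl) simp
  then show ?thesis using True abelian_lin_chars(2)[OF fin E comm] by simp
next
  case False
  then obtain w' where w': "w' \<in> lin_chars G E" "w' y \<noteq> 1"
    using abelian_lin_chars(3)[OF fin E comm y] by blast
  have mem: "(\<lambda>x. w1 x * w2 x) \<in> lin_chars G E" if "w1 \<in> lin_chars G E" "w2 \<in> lin_chars G E" for w1 w2
    using that by (auto simp: lin_chars_def)
  have memi: "(\<lambda>x. inverse (w1 x)) \<in> lin_chars G E" if "w1 \<in> lin_chars G E" for w1
    using that by (auto simp: lin_chars_def)
  \<comment> \<open>Outside \<open>E\<close> all values are 0 and both identities are trivial; they
    must hold there too, since the two reindexing maps have to be inverse on functions.\<close>
  have c: "inverse (w' x) * (w' x * w x) = w x" "w' x * (inverse (w' x) * w x) = w x" if "w \<in> lin_chars G E" for w x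
    using lin_chars_out[OF that, of x] lin_chars_nz[OF w'(1), of x] by (cases "x \<in> E"; simp)+
  have "(\<Sum>w\<in>lin_chars G E. w y) = (\<Sum>w\<in>lin_chars G E. w' y * w y)"
    by (rule sum.reindex_bij_witness[of _ "\<lambda>w x. w' x * w x" "\<lambda>w x. inverse (w' x) * w x"])
       (use mem memi w'(1) c in auto)
  then have "(\<Sum>w\<in>lin_chars G E. w y) = w' y * (\<Sum>w\<in>lin_chars G E. w y)"
    unfolding sum_distrib_left .
  then have "(1 - w' y) * (\<Sum>w\<in>lin_chars G E. w y) = 0"
    by (simp add: left_diff_distrib)
  then show ?thesis using False w'(2) by simp
qed

text \<open>\<open>P w\<close> below is, up to a factor, the projection to the w-eigenspace of
  \<open>E\<close>, and Fourier inversion recovers rho(x) from the matrices w x P w. If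
  \<open>P w\<close> vanished whenever w e0 differs from 1, inversion at e0 and at the identity
  would give the same matrix. So some such \<open>P w\<close> has a nonzero column, which is the
  eigenvector.\<close>

lemma abelian_eigenvector:
  assumes fin: "finite (carrier G)" and E: "subgroup E G"
    and comm: "\<And>x y. x \<in> E \<Longrightarrow> y \<in> E \<Longrightarrow> x \<otimes> y = y \<otimes> x"
    and rep: "complex_rep G d \<rho>" and e0: "e0 \<in> E" "\<rho> e0 \<noteq> 1\<^sub>m d"
  shows "\<exists>w\<in>lin_chars G E. w e0 \<noteq> 1 \<and>
    (\<exists>v\<in>carrier_vec d. v \<noteq> 0\<^sub>v d \<and> (\<forall>e\<in>E. \<rho> e *\<^sub>v v = w e \<cdot>\<^sub>v v))"
proof -
  note R = complex_repD[OF rep]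
  have EC: "\<And>x. x \<in> E \<Longrightarrow> x \<in> carrier G" using subgroup.mem_carrier[OF E] .
  note Ei = subgroup.m_inv_closed[OF E] and Em = subgroup.m_closed[OF E]
  define P where "P w = mat d d (\<lambda>(a, b). \<Sum>e\<in>E. w (inv e) * \<rho> e $$ (a, b))" for w
  have Pc: "P w \<in> carrier_mat d d" for w by (simp add: P_def)
  have RP: "\<rho> f * P w = w f \<cdot>\<^sub>m P w" if f: "f \<in> E" and w: "w \<in> lin_chars G E" for f w
  proof (rule eq_matI)
    fix a b assume "a < dim_row (w f \<cdot>\<^sub>m P w)" "b < dim_col (w f \<cdot>\<^sub>m P w)"
    then have ab: "a < d" "b < d" by (auto simp: P_def)
    have "(\<rho> f * P w) $$ (a, b) = (\<Sum>k<d. \<rho> f $$ (a, k) * (\<Sum>e\<in>E. w (inv e) * \<rho> e $$ (k, b)))"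
      using index_mult_mat_sum[OF R(1)[OF EC[OF f]] Pc ab] ab by (simp add: P_def)
    also have "\<dots> = (\<Sum>e\<in>E. w (inv e) * (\<Sum>k<d. \<rho> f $$ (a, k) * \<rho> e $$ (k, b)))"
      unfolding sum_distrib_left by (subst sum.swap) (simp only: ac_simps)
    also have "\<dots> = (\<Sum>e\<in>E. w (inv e) * \<rho> (f \<otimes> e) $$ (a, b))"
      using ab EC f by (intro sum.cong refl) (simp add: R(3) index_mult_mat_sum[OF R(1) R(1)])
    also have "\<dots> = (\<Sum>e\<in>E. w (inv e \<otimes> f) * \<rho> e $$ (a, b))"
      by (rule sum.reindex_bij_witness[of _ "\<lambda>e. inv f \<otimes> e" "\<lambda>e. f \<otimes> e"])
         (use f EC Ei Em in \<open>auto simp: m_assoc[symmetric] inv_mult_group m_assoc\<close>)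
    also have "\<dots> = (\<Sum>e\<in>E. w f * (w (inv e) * \<rho> e $$ (a, b)))"
      using lin_chars_mult[OF w] f Ei by (intro sum.cong refl) simp
    also have "\<dots> = (w f \<cdot>\<^sub>m P w) $$ (a, b)" using ab by (simp add: P_def sum_distrib_left)
    finally show "(\<rho> f * P w) $$ (a, b) = (w f \<cdot>\<^sub>m P w) $$ (a, b)" .
  qed (use Pc[of w] R(1)[OF EC[OF f]] in auto)
  have inversion: "(\<Sum>w\<in>lin_chars G E. w x * P w $$ (a, b)) = of_nat (card E) * \<rho> x $$ (a, b)"
    if x: "x \<in> E" and ab: "a < d" "b < d" for x a b
  proof -
    have "(\<Sum>w\<in>lin_chars G E. w x * P w $$ (a, b)) = (\<Sum>w\<in>lin_chars G E. \<Sum>e\<in>E. w (x \<otimes> inv e) * \<rho> e $$ (a, b))"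
      using ab x Ei by (intro sum.cong refl) (simp add: P_def sum_distrib_left lin_chars_mult mult.assoc)
    also have "\<dots> = (\<Sum>e\<in>E. (\<Sum>w\<in>lin_chars G E. w (x \<otimes> inv e)) * \<rho> e $$ (a, b))"
      by (subst sum.swap) (simp add: sum_distrib_right)
    also have "\<dots> = (\<Sum>e\<in>E. if x = e then of_nat (card E) * \<rho> x $$ (a, b) else 0)"
    proof (rule sum.cong[OF refl])
      fix e assume e: "e \<in> E"
      have "x \<otimes> inv e = \<one> \<longleftrightarrow> x = e" using x e EC by (metis inv_equality inv_inv inv_closed r_inv)
      then show "(\<Sum>w\<in>lin_chars G E. w (x \<otimes> inv e)) * \<rho> e $$ (a, b)
         = (if x = e then of_nat (card E) * \<rho> x $$ (a, b) else 0)"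
        using sum_lin_chars[OF fin E comm Em[OF x Ei[OF e]]] by simp
    qed
    also have "\<dots> = of_nat (card E) * \<rho> x $$ (a, b)"
      using x fin EC by (simp add: finite_subset[of E "carrier G"] subset_eq)
    finally show ?thesis .
  qed
  have "\<exists>w\<in>lin_chars G E. w e0 \<noteq> 1 \<and> P w \<noteq> 0\<^sub>m d d"
  proof (rule ccontr)
    assume "\<not> ?thesis"
    then have tr: "w e0 = 1 \<or> P w = 0\<^sub>m d d" if "w \<in> lin_chars G E" for w using that by blast
    have cE: "card E > 0" using E fin subgroup.finite_imp_card_positive by blast
    have "\<rho> e0 = \<rho> \<one>"
    proof (rule eq_matI)
      fix a b assume "a < dim_row (\<rho> \<one>)" "b < dim_col (\<rho> \<one>)"
      then have ab: "a < d" "b < d" using R(1)[of \<one>] by auto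
      have "of_nat (card E) * \<rho> e0 $$ (a, b) = (\<Sum>w\<in>lin_chars G E. w e0 * P w $$ (a, b))"
        using inversion[OF e0(1) ab] by simp
      also have "\<dots> = (\<Sum>w\<in>lin_chars G E. w \<one> * P w $$ (a, b))"
        using tr lin_chars_one[OF _ E] ab by (intro sum.cong refl) fastforce
      also have "\<dots> = of_nat (card E) * \<rho> \<one> $$ (a, b)"
        using inversion[OF subgroup.one_closed[OF E] ab] by simp
      finally show "\<rho> e0 $$ (a, b) = \<rho> \<one> $$ (a, b)" using cE by simp
    qed (use R(1)[of \<one>] R(1)[OF EC[OF e0(1)]] in auto)
    then show False using e0 R(2) by simp
  qed
  then obtain w where w: "w \<in> lin_chars G E" "w e0 \<noteq> 1" "P w \<noteq> 0\<^sub>m d d" by blast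
  then obtain a b where ab: "a < d" "b < d" "P w $$ (a, b) \<noteq> 0" using Pc[of w]
    by (metis carrier_matD eq_matI index_zero_mat)
  have "\<rho> e *\<^sub>v col (P w) b = w e \<cdot>\<^sub>v col (P w) b" if e: "e \<in> E" for e
  proof -
    have "\<rho> e *\<^sub>v col (P w) b = col (\<rho> e * P w) b" using ab Pc[of w] R(1)[OF EC[OF e]] by (auto intro!: eq_vecI)
    also have "\<dots> = w e \<cdot>\<^sub>v col (P w) b" unfolding RP[OF e w(1)] using ab Pc[of w] by (auto intro!: eq_vecI)
    finally show ?thesis .
  qed
  moreover have "col (P w) b \<noteq> 0\<^sub>v d" using ab Pc[of w]
    by (metis carrier_matD index_col index_zero_vec(1))
  moreover have "col (P w) b \<in> carrier_vec d" using Pc[of w] by auto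
  ultimately show ?thesis using w by blast
qed

text \<open>Common eigenvectors with distinct characters are linearly independent. The coefficient
  vectors of linear relations among them form a space stable under the diagonal operators given by
  the eigenvalues; if it were nonzero it would contain a unit vector, that is, one of the
  eigenvectors would be 0.\<close>

lemma card_eigenchars_le:
  assumes "complex_rep G d \<rho>" and fI: "finite I" and EC: "E \<subseteq> carrier G"
    and v: "\<And>i. i \<in> I \<Longrightarrow> v i \<in> carrier_vec d" "\<And>i. i \<in> I \<Longrightarrow> v i \<noteq> 0\<^sub>v d"
    and ev: "\<And>i e. i \<in> I \<Longrightarrow> e \<in> E \<Longrightarrow> \<rho> e *\<^sub>v v i = w i e \<cdot>\<^sub>v v i"
    and sep: "\<And>i j. i \<in> I \<Longrightarrow> j \<in> I \<Longrightarrow> i \<noteq> j \<Longrightarrow> \<exists>e\<in>E. w i e \<noteq> w j e"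
  shows "card I \<le> d"
proof (rule ccontr)
  assume "\<not> card I \<le> d"
  then have dm: "d < card I" by simp
  note R = complex_repD[OF assms(1)]
  define m where "m = card I"
  obtain b where b: "bij_betw b {..<m} I" using fI unfolding m_def
    by (metis atLeast0LessThan ex_bij_betw_nat_finite)
  have bI: "b i \<in> I" if "i < m" for i using b that by (auto simp: bij_betw_def)
  have bij: "b i \<noteq> b j" if "i < m" "j < m" "i \<noteq> j" for i j
    using b that by (auto simp: bij_betw_def inj_on_def)
  \<comment> \<open>The eigenvectors are the columns, padded with zero rows to a square matrix. Row
    d exists because there are more than d columns, so the determinant vanishes and a nontrivial
    relation exists.\<close>
  define A where "A = mat m m (\<lambda>(a, i). if a < d then v (b i) $ a else 0)"
  have Ac: "A \<in> carrier_mat m m" by (simp add: A_def)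
  have Ax: "A *\<^sub>v c = 0\<^sub>v m \<longleftrightarrow> (\<forall>a<d. (\<Sum>i<m. v (b i) $ a * c $ i) = 0)" if "c \<in> carrier_vec m" for c
  proof -
    have ix: "(A *\<^sub>v c) $ a = (if a < d then \<Sum>i<m. v (b i) $ a * c $ i else 0)" if "a < m" for a
      using index_mult_vec_sum[OF Ac \<open>c \<in> carrier_vec m\<close> that] that by (simp add: A_def)
    have "A *\<^sub>v c = 0\<^sub>v m \<longleftrightarrow> (\<forall>a<m. (A *\<^sub>v c) $ a = 0)"
    proof (intro iffI allI impI)
      fix a assume "A *\<^sub>v c = 0\<^sub>v m" "a < m"
      then show "(A *\<^sub>v c) $ a = 0" by (metis index_zero_vec(1))
    next
      assume "\<forall>a<m. (A *\<^sub>v c) $ a = 0"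
      then show "A *\<^sub>v c = 0\<^sub>v m" using Ac by (intro eq_vecI) (simp_all del: index_mult_mat_vec)
    qed
    then show ?thesis using ix dm unfolding m_def[symmetric] by auto
  qed
  have dm': "d < m" using dm by (simp add: m_def)
  have "A = mat\<^sub>r m m (\<lambda>i. if i = d then 0\<^sub>v m else row A i)"
    using dm' by (intro eq_matI) (auto simp: A_def)
  also have "det \<dots> = 0" by (rule det_row_0[OF dm']) (use Ac in auto)
  finally have "det A = 0" .
  then obtain c where c: "c \<in> carrier_vec m" "c \<noteq> 0\<^sub>v m" "A *\<^sub>v c = 0\<^sub>v m"
    using det_0_iff_vec_prod_zero[OF Ac] by blast
  define W where "W = {c \<in> carrier_vec m. A *\<^sub>v c = 0\<^sub>v m}"
  have "\<exists>i<m. unit_vec m i \<in> W"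
  proof (rule unit_vec_in_diag_invariant[where S = E and D = "\<lambda>e i. w (b i) e"])
    show "W \<subseteq> carrier_vec m" by (auto simp: W_def)
    show "x + y \<in> W" if "x \<in> W" "y \<in> W" for x y
      using that Ac by (auto simp: W_def mult_add_distrib_mat_vec)
    show "k \<cdot>\<^sub>v x \<in> W" if "x \<in> W" for k x
      using that Ac by (auto simp: W_def mult_mat_vec)
    show "\<exists>s\<in>E. w (b i) s \<noteq> w (b j) s" if "i < m" "j < m" "i \<noteq> j" for i j
      using sep bI bij that by blast
    show "c \<in> W" "c \<noteq> 0\<^sub>v m" using c by (auto simp: W_def)
    show "vec m (\<lambda>i. w (b i) s * x $ i) \<in> W" if s: "s \<in> E" and x: "x \<in> W" for s x
    proof -
      have xc: "x \<in> carrier_vec m" using x by (simp add: W_def)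
      have x0: "\<And>a. a < d \<Longrightarrow> (\<Sum>i<m. v (b i) $ a * x $ i) = 0" using x Ax[OF xc] by (auto simp: W_def)
      have sc: "\<rho> s \<in> carrier_mat d d" using R(1) s EC by blast
      have "(\<Sum>i<m. v (b i) $ a * (w (b i) s * x $ i)) = 0" if a: "a < d" for a
      proof -
        have "v (b i) $ a * (w (b i) s * x $ i) = (\<Sum>k<d. \<rho> s $$ (a, k) * (v (b i) $ k * x $ i))" if i: "i < m" for i
        proof -
          have "w (b i) s * v (b i) $ a = (\<rho> s *\<^sub>v v (b i)) $ a"
            using ev[OF bI[OF i] s] v(1)[OF bI[OF i]] a by simp
          also have "\<dots> = (\<Sum>k<d. \<rho> s $$ (a, k) * v (b i) $ k)"
            using index_mult_vec_sum[OF sc v(1)[OF bI[OF i]] a] .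
          finally have "w (b i) s * v (b i) $ a * x $ i = (\<Sum>k<d. \<rho> s $$ (a, k) * v (b i) $ k) * x $ i" by simp
          also have "\<dots> = (\<Sum>k<d. \<rho> s $$ (a, k) * (v (b i) $ k * x $ i))"
            unfolding sum_distrib_right by (simp only: mult.assoc)
          finally show ?thesis by (simp only: ac_simps)
        qed
        then have "(\<Sum>i<m. v (b i) $ a * (w (b i) s * x $ i)) = (\<Sum>i<m. \<Sum>k<d. \<rho> s $$ (a, k) * (v (b i) $ k * x $ i))"
          by (intro sum.cong) auto
        also have "\<dots> = (\<Sum>k<d. \<rho> s $$ (a, k) * (\<Sum>i<m. v (b i) $ k * x $ i))"
          by (subst sum.swap) (simp add: sum_distrib_left)
        also have "\<dots> = 0" using x0 by simp
        finally show ?thesis .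
      qed
      then show ?thesis unfolding W_def using Ax[of "vec m (\<lambda>i. w (b i) s * x $ i)"] by simp
    qed
  qed
  then obtain i where i: "i < m" "unit_vec m i \<in> W" by blast
  have "v (b i) $ a = 0" if "a < d" for a
  proof -
    have "(\<Sum>j<m. v (b j) $ a * unit_vec m i $ j) = 0" using i(2) Ax[of "unit_vec m i"] that by (auto simp: W_def)
    moreover have "(\<Sum>j<m. v (b j) $ a * unit_vec m i $ j) = (\<Sum>j<m. if j = i then v (b i) $ a else 0)"
      using i by (intro sum.cong refl) (auto simp: unit_vec_def)
    ultimately show ?thesis using i by simp
  qed
  then have "v (b i) = 0\<^sub>v d" using v(1)[OF bI[OF i(1)]] by (intro eq_vecI) auto
  then show False using v(2) bI i by blast
qed

text \<open>If v is an eigenvector of \<open>E\<close> with character w, then rho(s) v is one with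
  the conjugate character e -> w (s^-1 e s). Only w e0 being different from 1 is known about the
  character that occurs, so \<open>sep\<close> must distinguish the conjugates of every such
  w.\<close>

lemma rep_degree_ge_card_conjugates:
  assumes fin: "finite (carrier G)" and E: "subgroup E G"
    and comm: "\<And>x y. x \<in> E \<Longrightarrow> y \<in> E \<Longrightarrow> x \<otimes> y = y \<otimes> x"
    and rep: "complex_rep G d \<rho>" and e0: "e0 \<in> E" "\<rho> e0 \<noteq> 1\<^sub>m d"
    and S: "S \<subseteq> carrier G" "\<And>s e. s \<in> S \<Longrightarrow> e \<in> E \<Longrightarrow> inv s \<otimes> e \<otimes> s \<in> E"
    and sep: "\<And>w s t. w \<in> lin_chars G E \<Longrightarrow> w e0 \<noteq> 1 \<Longrightarrow> s \<in> S \<Longrightarrow> t \<in> S \<Longrightarrow> s \<noteq> t \<Longrightarrow>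
        \<exists>e\<in>E. w (inv s \<otimes> e \<otimes> s) \<noteq> w (inv t \<otimes> e \<otimes> t)"
  shows "card S \<le> d"
proof -
  note R = complex_repD[OF rep]
  obtain w v where w: "w \<in> lin_chars G E" "w e0 \<noteq> 1" and v: "v \<in> carrier_vec d" "v \<noteq> 0\<^sub>v d"
    and ev: "\<And>e. e \<in> E \<Longrightarrow> \<rho> e *\<^sub>v v = w e \<cdot>\<^sub>v v"
    using abelian_eigenvector[OF fin E comm rep e0] by blast
  have EC: "E \<subseteq> carrier G" using subgroup.subset[OF E] .
  show ?thesis
  proof (rule card_eigenchars_le[OF rep _ EC, where v = "\<lambda>s. \<rho> s *\<^sub>v v" and w = "\<lambda>s e. w (inv s \<otimes> e \<otimes> s)"])
    show "finite S" using S fin finite_subset by blast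
    fix s assume s: "s \<in> S"
    have sc: "s \<in> carrier G" using s S by blast
    show "\<rho> s *\<^sub>v v \<in> carrier_vec d" using R(1)[OF sc] v by auto
    show "\<rho> s *\<^sub>v v \<noteq> 0\<^sub>v d"
    proof
      assume z: "\<rho> s *\<^sub>v v = 0\<^sub>v d"
      have "v = \<rho> (inv s \<otimes> s) *\<^sub>v v" using sc R(2) v by simp
      also have "\<dots> = \<rho> (inv s) *\<^sub>v (\<rho> s *\<^sub>v v)"
        unfolding R(3)[OF inv_closed[OF sc] sc] using v R(1)[OF sc] R(1)[OF inv_closed[OF sc]] by simp
      also have "\<dots> = 0\<^sub>v d" unfolding z using R(1)[OF inv_closed[OF sc]] by (auto intro!: eq_vecI)
      finally show False using v by simp
    qed
    show "\<rho> e *\<^sub>v (\<rho> s *\<^sub>v v) = w (inv s \<otimes> e \<otimes> s) \<cdot>\<^sub>v (\<rho> s *\<^sub>v v)" if e: "e \<in> E" for e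
    proof -
      have ec: "e \<in> carrier G" using e EC by blast
      have e': "inv s \<otimes> e \<otimes> s \<in> E" using S(2) s e by blast
      then have e'c: "inv s \<otimes> e \<otimes> s \<in> carrier G" using EC by blast
      have "\<rho> e *\<^sub>v (\<rho> s *\<^sub>v v) = \<rho> (e \<otimes> s) *\<^sub>v v"
        unfolding R(3)[OF ec sc] using assoc_mult_mat_vec[OF R(1)[OF ec] R(1)[OF sc] v(1)] by simp
      also have "e \<otimes> s = s \<otimes> (inv s \<otimes> e \<otimes> s)" using ec sc by (simp add: m_assoc[symmetric])
      also have "\<rho> \<dots> *\<^sub>v v = \<rho> s *\<^sub>v (\<rho> (inv s \<otimes> e \<otimes> s) *\<^sub>v v)"
        unfolding R(3)[OF sc e'c] using assoc_mult_mat_vec[OF R(1)[OF sc] R(1)[OF e'c] v(1)] by simp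
      also have "\<dots> = w (inv s \<otimes> e \<otimes> s) \<cdot>\<^sub>v (\<rho> s *\<^sub>v v)"
        using ev[OF e'] R(1)[OF sc] v by (simp add: mult_mat_vec)
      finally show ?thesis .
    qed
  qed (use sep w in blast)
qed

end

section \<open>Groups that are nilpotent of class two modulo a subgroup\<close>

lemma smult_one_mat: "A \<in> carrier_mat d e \<Longrightarrow> 1 \<cdot>\<^sub>m (A :: 'a::semiring_1 mat) = A"
  by (intro eq_matI) auto

context group
begin

text \<open>The condition on g (t i)^-1 selects the right coset of \<open>B\<close> containing g;
  this is the form in which coset representatives enter the entries of an induced matrix.\<close>

lemma transversal:
  assumes fin: "finite (carrier G)" and B: "subgroup B G" and m: "card B * m = card (carrier G)"
  shows "\<exists>t. (\<forall>i<m. t i \<in> carrier G) \<and> (\<forall>g\<in>carrier G. \<exists>!i. i < m \<and> g \<otimes> inv (t i) \<in> B)"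
proof -
  have "card (rcosets B) * card B = card (carrier G)"
    using lagrange[OF B] by (simp add: Coset.order_def)
  moreover have "card B > 0" using B fin subgroup.finite_imp_card_positive by blast
  ultimately have cm: "card (rcosets B) = m" using m by (metis mult.commute nat_mult_eq_cancel1)
  have "finite (rcosets B)" using fin unfolding RCOSETS_def by auto
  then obtain c where c: "bij_betw c {..<m} (rcosets B)"
    using cm by (metis atLeast0LessThan ex_bij_betw_nat_finite)
  define t where "t i = (SOME x. x \<in> carrier G \<and> c i = B #> x)" for i
  have t: "t i \<in> carrier G \<and> c i = B #> t i" if "i < m" for i
  proof -
    have "c i \<in> rcosets B" using c that by (auto simp: bij_betw_def)
    then have "\<exists>x. x \<in> carrier G \<and> c i = B #> x" by (auto simp: RCOSETS_def)
    then show ?thesis unfolding t_def by (rule someI_ex)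
  qed
  have iff: "g \<otimes> inv (t i) \<in> B \<longleftrightarrow> c i = B #> g" if "i < m" "g \<in> carrier G" for i g
    using t[OF that(1)] that subgroup.rcos_module[OF B is_group] repr_independence[OF _ _ B] rcos_self[OF _ B]
    by metis
  have "\<exists>!i. i < m \<and> g \<otimes> inv (t i) \<in> B" if g: "g \<in> carrier G" for g
  proof -
    have "B #> g \<in> rcosets B" using g by (auto simp: RCOSETS_def)
    then obtain i where i: "i < m" "c i = B #> g" using c by (metis bij_betw_imp_surj_on imageE lessThan_iff)
    show ?thesis
    proof (rule ex1I)
      show "i < m \<and> g \<otimes> inv (t i) \<in> B" using i iff g by blast
      fix j assume "j < m \<and> g \<otimes> inv (t j) \<in> B"
      then have "j < m" "c j = c i" using i iff g by auto
      then show "j = i" using c i by (auto simp: bij_betw_def inj_on_def)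
    qed
  qed
  then show ?thesis using t by (intro exI[of _ t]) simp
qed

text \<open>The induced representation in monomial form: entry (i, j) at g is w (t_i g t_j^-1),
  which is 0 unless the argument lies in \<open>B\<close>. On the normal subgroup \<open>B\<close>
  it is diagonal, its entries being the conjugates of \<open>w\<close>, and \<open>sep\<close> makes
  these distinct. Hence a nonzero invariant subspace contains a unit vector, and \<open>G\<close>
  moves this to all others. The last clause records where \<open>B\<close> acts by scalars; the
  character will be identified through it.\<close>

lemma induced_irreducible:
  assumes fin: "finite (carrier G)" and B: "subgroup B G"
    and nrm: "\<And>g b. g \<in> carrier G \<Longrightarrow> b \<in> B \<Longrightarrow> g \<otimes> b \<otimes> inv g \<in> B"
    and w: "w \<in> lin_chars G B" and m: "card B * m = card (carrier G)"
    and sep: "\<And>g. g \<in> carrier G \<Longrightarrow> g \<notin> B \<Longrightarrow> \<exists>b\<in>B. w (g \<otimes> b \<otimes> inv g) \<noteq> w b"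
  shows "\<exists>\<rho>. irreducible_rep G m \<rho> \<and>
    (\<forall>b\<in>B. (\<forall>g\<in>carrier G. w (g \<otimes> b \<otimes> inv g) = w b) \<longrightarrow> \<rho> b = w b \<cdot>\<^sub>m 1\<^sub>m m)"
proof -
  have BC: "\<And>x. x \<in> B \<Longrightarrow> x \<in> carrier G" using subgroup.mem_carrier[OF B] .
  note Bm = subgroup.m_closed[OF B] and Bi = subgroup.m_inv_closed[OF B] and B1 = subgroup.one_closed[OF B]
  obtain t where t: "(\<forall>i<m. t i \<in> carrier G) \<and> (\<forall>g\<in>carrier G. \<exists>!i. i < m \<and> g \<otimes> inv (t i) \<in> B)"
    using transversal[OF fin B m] ..
  have tc: "\<And>i. i < m \<Longrightarrow> t i \<in> carrier G" using t by simp
  have t1: "\<And>g. g \<in> carrier G \<Longrightarrow> \<exists>!i. i < m \<and> g \<otimes> inv (t i) \<in> B" using t by simp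
  have m0: "m > 0" using t1[OF one_closed] by auto
  have tt: "t i \<otimes> inv (t j) \<in> B \<longleftrightarrow> i = j" if "i < m" "j < m" for i j
    using t1[OF tc[OF that(1)]] that tc B1 by (metis r_inv)
  define r where "r g = mat m m (\<lambda>(i, j). w (t i \<otimes> g \<otimes> inv (t j)))" for g
  have rc: "r g \<in> carrier_mat m m" for g by (simp add: r_def)
  have ri: "r g $$ (i, j) = w (t i \<otimes> g \<otimes> inv (t j))" if "i < m" "j < m" for g i j
    using that by (simp add: r_def)
  have w1: "w \<one> = 1" by (rule lin_chars_one[OF w B])
  have wmult: "w (a \<otimes> b) = w a * w b" if "a \<in> B" "b \<in> carrier G" for a b
  proof (cases "b \<in> B")
    case True then show ?thesis using lin_chars_mult[OF w] that by blast
  next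
    case False
    have "a \<otimes> b \<notin> B"
    proof
      assume "a \<otimes> b \<in> B"
      then have "inv a \<otimes> (a \<otimes> b) \<in> B" using Bm Bi that by blast
      then show False using False that BC by (simp add: m_assoc[symmetric])
    qed
    then show ?thesis using False lin_chars_out[OF w] by simp
  qed
  have rep: "complex_rep G m r"
    unfolding complex_rep_def
  proof (intro conjI ballI)
    show "r g \<in> carrier_mat m m" for g by (rule rc)
    show "r \<one> = 1\<^sub>m m"
      using tc tt w1 lin_chars_out[OF w] by (intro eq_matI) (auto simp: r_def)
    fix g h assume g: "g \<in> carrier G" and h: "h \<in> carrier G"
    show "r (g \<otimes> h) = r g * r h"
    proof (rule eq_matI)
      fix i j assume "i < dim_row (r g * r h)" "j < dim_col (r g * r h)"
      then have ij: "i < m" "j < m" by (auto simp: r_def)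
      have "t i \<otimes> g \<in> carrier G" using tc ij g by simp
      then obtain k where k: "k < m" "t i \<otimes> g \<otimes> inv (t k) \<in> B"
        and ku: "\<And>l. l < m \<Longrightarrow> t i \<otimes> g \<otimes> inv (t l) \<in> B \<Longrightarrow> l = k" using t1 by metis
      have "(r g * r h) $$ (i, j) = (\<Sum>l<m. w (t i \<otimes> g \<otimes> inv (t l)) * w (t l \<otimes> h \<otimes> inv (t j)))"
        using index_mult_mat_sum[OF rc rc ij] ij by (simp add: ri)
      also have "\<dots> = (\<Sum>l<m. if l = k then w (t i \<otimes> g \<otimes> inv (t k)) * w (t k \<otimes> h \<otimes> inv (t j)) else 0)"
      proof (rule sum.cong[OF refl])
        fix l assume "l \<in> {..<m}"
        then show "w (t i \<otimes> g \<otimes> inv (t l)) * w (t l \<otimes> h \<otimes> inv (t j))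
          = (if l = k then w (t i \<otimes> g \<otimes> inv (t k)) * w (t k \<otimes> h \<otimes> inv (t j)) else 0)"
          using ku[of l] lin_chars_out[OF w, of "t i \<otimes> g \<otimes> inv (t l)"] by auto
      qed
      also have "\<dots> = w (t i \<otimes> g \<otimes> inv (t k)) * w (t k \<otimes> h \<otimes> inv (t j))" using k by simp
      also have "\<dots> = w ((t i \<otimes> g \<otimes> inv (t k)) \<otimes> (t k \<otimes> h \<otimes> inv (t j)))"
        using wmult k tc ij h by simp
      also have "(t i \<otimes> g \<otimes> inv (t k)) \<otimes> (t k \<otimes> h \<otimes> inv (t j)) = t i \<otimes> (g \<otimes> h) \<otimes> inv (t j)"
      proof -
        have "inv (t k) \<otimes> (t k \<otimes> (h \<otimes> inv (t j))) = h \<otimes> inv (t j)"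
          using tc k ij h by (simp add: m_assoc[symmetric])
        then show ?thesis using tc k ij g h by (simp add: m_assoc)
      qed
      finally show "r (g \<otimes> h) $$ (i, j) = (r g * r h) $$ (i, j)" using ij by (simp add: ri)
    qed (auto simp: r_def)
  qed
  have conj_in: "t i \<otimes> b \<otimes> inv (t j) \<in> B \<longleftrightarrow> i = j" if "i < m" "j < m" "b \<in> B" for i j b
  proof -
    have ti: "t i \<in> carrier G" and tj: "t j \<in> carrier G" and bc: "b \<in> carrier G"
      using tc that BC by auto
    have "inv (t i) \<otimes> (t i \<otimes> inv (t j)) = inv (t j)"
      using m_assoc[of "inv (t i)" "t i" "inv (t j)"] ti tj by simp
    then have e: "t i \<otimes> b \<otimes> inv (t j) = (t i \<otimes> b \<otimes> inv (t i)) \<otimes> (t i \<otimes> inv (t j))"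
      using ti tj bc by (simp add: m_assoc)
    have c: "t i \<otimes> b \<otimes> inv (t i) \<in> B" using nrm tc that by blast
    have "t i \<otimes> b \<otimes> inv (t j) \<in> B \<longleftrightarrow> t i \<otimes> inv (t j) \<in> B"
    proof
      assume "t i \<otimes> b \<otimes> inv (t j) \<in> B"
      then have "inv (t i \<otimes> b \<otimes> inv (t i)) \<otimes> ((t i \<otimes> b \<otimes> inv (t i)) \<otimes> (t i \<otimes> inv (t j))) \<in> B"
        unfolding e[symmetric] using c Bi Bm by blast
      then show "t i \<otimes> inv (t j) \<in> B"
        using BC[OF c] ti tj m_assoc[of "inv (t i \<otimes> b \<otimes> inv (t i))" "t i \<otimes> b \<otimes> inv (t i)" "t i \<otimes> inv (t j)"]
        by simp
    next
      assume "t i \<otimes> inv (t j) \<in> B"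
      then show "t i \<otimes> b \<otimes> inv (t j) \<in> B" unfolding e using c Bm by blast
    qed
    then show ?thesis using tt that by blast
  qed
  have rB: "r b $$ (i, j) = (if i = j then w (t i \<otimes> b \<otimes> inv (t i)) else 0)"
    if "i < m" "j < m" "b \<in> B" for i j b
    using conj_in[OF that] lin_chars_out[OF w] ri that by auto
  have rBv: "r b *\<^sub>v v = vec m (\<lambda>i. w (t i \<otimes> b \<otimes> inv (t i)) * v $ i)"
    if b: "b \<in> B" and v: "v \<in> carrier_vec m" for b v
  proof (rule eq_vecI)
    fix i assume "i < dim_vec (vec m (\<lambda>i. w (t i \<otimes> b \<otimes> inv (t i)) * v $ i))"
    then have i: "i < m" by simp
    have "(r b *\<^sub>v v) $ i = (\<Sum>k<m. r b $$ (i, k) * v $ k)" by (rule index_mult_vec_sum[OF rc v i])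
    also have "\<dots> = (\<Sum>k<m. if k = i then w (t i \<otimes> b \<otimes> inv (t i)) * v $ i else 0)"
      using i b by (intro sum.cong refl) (auto simp: rB)
    finally show "(r b *\<^sub>v v) $ i = vec m (\<lambda>i. w (t i \<otimes> b \<otimes> inv (t i)) * v $ i) $ i" using i by simp
  qed (use rc[of b] in auto)
  have "W = {0\<^sub>v m} \<or> W = carrier_vec m" if inv: "invariant_subspace G m r W" for W
  proof (cases "W = {0\<^sub>v m}")
    case False
    have Wc: "W \<subseteq> carrier_vec m" and W0: "0\<^sub>v m \<in> W"
      and Wa: "\<And>x y. x \<in> W \<Longrightarrow> y \<in> W \<Longrightarrow> x + y \<in> W"
      and Ws: "\<And>c x. x \<in> W \<Longrightarrow> c \<cdot>\<^sub>v x \<in> W"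
      and Wg: "\<And>g x. g \<in> carrier G \<Longrightarrow> x \<in> W \<Longrightarrow> r g *\<^sub>v x \<in> W"
      using inv unfolding invariant_subspace_def by auto
    obtain x where x: "x \<in> W" "x \<noteq> 0\<^sub>v m" using False W0 by blast
    have "\<exists>i<m. unit_vec m i \<in> W"
    proof (rule unit_vec_in_diag_invariant[where S = B and D = "\<lambda>b i. w (t i \<otimes> b \<otimes> inv (t i))", OF Wc Wa Ws _ _ x])
      show "vec m (\<lambda>i. w (t i \<otimes> s \<otimes> inv (t i)) * v $ i) \<in> W" if "s \<in> B" "v \<in> W" for s v
        using Wg[of s v] rBv[of s v] that Wc BC by auto
      show "\<exists>s\<in>B. w (t i \<otimes> s \<otimes> inv (t i)) \<noteq> w (t j \<otimes> s \<otimes> inv (t j))"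
        if ij: "i < m" "j < m" "i \<noteq> j" for i j
      proof -
        \<comment> \<open>Evaluating the i-th and j-th diagonal characters at t_j^-1 b t_j turns
          their comparison into that of w (g b g^-1) with w b, to which \<open>sep\<close>
          applies.\<close>
        define g where "g = t i \<otimes> inv (t j)"
        have gc: "g \<in> carrier G" using tc ij by (simp add: g_def)
        have "g \<notin> B" using tt ij by (simp add: g_def)
        then obtain b where b: "b \<in> B" "w (g \<otimes> b \<otimes> inv g) \<noteq> w b" using sep gc by blast
        have bc: "b \<in> carrier G" using b BC by blast
        have tj: "t j \<in> carrier G" and ti: "t i \<in> carrier G" using tc ij by auto
        have s: "inv (t j) \<otimes> b \<otimes> t j \<in> B" using nrm[of "inv (t j)" b] b tj by simp
        have e1: "t i \<otimes> (inv (t j) \<otimes> b \<otimes> t j) \<otimes> inv (t i) = g \<otimes> b \<otimes> inv g"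
          using ti tj bc by (simp add: g_def inv_mult_group m_assoc)
        have e2: "t j \<otimes> (inv (t j) \<otimes> b \<otimes> t j) \<otimes> inv (t j) = b"
        proof -
          have "t j \<otimes> (inv (t j) \<otimes> b \<otimes> t j) \<otimes> inv (t j) = (t j \<otimes> inv (t j)) \<otimes> b \<otimes> (t j \<otimes> inv (t j))"
            using tj bc by (simp only: m_assoc inv_closed m_closed)
          then show ?thesis using tj bc by simp
        qed
        show ?thesis by (rule bexI[OF _ s]) (use e1 e2 b in simp)
      qed
    qed blast+
    then obtain i where i: "i < m" "unit_vec m i \<in> W" by blast
    have U: "unit_vec m j \<in> W" if j: "j < m" for j
    proof -
      \<comment> \<open>This g sends the i-th unit vector to the j-th: t_k g t_i^-1 = t_k t_j^-1
        lies in \<open>B\<close> only for k = j, where it is the identity.\<close>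
      define g where "g = inv (t j) \<otimes> t i"
      have gc: "g \<in> carrier G" using tc i j by (simp add: g_def)
      have "r g *\<^sub>v unit_vec m i = unit_vec m j"
      proof (rule eq_vecI)
        fix k assume "k < dim_vec (unit_vec m j)"
        then have k: "k < m" by simp
        have "t k \<otimes> g \<otimes> inv (t i) = t k \<otimes> inv (t j)"
          using tc k i j by (simp add: g_def m_assoc)
        then have "r g $$ (k, i) = (if k = j then 1 else 0)"
          using tt[OF k j] ri[OF k i(1)] w1 lin_chars_out[OF w] tc k by auto
        moreover have "(r g *\<^sub>v unit_vec m i) $ k = r g $$ (k, i)"
          using k i rc[of g] by (simp add: scalar_prod_right_unit)
        ultimately show "(r g *\<^sub>v unit_vec m i) $ k = unit_vec m j $ k" using k j by simp
      qed (use rc[of g] in auto)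
      then show ?thesis using Wg[OF gc i(2)] by simp
    qed
    have "v \<in> W" if v: "v \<in> carrier_vec m" for v
    proof -
      have "vec m (\<lambda>i. if i < k then v $ i else 0) \<in> W" if "k \<le> m" for k
        using that
      proof (induction k)
        case 0
        have "vec m (\<lambda>i. if i < 0 then v $ i else 0) = 0\<^sub>v m" by auto
        then show ?case using W0 by simp
      next
        case (Suc k)
        have "vec m (\<lambda>i. if i < Suc k then v $ i else 0) = vec m (\<lambda>i. if i < k then v $ i else 0) + v $ k \<cdot>\<^sub>v unit_vec m k"
          using Suc.prems by (intro eq_vecI) (auto simp: less_Suc_eq)
        then show ?case using Suc Wa Ws U by simp
      qed
      from this[of m] show ?thesis
      proof -
        assume "m \<le> m \<Longrightarrow> vec m (\<lambda>i. if i < m then v $ i else 0) \<in> W"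
        moreover have "vec m (\<lambda>i. if i < m then v $ i else 0) = v" using v by (intro eq_vecI) auto
        ultimately show ?thesis by simp
      qed
    qed
    then show ?thesis using Wc by blast
  qed simp
  then have "irreducible_rep G m r" using rep m0 by (simp add: irreducible_rep_def)
  moreover have "r b = w b \<cdot>\<^sub>m 1\<^sub>m m" if b: "b \<in> B" and st: "\<forall>g\<in>carrier G. w (g \<otimes> b \<otimes> inv g) = w b" for b
    using rB b st tc by (intro eq_matI) (auto simp: r_def)
  ultimately show ?thesis by blast
qed

end

text \<open>The quotient by \<open>N\<close> has class at most two, with the image of
  \<open>Z\<close> central and containing all commutators. The quotient is never formed:
  \<open>N\<close> stays inside, and everything attached to it is required to be trivial on
  \<open>N\<close>.\<close>

locale class_two = group +
  fixes Z N
  assumes fin: "finite (carrier G)" and Z: "subgroup Z G" and N: "subgroup N G" and NZ: "N \<subseteq> Z"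
    and comm_Z: "x \<in> carrier G \<Longrightarrow> y \<in> carrier G \<Longrightarrow> \<exists>c\<in>Z. x \<otimes> y = y \<otimes> x \<otimes> c"
    and comm_N: "x \<in> carrier G \<Longrightarrow> z \<in> Z \<Longrightarrow> \<exists>c\<in>N. x \<otimes> z = z \<otimes> x \<otimes> c"
begin

text \<open>This is x^-1 y^-1 x y, written as the right factor that corrects y x to x y.\<close>

definition commut :: "'a \<Rightarrow> 'a \<Rightarrow> 'a" where
  "commut x y = inv (y \<otimes> x) \<otimes> (x \<otimes> y)"

definition central_chars :: "('a \<Rightarrow> complex) set" where
  "central_chars = {w \<in> lin_chars G Z. \<forall>n\<in>N. w n = 1}"

definition radical :: "('a \<Rightarrow> complex) \<Rightarrow> 'a set" where
  "radical w = {x \<in> carrier G. \<forall>y\<in>carrier G. w (commut x y) = 1}"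

text \<open>The last two conditions together say that \<open>B\<close> is its own orthogonal for the
  form \<open>w (commut x y)\<close>.\<close>

definition polarization :: "nat \<Rightarrow> ('a \<Rightarrow> complex) \<Rightarrow> 'a set \<Rightarrow> bool" where
  "polarization q w B \<longleftrightarrow> subgroup B G \<and> radical w \<subseteq> B \<and> card B * q = card (carrier G) \<and>
    (\<forall>x\<in>B. \<forall>y\<in>B. w (commut x y) = 1) \<and> (\<forall>x\<in>carrier G - B. \<exists>y\<in>B. w (commut x y) \<noteq> 1)"

lemma ZC: "z \<in> Z \<Longrightarrow> z \<in> carrier G" using subgroup.mem_carrier[OF Z] .

lemma commut_unique:
  assumes "x \<in> carrier G" "y \<in> carrier G" "c \<in> carrier G" "x \<otimes> y = y \<otimes> x \<otimes> c"
  shows "commut x y = c"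
  using assms inv_solve_left[of c "y \<otimes> x" "x \<otimes> y"] unfolding commut_def by simp

lemma commut_in: "x \<in> carrier G \<Longrightarrow> y \<in> carrier G \<Longrightarrow> commut x y \<in> Z"
  using comm_Z commut_unique ZC by metis

lemma commut_eq: "x \<in> carrier G \<Longrightarrow> y \<in> carrier G \<Longrightarrow> x \<otimes> y = y \<otimes> x \<otimes> commut x y"
  using comm_Z commut_unique ZC by metis

lemma central_charsD:
  assumes "w \<in> central_chars" shows "w \<in> lin_chars G Z" "n \<in> N \<Longrightarrow> w n = 1" "w \<one> = 1"
  using assms lin_chars_one[OF _ Z] by (auto simp: central_chars_def)

lemma central_move:
  assumes w: "w \<in> central_chars" and x: "x \<in> carrier G" and z: "z \<in> Z"
  shows "\<exists>z'\<in>Z. z \<otimes> x = x \<otimes> z' \<and> w z' = w z"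
proof -
  obtain n where n: "n \<in> N" "x \<otimes> z = z \<otimes> x \<otimes> n" using comm_N x z by blast
  have nc: "n \<in> carrier G" "inv n \<in> N" "inv n \<in> Z"
    using n NZ subgroup.m_inv_closed[OF N] ZC by auto
  have "z \<otimes> x = x \<otimes> z \<otimes> inv n" using n nc x z ZC by (simp add: m_assoc)
  then have "z \<otimes> x = x \<otimes> (z \<otimes> inv n)" using nc x z ZC by (simp add: m_assoc)
  moreover have "w (z \<otimes> inv n) = w z"
    using lin_chars_mult[OF central_charsD(1)[OF w] z nc(3)] central_charsD(2)[OF w nc(2)] by simp
  ultimately show ?thesis using subgroup.m_closed[OF Z z nc(3)] by blast
qed

text \<open>Moving y through x x' gives [x x', y] = z [x', y], where z is [x, y] carried past x'. By
  \<open>central_move\<close> the value of \<open>w\<close> does not change on the way, so the form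
  is multiplicative in its first argument.\<close>

lemma form_mult_left:
  assumes w: "w \<in> central_chars" and x: "x \<in> carrier G" and x': "x' \<in> carrier G" and y: "y \<in> carrier G"
  shows "w (commut (x \<otimes> x') y) = w (commut x y) * w (commut x' y)"
proof -
  note c = commut_in[OF x y] commut_in[OF x' y]
  obtain z where z: "z \<in> Z" "commut x y \<otimes> x' = x' \<otimes> z" "w z = w (commut x y)"
    using central_move[OF w x' c(1)] by blast
  have "x \<otimes> x' \<otimes> y = x \<otimes> (y \<otimes> x' \<otimes> commut x' y)" using commut_eq[OF x' y] x x' y by (simp add: m_assoc)
  also have "\<dots> = (x \<otimes> y) \<otimes> (x' \<otimes> commut x' y)" using x x' y c ZC by (simp add: m_assoc)
  also have "\<dots> = (y \<otimes> x) \<otimes> (commut x y \<otimes> x') \<otimes> commut x' y"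
    using commut_eq[OF x y] x x' y c ZC by (simp add: m_assoc)
  also have "\<dots> = y \<otimes> (x \<otimes> x') \<otimes> (z \<otimes> commut x' y)"
    unfolding z(2) using x x' y c z(1) ZC by (simp add: m_assoc)
  finally have "commut (x \<otimes> x') y = z \<otimes> commut x' y"
    using x x' y c z ZC by (intro commut_unique) auto
  then show ?thesis using lin_chars_mult[OF central_charsD(1)[OF w] z(1) c(2)] z(3) by simp
qed

lemma form_swap:
  assumes w: "w \<in> central_chars" and x: "x \<in> carrier G" and y: "y \<in> carrier G"
  shows "w (commut y x) = inverse (w (commut x y))"
proof -
  have "commut y x = inv (commut x y)"
    using x y unfolding commut_def by (simp add: inv_mult_group)
  then show ?thesis using lin_chars_inv[OF central_charsD(1)[OF w] Z commut_in[OF x y]] by simp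
qed

lemma form_central:
  assumes w: "w \<in> central_chars" and x: "x \<in> carrier G" and z: "z \<in> Z"
  shows "w (commut x z) = 1" "w (commut z x) = 1"
proof -
  obtain n where "n \<in> N" "x \<otimes> z = z \<otimes> x \<otimes> n" using comm_N x z by blast
  then show 1: "w (commut x z) = 1" using commut_unique x z ZC NZ central_charsD(2)[OF w] by (metis subsetD)
  show "w (commut z x) = 1" using form_swap[OF w x ZC[OF z]] 1 by simp
qed

text \<open>It translates between conjugates of a character, which decide irreducibility of an
  induced representation, and values of the commutator form.\<close>

lemma conj_commut:
  assumes w: "w \<in> central_chars" and x: "x \<in> carrier G" and y: "y \<in> carrier G"
  shows "\<exists>c\<in>Z. x \<otimes> y \<otimes> inv x = y \<otimes> c \<and> w c = w (commut x y)"
proof -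
  note c = commut_in[OF x y]
  obtain z where z: "z \<in> Z" "commut x y \<otimes> inv x = inv x \<otimes> z" "w z = w (commut x y)"
    using central_move[OF w inv_closed[OF x] c] by blast
  have "x \<otimes> y \<otimes> inv x = y \<otimes> x \<otimes> (commut x y \<otimes> inv x)" using commut_eq[OF x y] x y c ZC by (simp add: m_assoc)
  also have "\<dots> = y \<otimes> (x \<otimes> inv x) \<otimes> z" unfolding z(2) using x y z(1) ZC by (simp only: m_assoc m_closed inv_closed)
  finally show ?thesis using x y z by auto
qed

lemma radical_subgroup:
  assumes w: "w \<in> central_chars" shows "subgroup (radical w) G" "Z \<subseteq> radical w"
proof -
  show ZR: "Z \<subseteq> radical w" using form_central[OF w] ZC by (auto simp: radical_def)
  show "subgroup (radical w) G"
  proof (rule finite_subgroupI)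
    show "finite (radical w)" using fin by (auto simp: radical_def)
    show "radical w \<subseteq> carrier G" by (auto simp: radical_def)
    show "radical w \<noteq> {}" using ZR subgroup.one_closed[OF Z] by auto
    show "x \<otimes> y \<in> radical w" if "x \<in> radical w" "y \<in> radical w" for x y
      using that form_mult_left[OF w] by (auto simp: radical_def)
  qed
qed

lemma card_isotropic_exts:
  assumes w: "w \<in> central_chars" and K: "subgroup K G" "Z \<subseteq> K"
    and iso: "\<And>x y. x \<in> K \<Longrightarrow> y \<in> K \<Longrightarrow> w (commut x y) = 1"
  shows "finite (lin_exts G w Z K)" "card (lin_exts G w Z K) * card Z = card K"
proof -
  have "finite (lin_exts G w Z K) \<and> card (lin_exts G w Z K) * card Z = card K"
  proof (rule card_lin_exts[OF fin Z K central_charsD(1)[OF w]])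
    fix x y assume xy: "x \<in> K" "y \<in> K"
    then have "x \<in> carrier G" "y \<in> carrier G" using subgroup.mem_carrier[OF K(1)] by auto
    then show "\<exists>c\<in>Z. x \<otimes> y = y \<otimes> x \<otimes> c \<and> w c = 1"
      using commut_in commut_eq iso[OF xy] by blast
  qed
  then show "finite (lin_exts G w Z K)" "card (lin_exts G w Z K) * card Z = card K" by auto
qed

lemma finite_central_chars: "finite central_chars"
proof -
  let ?t = "\<lambda>x. if x \<in> N then 1 else (0::complex)"
  have "finite (lin_exts G ?t N Z)"
  proof (rule conjunct1[OF card_lin_exts[OF fin N Z NZ lin_chars_triv[OF N]]])
    fix x y assume "x \<in> Z" "y \<in> Z"
    then show "\<exists>c\<in>N. x \<otimes> y = y \<otimes> x \<otimes> c \<and> ?t c = 1" using comm_N[of x y] ZC by auto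
  qed
  moreover have "central_chars = lin_exts G ?t N Z" by (auto simp: central_chars_def lin_exts_def)
  ultimately show ?thesis by simp
qed

lemma scalar_lin_char:
  assumes rep: "complex_rep G d \<rho>" and d: "d > 0" and S: "subgroup S G"
    and sc: "\<And>s. s \<in> S \<Longrightarrow> \<exists>c. \<rho> s = c \<cdot>\<^sub>m 1\<^sub>m d"
  shows "(\<lambda>s. if s \<in> S then \<rho> s $$ (0, 0) else 0) \<in> lin_chars G S"
    and "s \<in> S \<Longrightarrow> \<rho> s = \<rho> s $$ (0, 0) \<cdot>\<^sub>m 1\<^sub>m d"
proof -
  note R = complex_repD[OF rep]
  show s: "\<rho> s = \<rho> s $$ (0, 0) \<cdot>\<^sub>m 1\<^sub>m d" if "s \<in> S" for s
    using sc[OF that] d by auto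
  have mult: "\<rho> (x \<otimes> y) $$ (0, 0) = \<rho> x $$ (0, 0) * \<rho> y $$ (0, 0)" if S2: "x \<in> S" "y \<in> S" for x y
  proof -
    have xy: "x \<in> carrier G" "y \<in> carrier G" using S2 subgroup.mem_carrier[OF S] by auto
    obtain a b where "\<rho> x = a \<cdot>\<^sub>m 1\<^sub>m d" "\<rho> y = b \<cdot>\<^sub>m 1\<^sub>m d" using sc S2 by metis
    then show ?thesis using R(3)[OF xy] d by simp
  qed
  show "(\<lambda>s. if s \<in> S then \<rho> s $$ (0, 0) else 0) \<in> lin_chars G S"
  proof (rule lin_charsI)
    fix x assume x: "x \<in> S"
    have "\<rho> (x \<otimes> inv x) $$ (0, 0) = \<rho> x $$ (0, 0) * \<rho> (inv x) $$ (0, 0)"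
      using mult x subgroup.m_inv_closed[OF S] by blast
    moreover have "\<rho> (x \<otimes> inv x) $$ (0, 0) = 1" using x subgroup.mem_carrier[OF S] R(2) d by simp
    ultimately show "(if x \<in> S then \<rho> x $$ (0, 0) else 0) \<noteq> 0" using x by auto
  qed (use mult subgroup.m_closed[OF S] in auto)
qed

text \<open>\<open>Z\<close> commutes with everything up to \<open>N\<close>, which acts trivially,
  so it acts by scalars \<open>w0\<close>. Then rho(g) and rho(h) commute up to the scalar
  \<open>w0 (commut g h)\<close>. On the radical this scalar is 1 for all h, and Schur applies
  again. Off the radical some h makes it different from 1, and conjugating by rho(h) shows that the
  trace at g equals a nontrivial multiple of itself. The norm relation, now a sum of d^2 over the
  radical, fixes the index.\<close>

lemma irreducible_character:
  assumes irr: "irreducible_rep G d \<rho>" and triv: "\<And>n. n \<in> N \<Longrightarrow> \<rho> n = 1\<^sub>m d"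
  shows "\<exists>w0\<in>central_chars. \<exists>w\<in>lin_exts G w0 Z (radical w0).
    card (radical w0) * d ^ 2 = card (carrier G) \<and> character G \<rho> = (\<lambda>g. of_nat d * w g)"
proof -
  have rep: "complex_rep G d \<rho>" and d: "d > 0" using irr by (auto simp: irreducible_rep_def)
  note R = complex_repD[OF rep]
  have NC: "n \<in> N \<Longrightarrow> n \<in> carrier G" for n using NZ ZC by blast
  have scZ: "\<exists>c. \<rho> z = c \<cdot>\<^sub>m 1\<^sub>m d" if z: "z \<in> Z" for z
  proof (rule schur_scalar[OF irr R(1)[OF ZC[OF z]]])
    fix g assume g: "g \<in> carrier G"
    obtain n where n: "n \<in> N" "g \<otimes> z = z \<otimes> g \<otimes> n" using comm_N g z by blast
    have "\<rho> g * \<rho> z = \<rho> (z \<otimes> g \<otimes> n)" using R(3)[OF g ZC[OF z]] n by simp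
    also have "\<dots> = \<rho> z * \<rho> g" using n g z ZC NC triv[OF n(1)] R(1)[OF ZC[OF z]] R(1)[OF g]
      by (simp add: R(3))
    finally show "\<rho> g * \<rho> z = \<rho> z * \<rho> g" .
  qed
  define w0 where "w0 = (\<lambda>z. if z \<in> Z then \<rho> z $$ (0, 0) else 0)"
  have w0: "w0 \<in> central_chars"
    using scalar_lin_char(1)[OF rep d Z scZ] triv NZ d by (auto simp: central_chars_def w0_def)
  have rz: "\<rho> z = w0 z \<cdot>\<^sub>m 1\<^sub>m d" if "z \<in> Z" for z
    using scalar_lin_char(2)[OF rep d Z scZ that] that by (simp add: w0_def)
  have rcomm: "\<rho> g * \<rho> h = w0 (commut g h) \<cdot>\<^sub>m (\<rho> h * \<rho> g)" if gh: "g \<in> carrier G" "h \<in> carrier G" for g h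
  proof -
    have c: "commut g h \<in> Z" by (rule commut_in[OF gh])
    have M: "\<rho> h * \<rho> g \<in> carrier_mat d d" using R(1) gh by (metis mult_carrier_mat)
    have "\<rho> g * \<rho> h = \<rho> (h \<otimes> g \<otimes> commut g h)" using R(3)[OF gh] commut_eq[OF gh] by simp
    also have "\<dots> = \<rho> h * \<rho> g * \<rho> (commut g h)" using R(3) gh ZC[OF c] by simp
    also have "\<dots> = w0 (commut g h) \<cdot>\<^sub>m (\<rho> h * \<rho> g)"
      unfolding rz[OF c] mult_smult_distrib[OF M one_carrier_mat] right_mult_one_mat[OF M] ..
    finally show ?thesis .
  qed
  have RS: "subgroup (radical w0) G" "Z \<subseteq> radical w0" using radical_subgroup[OF w0] by auto
  have RC: "x \<in> carrier G" if "x \<in> radical w0" for x using that by (simp add: radical_def)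
  have scR: "\<exists>c. \<rho> x = c \<cdot>\<^sub>m 1\<^sub>m d" if x: "x \<in> radical w0" for x
  proof (rule schur_scalar[OF irr R(1)[OF RC[OF x]]])
    fix g assume g: "g \<in> carrier G"
    have "w0 (commut x g) = 1" using x g by (simp add: radical_def)
    then have "\<rho> x * \<rho> g = 1 \<cdot>\<^sub>m (\<rho> g * \<rho> x)" using rcomm[OF RC[OF x] g] by simp
    then show "\<rho> g * \<rho> x = \<rho> x * \<rho> g" using R(1)[OF RC[OF x]] R(1)[OF g]
      by (metis mult_carrier_mat smult_one_mat)
  qed
  define w where "w = (\<lambda>x. if x \<in> radical w0 then \<rho> x $$ (0, 0) else 0)"
  have wl: "w \<in> lin_chars G (radical w0)"
    unfolding w_def by (rule scalar_lin_char(1)[OF rep d RS(1) scR])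
  have rx: "\<rho> x = w x \<cdot>\<^sub>m 1\<^sub>m d" if "x \<in> radical w0" for x
    using scalar_lin_char(2)[OF rep d RS(1) scR that] that by (simp add: w_def)
  have we: "w \<in> lin_exts G w0 Z (radical w0)"
    using wl RS(2) by (auto simp: lin_exts_def w_def w0_def)
  have tr: "mat_trace (\<rho> g) = of_nat d * w g" if g: "g \<in> carrier G" for g
  proof (cases "g \<in> radical w0")
    case True
    then show ?thesis using rx[OF True] by (simp add: mat_trace_def)
  next
    case False
    then obtain h where h: "h \<in> carrier G" "w0 (commut g h) \<noteq> 1" using g by (auto simp: radical_def)
    note Rg = R(1)[OF g] and Rh = R(1)[OF h(1)] and Ri = R(1)[OF inv_closed[OF h(1)]]
    have hi: "\<rho> (inv h) * \<rho> h = 1\<^sub>m d" "\<rho> h * \<rho> (inv h) = 1\<^sub>m d"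
      using R(3)[OF inv_closed[OF h(1)] h(1)] R(3)[OF h(1) inv_closed[OF h(1)]] h(1) R(2) by auto
    have M: "\<rho> h * \<rho> g \<in> carrier_mat d d" "\<rho> g * \<rho> h \<in> carrier_mat d d" using Rg Rh by auto
    have "mat_trace (\<rho> g) = mat_trace (\<rho> g * (\<rho> h * \<rho> (inv h)))" using hi Rg by simp
    also have "\<dots> = mat_trace ((\<rho> g * \<rho> h) * \<rho> (inv h))" using assoc_mult_mat[OF Rg Rh Ri] by simp
    also have "\<dots> = mat_trace (\<rho> (inv h) * (w0 (commut g h) \<cdot>\<^sub>m (\<rho> h * \<rho> g)))"
      unfolding mat_trace_comm[OF M(2) Ri] unfolding rcomm[OF g h(1)] ..
    also have "\<dots> = mat_trace (w0 (commut g h) \<cdot>\<^sub>m (\<rho> (inv h) * (\<rho> h * \<rho> g)))"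
      using mult_smult_distrib[OF Ri M(1)] by simp
    also have "\<rho> (inv h) * (\<rho> h * \<rho> g) = \<rho> g" using assoc_mult_mat[OF Ri Rh Rg] hi Rg by simp
    also have "mat_trace (w0 (commut g h) \<cdot>\<^sub>m \<rho> g) = w0 (commut g h) * mat_trace (\<rho> g)"
      using Rg by (simp add: mat_trace_def sum_distrib_left)
    finally have "mat_trace (\<rho> g) = w0 (commut g h) * mat_trace (\<rho> g)" .
    then have "(1 - w0 (commut g h)) * mat_trace (\<rho> g) = 0" by (simp add: left_diff_distrib)
    then have "mat_trace (\<rho> g) = 0" using h(2) by simp
    then show ?thesis using False by (simp add: w_def)
  qed
  have ch: "character G \<rho> = (\<lambda>g. of_nat d * w g)"
    using tr RC by (auto simp: character_def w_def)
  have "of_nat (card (carrier G)) = (\<Sum>g\<in>carrier G. mat_trace (\<rho> g) * mat_trace (\<rho> (inv g)))"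
    using character_norm[OF irr fin] by simp
  also have "\<dots> = (\<Sum>g\<in>carrier G. if g \<in> radical w0 then of_nat d ^ 2 else 0)"
  proof (rule sum.cong[OF refl])
    fix g assume g: "g \<in> carrier G"
    show "mat_trace (\<rho> g) * mat_trace (\<rho> (inv g)) = (if g \<in> radical w0 then of_nat d ^ 2 else 0)"
    proof (cases "g \<in> radical w0")
      case True
      then show ?thesis using tr[OF g] tr[OF inv_closed[OF g]] lin_chars_inv[OF wl RS(1) True] lin_chars_nz[OF wl True]
        by (simp add: power2_eq_square)
    next
      case False
      then show ?thesis using tr[OF g] lin_chars_out[OF wl] by simp
    qed
  qed
  also have "\<dots> = of_nat (card (radical w0)) * of_nat d ^ 2"
  proof -
    have "carrier G \<inter> radical w0 = radical w0" using RC by blast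
    then show ?thesis using fin by (simp add: sum.If_cases)
  qed
  finally have "card (radical w0) * d ^ 2 = card (carrier G)"
    by (metis of_nat_eq_iff of_nat_mult of_nat_power)
  then show ?thesis using w0 we ch by blast
qed

text \<open>Given \<open>w\<close> on the radical, isotropy of a polarization \<open>B\<close>
  allows an extension of \<open>w\<close> to \<open>B\<close>, and self-orthogonality makes the
  induced representation irreducible. Its degree is the index q of \<open>B\<close>.\<close>

lemma irr_chars_of_degree_eq:
  assumes q: "q > 0"
    and triv: "\<And>\<rho> n. irreducible_rep G q \<rho> \<Longrightarrow> n \<in> N \<Longrightarrow> \<rho> n = 1\<^sub>m q"
    and pol: "\<And>w. w \<in> central_chars \<Longrightarrow> card (radical w) * q ^ 2 = card (carrier G) \<Longrightarrow>
      \<exists>B. polarization q w B"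
  shows "irr_chars_of_degree G q = (\<lambda>w g. of_nat q * w g) `
    (\<Union>w0\<in>{w\<in>central_chars. card (radical w) * q ^ 2 = card (carrier G)}. lin_exts G w0 Z (radical w0))"
    (is "_ = ?F ` ?U")
proof (intro equalityI subsetI)
  fix \<chi> assume "\<chi> \<in> irr_chars_of_degree G q"
  then obtain \<rho> where r: "irreducible_rep G q \<rho>" "\<chi> = character G \<rho>"
    by (auto simp: irr_chars_of_degree_def)
  then show "\<chi> \<in> ?F ` ?U" using irreducible_character[OF r(1) triv[OF r(1)]] by blast
next
  fix \<chi> assume "\<chi> \<in> ?F ` ?U"
  then obtain w0 w where w0: "w0 \<in> central_chars" "card (radical w0) * q ^ 2 = card (carrier G)"
    and w: "w \<in> lin_exts G w0 Z (radical w0)" and chi: "\<chi> = ?F w" by blast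
  obtain B where B: "subgroup B G" "radical w0 \<subseteq> B" "card B * q = card (carrier G)"
    and iso: "\<And>x y. x \<in> B \<Longrightarrow> y \<in> B \<Longrightarrow> w0 (commut x y) = 1"
    and sep: "\<And>x. x \<in> carrier G \<Longrightarrow> x \<notin> B \<Longrightarrow> \<exists>y\<in>B. w0 (commut x y) \<noteq> 1"
    using pol[OF w0] unfolding polarization_def by blast
  note R = radical_subgroup[OF w0(1)]
  have BC: "\<And>b. b \<in> B \<Longrightarrow> b \<in> carrier G" using subgroup.mem_carrier[OF B(1)] .
  have ZB: "Z \<subseteq> B" using R B by blast
  have wl: "w \<in> lin_chars G (radical w0)" and wZ: "\<And>z. z \<in> Z \<Longrightarrow> w z = w0 z"
    using w by (auto simp: lin_exts_def)
  have "finite (lin_exts G w (radical w0) B) \<and> card (lin_exts G w (radical w0) B) * card (radical w0) = card B"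
  proof (rule card_lin_exts[OF fin R(1) B(1,2) wl])
    fix x y assume xy: "x \<in> B" "y \<in> B"
    then show "\<exists>c\<in>radical w0. x \<otimes> y = y \<otimes> x \<otimes> c \<and> w c = 1"
      using commut_in[OF BC BC] commut_eq[OF BC BC] iso[OF xy] wZ R(2) by (metis subsetD)
  qed
  moreover have "card B > 0" using B fin subgroup.finite_imp_card_positive by blast
  ultimately obtain wB where "wB \<in> lin_exts G w (radical w0) B" by fastforce
  then have wBl: "wB \<in> lin_chars G B" and wBR: "\<And>x. x \<in> radical w0 \<Longrightarrow> wB x = w x"
    by (auto simp: lin_exts_def)
  have wBZ: "wB z = w0 z" if "z \<in> Z" for z using that wBR wZ R(2) by auto
  have cj: "g \<otimes> b \<otimes> inv g \<in> B \<and> wB (g \<otimes> b \<otimes> inv g) = wB b * w0 (commut g b)"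
    if gb: "g \<in> carrier G" "b \<in> B" for g b
  proof -
    obtain c where c: "c \<in> Z" "g \<otimes> b \<otimes> inv g = b \<otimes> c" "w0 c = w0 (commut g b)"
      using conj_commut[OF w0(1) gb(1) BC[OF gb(2)]] by blast
    have cB: "c \<in> B" using c ZB by blast
    then show ?thesis using c gb lin_chars_mult[OF wBl gb(2) cB] subgroup.m_closed[OF B(1)] wBZ by simp
  qed
  obtain \<rho> where irr: "irreducible_rep G q \<rho>"
    and sc: "\<And>b. b \<in> B \<Longrightarrow> \<forall>g\<in>carrier G. wB (g \<otimes> b \<otimes> inv g) = wB b \<Longrightarrow> \<rho> b = wB b \<cdot>\<^sub>m 1\<^sub>m q"
  proof -
    have "\<exists>\<rho>. irreducible_rep G q \<rho> \<and>
      (\<forall>b\<in>B. (\<forall>g\<in>carrier G. wB (g \<otimes> b \<otimes> inv g) = wB b) \<longrightarrow> \<rho> b = wB b \<cdot>\<^sub>m 1\<^sub>m q)"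
    proof (rule induced_irreducible[OF fin B(1) _ wBl B(3)])
      fix g assume g: "g \<in> carrier G" "g \<notin> B"
      then obtain b where b: "b \<in> B" "w0 (commut g b) \<noteq> 1" using sep by blast
      then have "wB (g \<otimes> b \<otimes> inv g) \<noteq> wB b" using cj[OF g(1) b(1)] lin_chars_nz[OF wBl b(1)] by simp
      then show "\<exists>b\<in>B. wB (g \<otimes> b \<otimes> inv g) \<noteq> wB b" using b by blast
    qed (use cj in blast)
    then show ?thesis using that by blast
  qed
  have scR: "\<rho> x = w x \<cdot>\<^sub>m 1\<^sub>m q" if x: "x \<in> radical w0" for x
  proof -
    have xB: "x \<in> B" using x B by blast
    have "wB (g \<otimes> x \<otimes> inv g) = wB x" if g: "g \<in> carrier G" for g
    proof -
      have "w0 (commut g x) = inverse (w0 (commut x g))" by (rule form_swap[OF w0(1) BC[OF xB] g])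
      then have "w0 (commut g x) = 1" using x g by (simp add: radical_def)
      then show ?thesis using cj[OF g xB] by simp
    qed
    then show ?thesis using sc[OF xB] wBR[OF x] by simp
  qed
  \<comment> \<open>The induced trace is not computed. The representation is irreducible, so its
    character is q w' for some w' of the known shape, and the scalar action on the radical of
    \<open>w0\<close> forces w' = w.\<close>
  obtain w0' w' where w0': "w0' \<in> central_chars" and w': "w' \<in> lin_exts G w0' Z (radical w0')"
    and ch: "character G \<rho> = (\<lambda>g. of_nat q * w' g)"
    using irreducible_character[OF irr triv[OF irr]] by blast
  have eqR: "w' x = w x" if "x \<in> radical w0" for x
  proof -
    have xc: "x \<in> carrier G" using that by (simp add: radical_def)
    have "of_nat q * w' x = character G \<rho> x" by (simp add: ch)
    also have "\<dots> = of_nat q * w x" unfolding character_def using xc scR[OF that] by (simp add: mat_trace_def)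
    finally show ?thesis using q by simp
  qed
  have "w0' z = w0 z" for z
  proof (cases "z \<in> Z")
    case True
    then have "w0' z = w' z" using w' by (simp add: lin_exts_def)
    also have "\<dots> = w0 z" using eqR[of z] True R(2) wZ by auto
    finally show ?thesis .
  next
    case False
    then show ?thesis using lin_chars_out central_charsD(1) w0' w0(1) by metis
  qed
  then have e: "w0' = w0" by blast
  have "w' = w"
  proof
    fix x show "w' x = w x"
      using eqR[of x] w' wl unfolding e lin_exts_def by (cases "x \<in> radical w0") (auto simp: lin_chars_out)
  qed
  then show "\<chi> \<in> irr_chars_of_degree G q"
    using irr ch unfolding chi irr_chars_of_degree_def mem_Collect_eq by (intro exI[of _ \<rho>]) simp
qed

text \<open>Each w0 contributes |R : Z| extensions to its radical R, and |R : Z| |Z| q^2 = |G|.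
  Different w0 contribute disjoint sets because an extension restricts to w0 on
  \<open>Z\<close>.\<close>

lemma card_irr_chars_of_degree:
  assumes q: "q > 0"
    and triv: "\<And>\<rho> n. irreducible_rep G q \<rho> \<Longrightarrow> n \<in> N \<Longrightarrow> \<rho> n = 1\<^sub>m q"
    and pol: "\<And>w. w \<in> central_chars \<Longrightarrow> card (radical w) * q ^ 2 = card (carrier G) \<Longrightarrow>
      \<exists>B. polarization q w B"
  shows "card (irr_chars_of_degree G q) * card Z * q ^ 2 =
    card {w\<in>central_chars. card (radical w) * q ^ 2 = card (carrier G)} * card (carrier G)"
proof -
  let ?T = "{w\<in>central_chars. card (radical w) * q ^ 2 = card (carrier G)}"
  let ?E = "\<lambda>w0. lin_exts G w0 Z (radical w0)"
  have eq: "irr_chars_of_degree G q = (\<lambda>w g. of_nat q * w g) ` (\<Union>w0\<in>?T. ?E w0)"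
    by (rule irr_chars_of_degree_eq[OF q]; (rule triv | rule pol); assumption)
  have "inj (\<lambda>w g. of_nat q * w g :: complex)"
    using q by (auto simp: inj_def fun_eq_iff)
  then have "card (irr_chars_of_degree G q) = card (\<Union>w0\<in>?T. ?E w0)"
    unfolding eq by (rule card_image[OF inj_on_subset[OF _ subset_UNIV]])
  also have "\<dots> = (\<Sum>w0\<in>?T. card (?E w0))"
  proof (rule card_UN_disjoint)
    show "finite ?T" using finite_central_chars by simp
    show "\<forall>w0\<in>?T. finite (?E w0)"
      using card_isotropic_exts(1)[OF _ radical_subgroup] by (auto simp: radical_def)
    show "\<forall>w1\<in>?T. \<forall>w2\<in>?T. w1 \<noteq> w2 \<longrightarrow> ?E w1 \<inter> ?E w2 = {}"
    proof (intro ballI impI, rule ccontr)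
      fix w1 w2 assume w12: "w1 \<in> ?T" "w2 \<in> ?T" "w1 \<noteq> w2" "?E w1 \<inter> ?E w2 \<noteq> {}"
      then have "\<forall>z\<in>Z. w1 z = w2 z" unfolding lin_exts_def by auto
      moreover have "\<forall>z. z \<notin> Z \<longrightarrow> w1 z = w2 z" using w12 central_charsD(1) lin_chars_out by (metis (mono_tags, lifting) mem_Collect_eq)
      ultimately show False using w12(3) by blast
    qed
  qed
  finally have "card (irr_chars_of_degree G q) * card Z * q ^ 2 = (\<Sum>w0\<in>?T. card (?E w0) * card Z * q ^ 2)"
    by (simp add: sum_distrib_right)
  also have "\<dots> = (\<Sum>w0\<in>?T. card (carrier G))"
  proof (rule sum.cong[OF refl])
    fix w0 assume w0: "w0 \<in> ?T"
    have "card (?E w0) * card Z = card (radical w0)"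
      by (rule card_isotropic_exts(2)) (use w0 radical_subgroup in \<open>auto simp: radical_def\<close>)
    then show "card (?E w0) * card Z * q ^ 2 = card (carrier G)" using w0 by simp
  qed
  finally show ?thesis by simp
qed

end

section \<open>Pattern algebras and pattern groups\<close>

lemma patternI:
  assumes "A \<in> carrier_mat n n" "\<And>i j. i < n \<Longrightarrow> j < n \<Longrightarrow> (i, j) \<notin> P \<Longrightarrow> A $$ (i, j) = 0"
  shows "A \<in> pattern_algebra n P"
  using assms by (auto simp: pattern_algebra_def)

lemma patternD:
  assumes "A \<in> pattern_algebra n P"
  shows "A \<in> carrier_mat n n" "dim_row A = n" "dim_col A = n"
    "i < n \<Longrightarrow> j < n \<Longrightarrow> (i, j) \<notin> P \<Longrightarrow> A $$ (i, j) = 0"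
  using assms by (auto simp: pattern_algebra_def)

lemma pattern_mono: "P \<subseteq> Q \<Longrightarrow> pattern_algebra n P \<subseteq> pattern_algebra n Q"
  by (auto simp: pattern_algebra_def)

lemma pattern_zero: "0\<^sub>m n n \<in> pattern_algebra n P"
  by (intro patternI) auto

lemma pattern_add:
  "A \<in> pattern_algebra n P \<Longrightarrow> B \<in> pattern_algebra n P \<Longrightarrow> A + B \<in> pattern_algebra n P"
  by (intro patternI) (auto simp: pattern_algebra_def)

lemma pattern_minus:
  "A \<in> pattern_algebra n P \<Longrightarrow> B \<in> pattern_algebra n P \<Longrightarrow> A - B \<in> pattern_algebra n P"
  by (intro patternI) (auto simp: pattern_algebra_def)

lemma pattern_smult: "A \<in> pattern_algebra n P \<Longrightarrow> c \<cdot>\<^sub>m A \<in> pattern_algebra n P"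
  by (intro patternI) (auto simp: pattern_algebra_def)

text \<open>Supports multiply as relations. This is why \<open>a2\<close> and \<open>a3\<close> can
  be pattern algebras for \<open>D O D\<close> and \<open>D O D O D\<close>: membership in a power
  of the algebra becomes a condition on entries.\<close>

lemma pattern_mult:
  assumes "A \<in> pattern_algebra n P" "B \<in> pattern_algebra n Q"
  shows "A * B \<in> pattern_algebra n (P O Q)"
proof (rule patternI)
  note A = patternD[OF assms(1)] and B = patternD[OF assms(2)]
  show "A * B \<in> carrier_mat n n" using A(1) B(1) by simp
  fix i j assume ij: "i < n" "j < n" "(i, j) \<notin> P O Q"
  have "A $$ (i, k) * B $$ (k, j) = 0" if "k < n" for k
    using A(4)[OF ij(1) that] B(4)[OF that ij(2)] ij(3) by auto
  then have "(\<Sum>k<n. A $$ (i, k) * B $$ (k, j)) = 0" by (intro sum.neutral ballI) simp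
  then show "(A * B) $$ (i, j) = 0"
    using index_mult_mat_sum[OF A(1) B(1) ij(1,2)] by simp
qed

lemma finite_pattern_algebra: "finite (pattern_algebra n P :: 'f::{finite,field} mat set)"
proof (rule finite_subset)
  show "pattern_algebra n P \<subseteq> (\<lambda>f. mat n n f) ` (({..<n} \<times> {..<n}) \<rightarrow>\<^sub>E (UNIV :: 'f set))"
  proof
    fix A :: "'f mat" assume "A \<in> pattern_algebra n P"
    then have A: "A \<in> carrier_mat n n" by (rule patternD)
    show "A \<in> (\<lambda>f. mat n n f) ` (({..<n} \<times> {..<n}) \<rightarrow>\<^sub>E UNIV)"
      by (rule image_eqI[of _ _ "\<lambda>x\<in>{..<n} \<times> {..<n}. A $$ x"]) (use A in auto)
  qed
  show "finite ((\<lambda>f. mat n n f) ` (({..<n} \<times> {..<n}) \<rightarrow>\<^sub>E (UNIV :: 'f set)))"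
    by (intro finite_imageI finite_PiE) auto
qed

lemma card_pattern_pos: "card (pattern_algebra n P :: 'f::{finite,field} mat set) > 0"
  by (metis card_gt_0_iff empty_iff finite_pattern_algebra pattern_zero)

definition elem_mat :: "nat \<Rightarrow> nat \<Rightarrow> nat \<Rightarrow> 'f::field \<Rightarrow> 'f mat" where
  "elem_mat n i j u = mat n n (\<lambda>(a, b). if a = i \<and> b = j then u else 0)"

lemma elem_mat_carrier [simp]: "elem_mat n i j u \<in> carrier_mat n n"
  by (simp add: elem_mat_def)

lemma elem_mat_dim [simp]: "dim_row (elem_mat n i j u) = n" "dim_col (elem_mat n i j u) = n"
  by (simp_all add: elem_mat_def)

lemma elem_mat_pattern: "(i, j) \<in> P \<Longrightarrow> elem_mat n i j u \<in> pattern_algebra n P"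
  by (intro patternI) (auto simp: elem_mat_def)

lemma elem_mat_index:
  "a < n \<Longrightarrow> b < n \<Longrightarrow> elem_mat n i j u $$ (a, b) = (if a = i \<and> b = j then u else 0)"
  by (simp add: elem_mat_def)

lemma elem_mat_mult:
  assumes "j < n"
  shows "elem_mat n i j u * elem_mat n k l v = (if j = k then elem_mat n i l (u * v) else 0\<^sub>m n n)"
proof (rule eq_matI)
  fix a b assume "a < dim_row (if j = k then elem_mat n i l (u * v) else 0\<^sub>m n n)"
    "b < dim_col (if j = k then elem_mat n i l (u * v) else 0\<^sub>m n n)"
  then have ab: "a < n" "b < n" by (auto simp: elem_mat_def split: if_splits)
  have "(elem_mat n i j u * elem_mat n k l v) $$ (a, b)
    = (\<Sum>c<n. elem_mat n i j u $$ (a, c) * elem_mat n k l v $$ (c, b))"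
    using ab by (intro index_mult_mat_sum) auto
  also have "\<dots> = (\<Sum>c<n. if c = j then (if a = i \<and> j = k \<and> b = l then u * v else 0) else 0)"
    using ab by (intro sum.cong refl) (auto simp: elem_mat_index)
  also have "\<dots> = (if a = i \<and> j = k \<and> b = l then u * v else 0)" using assms by simp
  finally show "(elem_mat n i j u * elem_mat n k l v) $$ (a, b)
    = (if j = k then elem_mat n i l (u * v) else 0\<^sub>m n n) $$ (a, b)"
    using ab by (auto simp: elem_mat_index)
qed (auto simp: elem_mat_def)

lemma elem_mat_smult: "c \<cdot>\<^sub>m elem_mat n i j u = elem_mat n i j (c * u)"
  by (intro eq_matI) (auto simp: elem_mat_def)

text \<open>The entries are stripped from the lowest nonzero row upwards, so that \<open>E\<^sub>k\<^sub>l A\<close> vanishes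
  for the remaining matrix \<open>A\<close>.\<close>

lemma pattern_induct [consumes 2, case_names zero step]:
  assumes A: "A \<in> pattern_algebra n P" and P: "P \<subseteq> {(i, j). i < j \<and> j < n}"
    and zero: "Q (0\<^sub>m n n)"
    and step: "\<And>A k l u. A \<in> pattern_algebra n P \<Longrightarrow> Q A \<Longrightarrow> (k, l) \<in> P \<Longrightarrow>
      elem_mat n k l u * A = 0\<^sub>m n n \<Longrightarrow> Q (elem_mat n k l u + A)"
  shows "Q A"
  using A
proof (induction "card {(i, j). i < n \<and> j < n \<and> A $$ (i, j) \<noteq> 0}" arbitrary: A rule: less_induct)
  case less
  note A = patternD[OF less.prems]
  let ?S = "\<lambda>A. {(i, j). i < n \<and> j < n \<and> A $$ (i, j) \<noteq> 0}"
  have fS: "finite (?S B)" for B :: "'a mat" by (rule finite_subset[of _ "{..<n} \<times> {..<n}"]) auto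
  show ?case
  proof (cases "?S A = {}")
    case True
    then have "A = 0\<^sub>m n n" using A by (intro eq_matI) auto
    then show ?thesis using zero by simp
  next
    case False
    define k where "k = Max (fst ` ?S A)"
    have "k \<in> fst ` ?S A" unfolding k_def using False fS by (intro Max_in) auto
    then obtain l where kl: "k < n" "l < n" "A $$ (k, l) \<noteq> 0" by auto
    have kmax: "A $$ (i, j) = 0" if "k < i" "i < n" "j < n" for i j
    proof (rule ccontr)
      assume "A $$ (i, j) \<noteq> 0"
      then have "(i, j) \<in> ?S A" using that by simp
      then have "i \<le> k" unfolding k_def using fS by (intro Max_ge) (auto intro!: image_eqI[of _ fst "(i, j)"])
      then show False using that by simp
    qed
    have klP: "(k, l) \<in> P" using kl A(4) by blast
    then have "k < l" using P by auto
    define u where "u = A $$ (k, l)"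
    define A' where "A' = A - elem_mat n k l u"
    have A': "A' \<in> pattern_algebra n P" unfolding A'_def
      by (intro pattern_minus less.prems elem_mat_pattern klP)
    have ix: "A' $$ (i, j) = (if i = k \<and> j = l then 0 else A $$ (i, j))" if "i < n" "j < n" for i j
      using that A by (auto simp: A'_def elem_mat_index u_def)
    have "?S A' \<subset> ?S A"
    proof
      show "?S A' \<subseteq> ?S A" using ix by (auto split: if_splits)
      have "(k, l) \<in> ?S A" "(k, l) \<notin> ?S A'" using kl ix by auto
      then show "?S A' \<noteq> ?S A" by blast
    qed
    then have "card (?S A') < card (?S A)" using fS by (intro psubset_card_mono)
    then have QA': "Q A'" using less.hyps A' by blast
    have "elem_mat n k l u * A' = 0\<^sub>m n n"
    proof (rule eq_matI)
      fix a b assume "a < dim_row (0\<^sub>m n n)" "b < dim_col (0\<^sub>m n n)"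
      then have ab: "a < n" "b < n" by auto
      have "(elem_mat n k l u * A') $$ (a, b) = (\<Sum>c<n. elem_mat n k l u $$ (a, c) * A' $$ (c, b))"
        using ab patternD(1)[OF A'] by (intro index_mult_mat_sum) auto
      also have "\<dots> = 0"
      proof (rule sum.neutral, rule ballI)
        fix c assume "c \<in> {..<n}"
        then have c: "c < n" by simp
        show "elem_mat n k l u $$ (a, c) * A' $$ (c, b) = 0"
        proof (cases "c = l")
          case True
          then have "A' $$ (c, b) = 0" using ix[OF c ab(2)] kmax[of l b] \<open>k < l\<close> kl ab by auto
          then show ?thesis by simp
        next
          case False
          then show ?thesis using elem_mat_index[OF ab(1) c, of k l u] by simp
        qed
      qed
      finally show "(elem_mat n k l u * A') $$ (a, b) = 0\<^sub>m n n $$ (a, b)" using ab by simp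
    qed (use patternD[OF A'] in \<open>auto simp: elem_mat_def\<close>)
    then have "Q (elem_mat n k l u + A')" using step A' QA' klP by blast
    moreover have "elem_mat n k l u + A' = A"
      using A by (intro eq_matI) (auto simp: A'_def elem_mat_def)
    ultimately show ?thesis by simp
  qed
qed

lemma one_plus_mult:
  assumes "A \<in> carrier_mat n n" "B \<in> carrier_mat n n"
  shows "(1\<^sub>m n + A) * (1\<^sub>m n + B) = 1\<^sub>m n + (A + B + A * B :: 'a::comm_ring_1 mat)"
proof -
  have "(1\<^sub>m n + A) * (1\<^sub>m n + B) = 1\<^sub>m n * (1\<^sub>m n + B) + A * (1\<^sub>m n + B)"
    using assms by (intro add_mult_distrib_mat) auto
  also have "A * (1\<^sub>m n + B) = A * 1\<^sub>m n + A * B"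
    using assms by (intro mult_add_distrib_mat) auto
  also have "1\<^sub>m n * (1\<^sub>m n + B) + (A * 1\<^sub>m n + A * B) = 1\<^sub>m n + (A + B + A * B)"
    using assms by (intro eq_matI) (auto simp: algebra_simps)
  finally show ?thesis .
qed

lemma one_plus_inj:
  assumes "A \<in> carrier_mat n n" "B \<in> carrier_mat n n" "1\<^sub>m n + A = 1\<^sub>m n + (B :: 'a::comm_ring_1 mat)"
  shows "A = B"
proof (rule eq_matI)
  fix i j assume "i < dim_row B" "j < dim_col B"
  then have ij: "i < n" "j < n" using assms by auto
  have "(1\<^sub>m n + A) $$ (i, j) = (1\<^sub>m n + B) $$ (i, j)" using assms by simp
  then show "A $$ (i, j) = B $$ (i, j)" using ij assms(1,2) by (auto split: if_splits)
qed (use assms in auto)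

definition one_plus :: "nat \<Rightarrow> 'f::field mat set \<Rightarrow> 'f mat set" where
  "one_plus n V = (\<lambda>A. 1\<^sub>m n + A) ` V"

lemma card_one_plus: "V \<subseteq> carrier_mat n n \<Longrightarrow> card (one_plus n V) = card V"
  unfolding one_plus_def by (intro card_image inj_onI) (auto intro: one_plus_inj)

section \<open>The pattern group and its filtration by powers of the algebra\<close>

locale pattern =
  fixes n :: nat and D :: "(nat \<times> nat) set" and F :: "'f::{finite,field} itself" and q :: nat
  assumes closed: "closed_pattern n D" and card_field [simp]: "card (UNIV :: 'f set) = q"
begin

abbreviation G :: "'f mat monoid" where "G \<equiv> pattern_group n D"
abbreviation ginv :: "'f mat \<Rightarrow> 'f mat" where "ginv g \<equiv> inv\<^bsub>G\<^esub> g"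
abbreviation I :: "'f mat" where "I \<equiv> 1\<^sub>m n"
abbreviation a1 :: "'f mat set" where "a1 \<equiv> pattern_algebra n D"
abbreviation a2 :: "'f mat set" where "a2 \<equiv> pattern_algebra n (D O D)"
abbreviation a3 :: "'f mat set" where "a3 \<equiv> pattern_algebra n (D O D O D)"
abbreviation Z :: "'f mat set" where "Z \<equiv> one_plus n a2"
abbreviation N :: "'f mat set" where "N \<equiv> one_plus n a3"

lemma D_less: "D \<subseteq> {(i, j). i < j \<and> j < n}"
  using closed by (auto simp: closed_pattern_def)

lemma DD: "D O D \<subseteq> D"
  using closed unfolding closed_pattern_def by blast

lemma a21: "a2 \<subseteq> a1" by (rule pattern_mono[OF DD])
lemma a32: "a3 \<subseteq> a2" using DD by (intro pattern_mono) blast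
lemma a31: "a3 \<subseteq> a1" using a21 a32 by blast

lemma carr: "A \<in> a1 \<Longrightarrow> A \<in> carrier_mat n n" by (rule patternD)
lemma carr2: "A \<in> a2 \<Longrightarrow> A \<in> carrier_mat n n" by (rule patternD)
lemma carr3: "A \<in> a3 \<Longrightarrow> A \<in> carrier_mat n n" by (rule patternD)

lemma mult_a1_a1: "A \<in> a1 \<Longrightarrow> B \<in> a1 \<Longrightarrow> A * B \<in> a2" by (rule pattern_mult)
lemma mult_a1_a2: "A \<in> a1 \<Longrightarrow> B \<in> a2 \<Longrightarrow> A * B \<in> a3" by (rule pattern_mult)
lemma mult_a2_a1: "A \<in> a2 \<Longrightarrow> B \<in> a1 \<Longrightarrow> A * B \<in> a3"
  using pattern_mult[of A n "D O D" B D] by (simp add: O_assoc)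

lemma mult_in_a1: "A \<in> a1 \<Longrightarrow> B \<in> a1 \<Longrightarrow> A * B \<in> a1" using mult_a1_a1 a21 by blast

lemma bracket_a2: "A \<in> a1 \<Longrightarrow> B \<in> a1 \<Longrightarrow> A * B - B * A \<in> a2"
  by (intro pattern_minus mult_a1_a1)

lemma carrier_G: "carrier G = one_plus n a1"
  by (auto simp: pattern_group_def one_plus_def)

lemma mult_G [simp]: "x \<otimes>\<^bsub>G\<^esub> y = x * y" by (simp add: pattern_group_def)
lemma one_G [simp]: "\<one>\<^bsub>G\<^esub> = I" by (simp add: pattern_group_def)

lemma finite_G: "finite (carrier G)"
  unfolding carrier_G one_plus_def by (intro finite_imageI finite_pattern_algebra)

lemma card_G: "card (carrier G) = card a1"
  unfolding carrier_G by (rule card_one_plus) (use carr in blast)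

lemma carrier_G_mat: "x \<in> carrier G \<Longrightarrow> x \<in> carrier_mat n n"
  unfolding carrier_G one_plus_def using carr by auto

lemma mult_closed:
  assumes V: "V \<subseteq> a1" "\<And>A B. A \<in> V \<Longrightarrow> B \<in> V \<Longrightarrow> A + B + A * B \<in> V"
    and xy: "x \<in> one_plus n V" "y \<in> one_plus n V"
  shows "x * y \<in> one_plus n V"
proof -
  obtain A B where "A \<in> V" "B \<in> V" "x = I + A" "y = I + B" using xy by (auto simp: one_plus_def)
  moreover have "A \<in> a1" "B \<in> a1" using V(1) \<open>A \<in> V\<close> \<open>B \<in> V\<close> by auto
  ultimately show ?thesis using one_plus_mult[OF carr carr, of A B] V(2)[of A B] by (auto simp: one_plus_def)
qed

text \<open>Inverses come from counting: x is upper triangular with ones on the diagonal, hence an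
  invertible matrix, so right multiplication by x is injective on the finite carrier, therefore
  onto, and reaches the identity.\<close>

lemma group_G: "group G"
proof (rule groupI)
  show closed: "x \<otimes>\<^bsub>G\<^esub> y \<in> carrier G" if "x \<in> carrier G" "y \<in> carrier G" for x y
    unfolding carrier_G mult_G
    by (rule mult_closed[OF _ _ that[unfolded carrier_G]])
       (auto intro!: pattern_add mult_in_a1)
  show one: "\<one>\<^bsub>G\<^esub> \<in> carrier G"
    unfolding carrier_G one_G one_plus_def
    by (rule image_eqI[of _ _ "0\<^sub>m n n"]) (auto simp: pattern_zero)
  show "x \<otimes>\<^bsub>G\<^esub> y \<otimes>\<^bsub>G\<^esub> z = x \<otimes>\<^bsub>G\<^esub> (y \<otimes>\<^bsub>G\<^esub> z)"
    if "x \<in> carrier G" "y \<in> carrier G" "z \<in> carrier G" for x y z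
    using that[THEN carrier_G_mat] by (simp add: assoc_mult_mat[of _ n n _ n _ n])
  show "\<one>\<^bsub>G\<^esub> \<otimes>\<^bsub>G\<^esub> x = x" if "x \<in> carrier G" for x
    using carrier_G_mat[OF that] by simp
  show "\<exists>y\<in>carrier G. y \<otimes>\<^bsub>G\<^esub> x = \<one>\<^bsub>G\<^esub>" if x: "x \<in> carrier G" for x
  proof -
    note xc = carrier_G_mat[OF x]
    obtain A where A: "A \<in> a1" "x = I + A" using x by (auto simp: carrier_G one_plus_def)
    have ut: "upper_triangular x"
    proof (rule upper_triangularI)
      fix i j assume ij: "j < i" "i < dim_row x"
      then have "(i, j) \<notin> D" "i < n" "j < n" using D_less xc by auto
      then show "x $$ (i, j) = 0" using A patternD[OF A(1)] ij by auto
    qed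
    have diag: "x $$ (i, i) = 1" if "i < n" for i
    proof -
      have "(i, i) \<notin> D" using D_less by auto
      then show ?thesis using A patternD[OF A(1)] that by auto
    qed
    have "diag_mat x = map (\<lambda>i. 1) [0..<n]"
      unfolding diag_mat_def using xc diag by auto
    then have "det x \<noteq> 0" using det_upper_triangular[OF ut xc] by (simp add: map_replicate_const)
    then have "x \<in> Units (ring_mat TYPE('f) n ())" by (rule det_non_zero_imp_unit[OF xc])
    then obtain y where y: "y \<in> carrier_mat n n" "x * y = I"
      by (auto simp: Units_def ring_mat_def)
    have "inj_on (\<lambda>h. h * x) (carrier G)"
    proof (rule inj_onI)
      fix h h' assume h: "h \<in> carrier G" "h' \<in> carrier G" "h * x = h' * x"
      have "h = h * (x * y)" using carrier_G_mat[OF h(1)] y by simp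
      also have "\<dots> = h' * (x * y)"
        using assoc_mult_mat[OF carrier_G_mat[OF h(1)] xc y(1)] assoc_mult_mat[OF carrier_G_mat[OF h(2)] xc y(1)] h(3)
        by simp
      finally show "h = h'" using carrier_G_mat[OF h(2)] y by simp
    qed
    moreover have "(\<lambda>h. h * x) ` carrier G \<subseteq> carrier G" using closed x by auto
    ultimately have "(\<lambda>h. h * x) ` carrier G = carrier G" using finite_G endo_inj_surj by blast
    then have "I \<in> (\<lambda>h. h * x) ` carrier G" using one by simp
    then show ?thesis by auto
  qed
qed

sublocale group G by (rule group_G)

lemma one_plus_subgroup:
  assumes V: "V \<subseteq> a1" "V \<noteq> {}" "\<And>A B. A \<in> V \<Longrightarrow> B \<in> V \<Longrightarrow> A + B + A * B \<in> V"
  shows "subgroup (one_plus n V) G"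
proof (rule finite_subgroupI)
  show sub: "one_plus n V \<subseteq> carrier G" using V(1) by (auto simp: carrier_G one_plus_def)
  then show "finite (one_plus n V)" using finite_G finite_subset by blast
  show "one_plus n V \<noteq> {}" using V(2) by (simp add: one_plus_def)
  show "x \<otimes>\<^bsub>G\<^esub> y \<in> one_plus n V" if "x \<in> one_plus n V" "y \<in> one_plus n V" for x y
    using mult_closed[OF V(1,3) that] by simp
qed

lemma Z_subgroup: "subgroup Z G"
proof (rule one_plus_subgroup)
  show "A + B + A * B \<in> a2" if "A \<in> a2" "B \<in> a2" for A B
    using that a21 mult_a1_a1[of A B] by (auto intro!: pattern_add)
  show "a2 \<noteq> {}" using pattern_zero by blast
qed (rule a21)

lemma N_subgroup: "subgroup N G"
proof (rule one_plus_subgroup)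
  show "A + B + A * B \<in> a3" if "A \<in> a3" "B \<in> a3" for A B
    using that a31 a32 mult_a1_a2[of A B] by (auto intro!: pattern_add)
  show "a3 \<noteq> {}" using pattern_zero by blast
qed (rule a31)

lemma one_plus_G: "A \<in> a1 \<Longrightarrow> I + A \<in> carrier G" by (auto simp: carrier_G one_plus_def)

lemma GE: assumes "x \<in> carrier G" obtains A where "A \<in> a1" "x = I + A"
  using assms by (auto simp: carrier_G one_plus_def)

lemma right_inverse:
  assumes "x \<in> carrier G" obtains E where "E \<in> a1" "ginv x = I + E" "x * (I + E) = I"
  using GE[OF inv_closed[OF assms]] r_inv[OF assms] by (metis mult_G one_G)

text \<open>x + K = x (1 + x^-1 K) with x^-1 = 1 + E. An additive perturbation becomes a
  multiplicative one, and the factor 1 + (K + E K) stays in \<open>Z\<close> or \<open>N\<close>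
  when K lies in \<open>a2\<close> or \<open>a3\<close>.\<close>

lemma add_as_mult:
  assumes x: "x \<in> carrier G" and K: "K \<in> carrier_mat n n"
  obtains E where "E \<in> a1" "x + K = x * (I + (K + E * K))"
proof -
  obtain E where E: "E \<in> a1" "x * (I + E) = I" using right_inverse[OF x] by metis
  note xc = carrier_G_mat[OF x] and Ec = carr[OF E(1)]
  have oEc: "I + E \<in> carrier_mat n n" using Ec by simp
  have EK: "K + E * K = (I + E) * K"
    using add_mult_distrib_mat[OF one_carrier_mat Ec K] K by simp
  have "x * (I + (K + E * K)) = x * I + x * ((I + E) * K)"
    unfolding EK by (rule mult_add_distrib_mat[OF xc one_carrier_mat]) (use oEc K in simp)
  also have "\<dots> = x + K"
    using assoc_mult_mat[OF xc oEc K] E(2) xc K by simp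
  finally show ?thesis using that E(1) by metis
qed

lemma one_plus_commute:
  assumes A: "A \<in> a1" and B: "B \<in> a1"
  obtains E where "E \<in> a1"
    "(I + A) * (I + B) = (I + B) * (I + A) * (I + ((A * B - B * A) + E * (A * B - B * A)))"
proof -
  note Ac = carr[OF A] and Bc = carr[OF B]
  have yx: "(I + B) * (I + A) \<in> carrier G"
    using m_closed[OF one_plus_G[OF B] one_plus_G[OF A]] by simp
  have K: "A * B - B * A \<in> carrier_mat n n" using bracket_a2[OF A B] carr2 by blast
  have "(I + A) * (I + B) = (I + B) * (I + A) + (A * B - B * A)"
    unfolding one_plus_mult[OF Ac Bc] one_plus_mult[OF Bc Ac]
    using Ac Bc by (intro eq_matI) (auto simp: algebra_simps)
  then show ?thesis using add_as_mult[OF yx K] that by metis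
qed

lemma bracket_plus_a2: "A \<in> a1 \<Longrightarrow> B \<in> a1 \<Longrightarrow> E \<in> a1 \<Longrightarrow> (A * B - B * A) + E * (A * B - B * A) \<in> a2"
  using bracket_a2[of A B] mult_a1_a2[of E "A * B - B * A"] a32 by (auto intro!: pattern_add)

text \<open>A commutator has the form 1 + (K + E K) with K = A B - B A. This K lies in
  \<open>a2\<close> always, and in \<open>a3\<close> as soon as A or B lies in
  \<open>a2\<close>.\<close>

lemma class_two_G: "class_two G Z N"
proof (rule class_two.intro[OF group_G], rule class_two_axioms.intro)
  show "finite (carrier G)" by (rule finite_G)
  show "subgroup Z G" by (rule Z_subgroup)
  show "subgroup N G" by (rule N_subgroup)
  show "N \<subseteq> Z" using a32 by (auto simp: one_plus_def)
  fix x assume "x \<in> carrier G"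
  then obtain A where A: "A \<in> a1" "x = I + A" by (rule GE)
  show "\<exists>c\<in>Z. x \<otimes>\<^bsub>G\<^esub> y = y \<otimes>\<^bsub>G\<^esub> x \<otimes>\<^bsub>G\<^esub> c" if y: "y \<in> carrier G" for y
  proof -
    obtain B where B: "B \<in> a1" "y = I + B" using y by (rule GE)
    obtain E where "E \<in> a1"
      "(I + A) * (I + B) = (I + B) * (I + A) * (I + ((A * B - B * A) + E * (A * B - B * A)))"
      by (rule one_plus_commute[OF A(1) B(1)])
    then show ?thesis using bracket_plus_a2[OF A(1) B(1)] A B by (auto simp: one_plus_def)
  qed
  show "\<exists>c\<in>N. x \<otimes>\<^bsub>G\<^esub> y = y \<otimes>\<^bsub>G\<^esub> x \<otimes>\<^bsub>G\<^esub> c" if y: "y \<in> Z" for y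
  proof -
    obtain B where B: "B \<in> a2" "y = I + B" using y by (auto simp: one_plus_def)
    have B1: "B \<in> a1" using B a21 by blast
    obtain E where E: "E \<in> a1"
      "(I + A) * (I + B) = (I + B) * (I + A) * (I + ((A * B - B * A) + E * (A * B - B * A)))"
      by (rule one_plus_commute[OF A(1) B1])
    have K: "A * B - B * A \<in> a3"
      using mult_a1_a2[OF A(1) B(1)] mult_a2_a1[OF B(1) A(1)] by (rule pattern_minus)
    have "E * (A * B - B * A) \<in> a3" using mult_a1_a2[OF E(1)] K a32 by blast
    then show ?thesis using E K A B by (auto simp: one_plus_def intro!: pattern_add)
  qed
qed

sublocale class_two G Z N by (rule class_two_G)

lemma central_char_add_a3:
  assumes w: "w \<in> central_chars" and A: "A \<in> a2" and P: "P \<in> a3"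
  shows "w (I + (A + P)) = w (I + A)"
proof -
  have x: "I + A \<in> carrier G" using A a21 one_plus_G by blast
  obtain E where E: "E \<in> a1" "(I + A) + P = (I + A) * (I + (P + E * P))"
    by (rule add_as_mult[OF x carr3[OF P]])
  have "P + E * P \<in> a3" using mult_a1_a2[OF E(1), of P] P a32 by (auto intro!: pattern_add)
  then have nN: "I + (P + E * P) \<in> N" by (auto simp: one_plus_def)
  then have nZ: "I + (P + E * P) \<in> Z" using a32 by (auto simp: one_plus_def)
  have xZ: "I + A \<in> Z" using A by (auto simp: one_plus_def)
  have "I + (A + P) = (I + A) + P" using assoc_add_mat[OF one_carrier_mat carr2[OF A] carr3[OF P]] by simp
  then show ?thesis using E lin_chars_mult[OF central_charsD(1)[OF w] xZ nZ] central_charsD(2)[OF w nN] by simp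
qed

text \<open>The product (1 + A)(1 + B) exceeds 1 + (A + B) by A B, which lies in \<open>a3\<close>
  and is invisible to \<open>w\<close>. Thus a multiplicative character of \<open>Z\<close> is an
  additive one of \<open>a2\<close>.\<close>

lemma central_char_add:
  assumes w: "w \<in> central_chars" and A: "A \<in> a2" and B: "B \<in> a2"
  shows "w (I + (A + B)) = w (I + A) * w (I + B)"
proof -
  have Z: "I + A \<in> Z" "I + B \<in> Z" using A B by (auto simp: one_plus_def)
  have "w (I + A) * w (I + B) = w (I + (A + B + A * B))"
    using lin_chars_mult[OF central_charsD(1)[OF w] Z] one_plus_mult[OF carr2[OF A] carr2[OF B]] by simp
  also have "\<dots> = w (I + (A + B))"
    by (rule central_char_add_a3[OF w]) (use A B a21 mult_a1_a2[of A B] in \<open>auto intro!: pattern_add\<close>)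
  finally show ?thesis by simp
qed

lemma commut_one_plus:
  assumes w: "w \<in> central_chars" and A: "A \<in> a1" and B: "B \<in> a1"
  shows "w (commut (I + A) (I + B)) = w (I + (A * B - B * A))"
proof -
  obtain E where E: "E \<in> a1"
    "(I + A) * (I + B) = (I + B) * (I + A) * (I + ((A * B - B * A) + E * (A * B - B * A)))"
    by (rule one_plus_commute[OF A B])
  have K: "A * B - B * A \<in> a2" by (rule bracket_a2[OF A B])
  have "I + ((A * B - B * A) + E * (A * B - B * A)) \<in> Z"
    using bracket_plus_a2[OF A B E(1)] by (auto simp: one_plus_def)
  then have "commut (I + A) (I + B) = I + ((A * B - B * A) + E * (A * B - B * A))"
    using E(2) by (intro commut_unique one_plus_G A B ZC) auto
  then show ?thesis using central_char_add_a3[OF w K mult_a1_a2[OF E(1) K]] by simp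
qed

end

section \<open>Irreducible characters of degree q\<close>

lemma card_field_ge_2: "card (UNIV :: 'f::{finite,field} set) \<ge> 2"
proof -
  have "card {0, 1 :: 'f} \<le> card (UNIV :: 'f set)" by (intro card_mono) auto
  then show ?thesis by simp
qed

definition add_line :: "'f::{finite,field} mat set \<Rightarrow> 'f mat \<Rightarrow> 'f mat set" where
  "add_line V x = (\<lambda>(v, c). v + c \<cdot>\<^sub>m x) ` (V \<times> UNIV)"

lemma add_lineE:
  assumes "y \<in> add_line V x" obtains v c where "v \<in> V" "y = v + c \<cdot>\<^sub>m x"
  using assms by (auto simp: add_line_def)

lemma add_lineI: "v \<in> V \<Longrightarrow> v + c \<cdot>\<^sub>m x \<in> add_line V x"
  by (auto simp: add_line_def)

lemma card_add_line:
  fixes x :: "'f::{finite,field} mat"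
  assumes V: "V \<subseteq> carrier_mat n n" and minus: "\<And>A B. A \<in> V \<Longrightarrow> B \<in> V \<Longrightarrow> A - B \<in> V"
    and smult: "\<And>c A. A \<in> V \<Longrightarrow> c \<cdot>\<^sub>m A \<in> V" and x: "x \<in> carrier_mat n n" "x \<notin> V"
  shows "card (add_line V x) = card V * card (UNIV :: 'f set)"
proof -
  have "inj_on (\<lambda>(v, c). v + c \<cdot>\<^sub>m x) (V \<times> UNIV)"
  proof (rule inj_onI, clarsimp)
    fix v v' c c' assume v: "v \<in> V" "v' \<in> V" and e: "v + c \<cdot>\<^sub>m x = v' + c' \<cdot>\<^sub>m x"
    have vc: "v \<in> carrier_mat n n" "v' \<in> carrier_mat n n" using v V by auto
    have ix: "v $$ (i, j) + c * x $$ (i, j) = v' $$ (i, j) + c' * x $$ (i, j)" if "i < n" "j < n" for i j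
    proof -
      have "(v + c \<cdot>\<^sub>m x) $$ (i, j) = (v' + c' \<cdot>\<^sub>m x) $$ (i, j)" using e by simp
      then show ?thesis using that vc x by simp
    qed
    have cc: "c = c'"
    proof (rule ccontr)
      assume ne: "c \<noteq> c'"
      have "x = inverse (c' - c) \<cdot>\<^sub>m (v - v')"
      proof (rule eq_matI)
        fix i j assume "i < dim_row (inverse (c' - c) \<cdot>\<^sub>m (v - v'))" "j < dim_col (inverse (c' - c) \<cdot>\<^sub>m (v - v'))"
        then have ij: "i < n" "j < n" using vc by auto
        have "v $$ (i, j) - v' $$ (i, j) = (c' - c) * x $$ (i, j)"
          using ix[OF ij] by (simp add: algebra_simps)
        then show "x $$ (i, j) = (inverse (c' - c) \<cdot>\<^sub>m (v - v')) $$ (i, j)"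
          using ij vc ne by simp
      qed (use x vc in auto)
      then show False using x(2) smult minus v by metis
    qed
    have "v = v'"
      using ix vc unfolding cc by (intro eq_matI) auto
    then show "v = v' \<and> c = c'" using cc by simp
  qed
  then show ?thesis unfolding add_line_def by (simp add: card_image card_cartesian_product)
qed

section \<open>The commutator form on the algebra and its polarizations\<close>

context pattern
begin

lemma q2: "q \<ge> 2" using card_field_ge_2[where 'f = 'f] by simp

definition bracket :: "'f mat \<Rightarrow> 'f mat \<Rightarrow> 'f mat" where
  "bracket A B = A * B - B * A"

lemma bracket_in_a2: "A \<in> a1 \<Longrightarrow> B \<in> a1 \<Longrightarrow> bracket A B \<in> a2"
  unfolding bracket_def by (rule bracket_a2)

lemma bracket_add_left:
  assumes "A \<in> a1" "A' \<in> a1" "B \<in> a1"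
  shows "bracket (A + A') B = bracket A B + bracket A' B"
proof -
  note c = assms[THEN carr]
  have "(A + A') * B = A * B + A' * B" by (rule add_mult_distrib_mat[OF c])
  moreover have "B * (A + A') = B * A + B * A'" by (rule mult_add_distrib_mat[OF c(3,1,2)])
  ultimately show ?thesis unfolding bracket_def using c by (intro eq_matI) (auto simp del: index_mult_mat(1))
qed

lemma bracket_add_right:
  assumes "A \<in> a1" "B \<in> a1" "B' \<in> a1"
  shows "bracket A (B + B') = bracket A B + bracket A B'"
proof -
  note c = assms[THEN carr]
  have "A * (B + B') = A * B + A * B'" by (rule mult_add_distrib_mat[OF c])
  moreover have "(B + B') * A = B * A + B' * A" by (rule add_mult_distrib_mat[OF c(2,3,1)])
  ultimately show ?thesis unfolding bracket_def using c by (intro eq_matI) (auto simp del: index_mult_mat(1))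
qed

lemma bracket_smult:
  assumes "A \<in> a1" "B \<in> a1"
  shows "bracket (c \<cdot>\<^sub>m A) B = c \<cdot>\<^sub>m bracket A B" "bracket A (c \<cdot>\<^sub>m B) = c \<cdot>\<^sub>m bracket A B"
proof -
  note cr = assms[THEN carr]
  have "c \<cdot>\<^sub>m A * B = c \<cdot>\<^sub>m (A * B)" "B * (c \<cdot>\<^sub>m A) = c \<cdot>\<^sub>m (B * A)"
    by (rule mult_smult_assoc_mat[OF cr], rule mult_smult_distrib[OF cr(2,1)])
  then show "bracket (c \<cdot>\<^sub>m A) B = c \<cdot>\<^sub>m bracket A B"
    unfolding bracket_def using cr by (intro eq_matI) (auto simp: algebra_simps simp del: index_mult_mat(1))
  have "A * (c \<cdot>\<^sub>m B) = c \<cdot>\<^sub>m (A * B)" "c \<cdot>\<^sub>m B * A = c \<cdot>\<^sub>m (B * A)"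
    by (rule mult_smult_distrib[OF cr], rule mult_smult_assoc_mat[OF cr(2,1)])
  then show "bracket A (c \<cdot>\<^sub>m B) = c \<cdot>\<^sub>m bracket A B"
    unfolding bracket_def using cr by (intro eq_matI) (auto simp: algebra_simps simp del: index_mult_mat(1))
qed

lemma bracket_self: "A \<in> a1 \<Longrightarrow> bracket A A = 0\<^sub>m n n"
  unfolding bracket_def using carr[of A] by (intro eq_matI) (auto simp del: index_mult_mat(1))

lemma bracket_a3: "A \<in> a2 \<Longrightarrow> B \<in> a1 \<Longrightarrow> bracket A B \<in> a3"
  unfolding bracket_def by (intro pattern_minus mult_a1_a2 mult_a2_a1)

definition mat_radical :: "('f mat \<Rightarrow> complex) \<Rightarrow> 'f mat set" where
  "mat_radical w = {A \<in> a1. \<forall>B\<in>a1. w (I + bracket A B) = 1}"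

lemma commut_bracket:
  "w \<in> central_chars \<Longrightarrow> A \<in> a1 \<Longrightarrow> B \<in> a1 \<Longrightarrow>
    w (commut (I + A) (I + B)) = w (I + bracket A B)"
  unfolding bracket_def by (rule commut_one_plus)

lemma radical_eq:
  assumes w: "w \<in> central_chars" shows "radical w = one_plus n (mat_radical w)"
proof (intro equalityI subsetI)
  fix x assume x: "x \<in> radical w"
  then have "x \<in> carrier G" by (simp add: radical_def)
  then obtain A where A: "A \<in> a1" "x = I + A" by (rule GE)
  have "w (I + bracket A B) = 1" if "B \<in> a1" for B
    using x commut_bracket[OF w A(1) that] A one_plus_G[OF that] by (simp add: radical_def)
  then show "x \<in> one_plus n (mat_radical w)" using A by (auto simp: mat_radical_def one_plus_def)
next
  fix x assume "x \<in> one_plus n (mat_radical w)"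
  then obtain A where A: "A \<in> a1" "x = I + A" "\<And>B. B \<in> a1 \<Longrightarrow> w (I + bracket A B) = 1"
    by (auto simp: mat_radical_def one_plus_def)
  have "w (commut x y) = 1" if y: "y \<in> carrier G" for y
  proof -
    obtain B where B: "B \<in> a1" "y = I + B" using y by (rule GE)
    then show ?thesis using commut_bracket[OF w A(1) B(1)] A by simp
  qed
  then show "x \<in> radical w" using A one_plus_G by (simp add: radical_def)
qed

lemma card_radical: "w \<in> central_chars \<Longrightarrow> card (radical w) = card (mat_radical w)"
  unfolding radical_eq by (rule card_one_plus) (auto simp: mat_radical_def carr)

lemma form_add_left:
  assumes w: "w \<in> central_chars" and "A \<in> a1" "A' \<in> a1" "B \<in> a1"
  shows "w (I + bracket (A + A') B) = w (I + bracket A B) * w (I + bracket A' B)"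
  unfolding bracket_add_left[OF assms(2-)] by (intro central_char_add w bracket_in_a2 assms)

lemma form_add_right:
  assumes w: "w \<in> central_chars" and "A \<in> a1" "B \<in> a1" "B' \<in> a1"
  shows "w (I + bracket A (B + B')) = w (I + bracket A B) * w (I + bracket A B')"
  unfolding bracket_add_right[OF assms(2-)] by (intro central_char_add w bracket_in_a2 assms)

lemma form_bracket_swap:
  assumes w: "w \<in> central_chars" and "A \<in> a1" "B \<in> a1"
  shows "w (I + bracket B A) = inverse (w (I + bracket A B))"
  using form_swap[OF w one_plus_G[OF assms(2)] one_plus_G[OF assms(3)]] commut_bracket[OF w] assms by simp

text \<open>The form has complex values and is only additive in each argument. Closure of the
  radical under field scalars holds because [c A, B] = [A, c B], so that a scalar on A is absorbed
  by the freely varying B.\<close>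

lemma mat_radical_space:
  assumes w: "w \<in> central_chars"
  shows "mat_radical w \<subseteq> a1" "a2 \<subseteq> mat_radical w"
    "A \<in> mat_radical w \<Longrightarrow> c \<cdot>\<^sub>m A \<in> mat_radical w"
    "A \<in> mat_radical w \<Longrightarrow> B \<in> mat_radical w \<Longrightarrow> A + B \<in> mat_radical w"
    "A \<in> mat_radical w \<Longrightarrow> B \<in> mat_radical w \<Longrightarrow> A - B \<in> mat_radical w"
proof -
  show sub: "mat_radical w \<subseteq> a1" by (auto simp: mat_radical_def)
  show "a2 \<subseteq> mat_radical w"
  proof
    fix A assume A: "A \<in> a2"
    have "w (I + bracket A B) = 1" if "B \<in> a1" for B
    proof -
      have "I + bracket A B \<in> N" using bracket_a3[OF A that] by (auto simp: one_plus_def)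
      then show ?thesis by (rule central_charsD(2)[OF w])
    qed
    then show "A \<in> mat_radical w" using A a21 by (auto simp: mat_radical_def)
  qed
  show smult: "c \<cdot>\<^sub>m A \<in> mat_radical w" if A: "A \<in> mat_radical w" for c A
  proof -
    have A1: "A \<in> a1" using A sub by blast
    have "w (I + bracket (c \<cdot>\<^sub>m A) B) = 1" if B: "B \<in> a1" for B
    proof -
      have "w (I + bracket A (c \<cdot>\<^sub>m B)) = 1"
        using A pattern_smult[OF B] by (simp add: mat_radical_def)
      then show ?thesis unfolding bracket_smult[OF A1 B] .
    qed
    then show ?thesis using pattern_smult[OF A1] by (simp add: mat_radical_def)
  qed
  show add: "A + B \<in> mat_radical w" if "A \<in> mat_radical w" "B \<in> mat_radical w" for A B
    using that form_add_left[OF w] pattern_add by (auto simp: mat_radical_def)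
  show "A - B \<in> mat_radical w" if "A \<in> mat_radical w" "B \<in> mat_radical w"
  proof -
    have "A - B = A + (-1) \<cdot>\<^sub>m B" using that sub carr by (intro eq_matI) (auto simp: subset_eq)
    then show ?thesis using add[OF that(1) smult[OF that(2)]] by simp
  qed
qed

text \<open>The radical R has codimension two. For any x outside it, b = R + F x is isotropic
  because the bracket is alternating, and it has index q. Products of elements of b fall into
  \<open>a2\<close>, which lies in R, so 1 + b is a subgroup.\<close>

lemma polarization_exists:
  assumes w: "w \<in> central_chars" and card: "card (radical w) * q ^ 2 = card (carrier G)"
  shows "\<exists>B. polarization q w B"
proof -
  define R where "R = mat_radical w"
  note Rs = mat_radical_space[OF w, folded R_def]
  have f: "\<And>A B. A \<in> R \<Longrightarrow> B \<in> a1 \<Longrightarrow> w (I + bracket A B) = 1"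
    by (auto simp: R_def mat_radical_def)
  have cR: "card R * q ^ 2 = card a1"
    using card card_radical[OF w] card_G unfolding R_def by simp
  have a1_pos: "card a1 > 0" by (rule card_pattern_pos)
  have "R \<noteq> a1"
  proof
    assume "R = a1"
    then have "card a1 * q ^ 2 = card a1 * 1" using cR by simp
    then have "q ^ 2 = 1" using a1_pos by (metis mult_left_cancel less_irrefl)
    then show False using q2 by simp
  qed
  then obtain x where x: "x \<in> a1" "x \<notin> R" using Rs(1) by blast
  define b where "b = add_line R x"
  have cb: "card b = card R * q" unfolding b_def
    using Rs(1) carr x card_add_line[OF _ Rs(5) Rs(3), of n x] by auto
  have Rc: "v \<in> carrier_mat n n" if "v \<in> R" for v using that Rs(1) carr by blast
  note xc = carr[OF x(1)]
  have Rb: "R \<subseteq> b"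
  proof
    fix v assume v: "v \<in> R"
    have "v + 0 \<cdot>\<^sub>m x = v" using Rc[OF v] xc by (intro eq_matI) auto
    then show "v \<in> b" unfolding b_def using add_lineI[OF v, of 0 x] by simp
  qed
  have b1: "b \<subseteq> a1" unfolding b_def
    using Rs(1) x by (auto elim!: add_lineE intro!: pattern_add pattern_smult)
  have b_add: "y + y' \<in> b" if "y \<in> b" "y' \<in> b" for y y'
  proof -
    obtain v c v' c' where v: "v \<in> R" "v' \<in> R" "y = v + c \<cdot>\<^sub>m x" "y' = v' + c' \<cdot>\<^sub>m x"
      using \<open>y \<in> b\<close> \<open>y' \<in> b\<close> unfolding b_def by (metis add_lineE)
    then have "y + y' = (v + v') + (c + c') \<cdot>\<^sub>m x"
      using Rc[OF v(1)] Rc[OF v(2)] xc by (intro eq_matI) (auto simp: algebra_simps)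
    then show ?thesis unfolding b_def using add_lineI[OF Rs(4)[OF v(1,2)]] by simp
  qed
  have b_smult: "k \<cdot>\<^sub>m y \<in> b" if y: "y \<in> b" for y k
  proof -
    obtain v c where v: "v \<in> R" "y = v + c \<cdot>\<^sub>m x" using y unfolding b_def by (rule add_lineE)
    then have "k \<cdot>\<^sub>m y = k \<cdot>\<^sub>m v + (k * c) \<cdot>\<^sub>m x"
      using Rc[OF v(1)] xc by (intro eq_matI) (auto simp: algebra_simps)
    then show ?thesis unfolding b_def using add_lineI[OF Rs(3)[OF v(1)]] by simp
  qed
  have b_minus: "y - y' \<in> b" if "y \<in> b" "y' \<in> b" for y y'
  proof -
    have "y - y' = y + (-1) \<cdot>\<^sub>m y'" using that b1 carr by (intro eq_matI) (auto simp: subset_eq)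
    then show ?thesis using b_add[OF that(1) b_smult[OF that(2)]] by simp
  qed
  have iso: "w (I + bracket y y') = 1" if "y \<in> b" "y' \<in> b" for y y'
  proof -
    obtain v c v' c' where v: "v \<in> R" "v' \<in> R" "y = v + c \<cdot>\<^sub>m x" "y' = v' + c' \<cdot>\<^sub>m x"
      using \<open>y \<in> b\<close> \<open>y' \<in> b\<close> unfolding b_def by (metis add_lineE)
    have v1: "v \<in> a1" "v' \<in> a1" using v Rs(1) by auto
    have x1: "k \<cdot>\<^sub>m x \<in> a1" for k by (rule pattern_smult[OF x(1)])
    have y1: "y' \<in> a1" using that b1 by blast
    have "w (I + bracket (c \<cdot>\<^sub>m x) v') = 1"
      using form_bracket_swap[OF w v1(2) x1] f[OF v(2) x1] by simp
    moreover have "w (I + bracket (c \<cdot>\<^sub>m x) (c' \<cdot>\<^sub>m x)) = 1"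
    proof -
      have "bracket (c \<cdot>\<^sub>m x) (c' \<cdot>\<^sub>m x) = 0\<^sub>m n n"
        using bracket_smult(1)[OF x(1) x1] bracket_smult(2)[OF x(1) x(1)] bracket_self[OF x(1)] by simp
      then show ?thesis using central_charsD(3)[OF w] by simp
    qed
    ultimately have "w (I + bracket (c \<cdot>\<^sub>m x) y') = 1"
      unfolding v(4) using form_add_right[OF w x1 v1(2) x1] by simp
    then show ?thesis unfolding v(3) using form_add_left[OF w v1(1) x1 y1] f[OF v(1) y1] by simp
  qed
  have sep: "\<exists>y'\<in>b. w (I + bracket y y') \<noteq> 1" if y: "y \<in> a1" "y \<notin> b" for y
  proof (rule ccontr)
    assume "\<not> ?thesis"
    then have triv: "\<And>y'. y' \<in> b \<Longrightarrow> w (I + bracket y y') = 1" by blast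
    \<comment> \<open>If y outside b were orthogonal to b, then b and the line of y would together
      fill the algebra by cardinality. Being also orthogonal to its own line, y would lie in the
      radical.\<close>
    have "card (add_line b y) = card b * q"
      using b1 carr y card_add_line[OF _ b_minus b_smult, of n y] by auto
    then have "card (add_line b y) = card a1" using cb cR by (simp add: power2_eq_square)
    moreover have "add_line b y \<subseteq> a1"
      using b1 y by (auto elim!: add_lineE intro!: pattern_add pattern_smult)
    ultimately have all: "add_line b y = a1" using finite_pattern_algebra card_subset_eq by blast
    have "w (I + bracket y B) = 1" if "B \<in> a1" for B
    proof -
      have "B \<in> add_line b y" using that all by simp
      then obtain v c where v: "v \<in> b" "B = v + c \<cdot>\<^sub>m y" by (rule add_lineE)
      have cy: "c \<cdot>\<^sub>m y \<in> a1" by (rule pattern_smult[OF y(1)])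
      have "bracket y (c \<cdot>\<^sub>m y) = 0\<^sub>m n n"
        using bracket_smult(2)[OF y(1) y(1)] bracket_self[OF y(1)] by simp
      then have "w (I + bracket y (c \<cdot>\<^sub>m y)) = 1" using central_charsD(3)[OF w] by simp
      moreover have "v \<in> a1" using v b1 by blast
      ultimately show ?thesis unfolding v(2) using form_add_right[OF w y(1) _ cy] triv[OF v(1)] by simp
    qed
    then have "y \<in> R" using y by (simp add: R_def mat_radical_def)
    then show False using Rb y by blast
  qed
  let ?B = "one_plus n b"
  have "subgroup ?B G"
  proof (rule one_plus_subgroup[OF b1])
    show "b \<noteq> {}" using Rb Rs(2) pattern_zero by blast
    show "A + B + A * B \<in> b" if "A \<in> b" "B \<in> b" for A B
    proof -
      have "A * B \<in> b" using mult_a1_a1 that b1 Rs(2) Rb by blast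
      then show ?thesis using b_add that by blast
    qed
  qed
  moreover have "radical w \<subseteq> ?B" unfolding radical_eq[OF w] using Rb by (auto simp: R_def one_plus_def)
  moreover have "card ?B * q = card (carrier G)"
    using card_one_plus[of b n] b1 carr cb cR card_G by (auto simp: power2_eq_square subset_eq)
  moreover have "\<forall>x\<in>?B. \<forall>y\<in>?B. w (commut x y) = 1"
    using iso b1 commut_bracket[OF w] by (auto simp: one_plus_def subset_eq)
  moreover have "\<forall>x\<in>carrier G - ?B. \<exists>y\<in>?B. w (commut x y) \<noteq> 1"
  proof
    fix z assume z: "z \<in> carrier G - ?B"
    then obtain y where y: "y \<in> a1" "z = I + y" using GE by blast
    then have "y \<notin> b" using z by (auto simp: one_plus_def)
    then obtain y' where y': "y' \<in> b" "w (I + bracket y y') \<noteq> 1" using sep y by blast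
    have "w (commut z (I + y')) \<noteq> 1" using commut_bracket[OF w y(1), of y'] y' b1 y(2) by auto
    then show "\<exists>y\<in>?B. w (commut z y) \<noteq> 1" using y'(1) by (auto simp: one_plus_def)
  qed
  ultimately show ?thesis unfolding polarization_def by blast
qed

text \<open>The matrices \<open>1 + u E\<^sub>i\<^sub>j + v E\<^sub>i\<^sub>k + z E\<^sub>i\<^sub>l\<close> form an abelian group. Conjugation by the \<open>q\<^sup>2\<close>
  matrices \<open>1 + s E\<^sub>j\<^sub>l + t E\<^sub>k\<^sub>l\<close> moves a character of it that is nontrivial on \<open>E\<^sub>i\<^sub>l\<close> to
  \<open>q\<^sup>2\<close> distinct ones.\<close>

lemma rep_degree_ge_square:
  assumes rep: "complex_rep G d \<rho>" and D: "(i, j) \<in> D" "(j, k) \<in> D" "(k, l) \<in> D"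
    and nt: "\<rho> (I + elem_mat n i l z0) \<noteq> 1\<^sub>m d"
  shows "q ^ 2 \<le> d"
proof -
  have lt: "i < j" "j < k" "k < l" "l < n" using D D_less by auto
  then have lts: "i < n" "j < n" "k < n" "i < k" "i < l" "j < l" by auto
  have D': "(i, k) \<in> D" "(j, l) \<in> D" "(i, l) \<in> D" using D DD by blast+
  define R where "R u v z = elem_mat n i j u + (elem_mat n i k v + elem_mat n i l z)" for u v z :: 'f
  define T where "T s t = elem_mat n j l s + elem_mat n k l t" for s t :: 'f
  have Rc: "R u v z \<in> carrier_mat n n" for u v z by (simp add: R_def)
  have Tc: "T s t \<in> carrier_mat n n" for s t by (simp add: T_def)
  have R1: "R u v z \<in> a1" for u v z
    unfolding R_def by (intro pattern_add elem_mat_pattern D D')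
  have T1: "T s t \<in> a1" for s t
    unfolding T_def by (intro pattern_add elem_mat_pattern D D')
  note dist = add_mult_distrib_mat[of _ n n _ _ n] mult_add_distrib_mat[of _ n n _ n] elem_mat_mult
  have RR: "R u v z * R u' v' z' = 0\<^sub>m n n" for u v z u' v' z'
    using lt lts by (simp add: R_def dist)
  have TR: "T s t * R u v z = 0\<^sub>m n n" for s t u v z
    using lt lts by (simp add: R_def T_def dist)
  have RT: "R u v z * T s t = elem_mat n i l (u * s + v * t)" for s t u v z
  proof -
    have "R u v z * T s t = elem_mat n i l (u * s) + elem_mat n i l (v * t)"
      using lt lts by (simp add: R_def T_def dist)
    also have "\<dots> = elem_mat n i l (u * s + v * t)" by (intro eq_matI) (auto simp: elem_mat_def)
    finally show ?thesis .
  qed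
  have Radd: "R u v z + R u' v' z' = R (u + u') (v + v') (z + z')" for u v z u' v' z'
    by (intro eq_matI) (auto simp: R_def elem_mat_def)
  define e where "e u v z = I + R u v z" for u v z
  define f where "f s t = I + T s t" for s t
  have ee: "e u v z * e u' v' z' = e (u + u') (v + v') (z + z')" for u v z u' v' z'
    unfolding e_def one_plus_mult[OF Rc Rc] RR Radd using Rc by (simp add: right_add_zero_mat)
  \<comment> \<open>Of the two mixed products only \<open>R * T\<close> survives, and it is a
    multiple of E_il. Passing \<open>f s t\<close> across therefore shifts the entry at (i, l) and
    changes nothing else.\<close>
  have ef: "e u v z * f s t = f s t * e u v (z + (u * s + v * t))" for u v z s t
    unfolding e_def f_def one_plus_mult[OF Rc Tc] one_plus_mult[OF Tc Rc] TR RT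
    by (intro eq_matI) (auto simp: R_def T_def elem_mat_def)
  have eG: "e u v z \<in> carrier G" for u v z unfolding e_def by (rule one_plus_G[OF R1])
  have fG: "f s t \<in> carrier G" for s t unfolding f_def by (rule one_plus_G[OF T1])
  define E where "E = {e u v z | u v z. True}"
  define S where "S = (\<lambda>(s, t). f s t) ` UNIV"
  have conj: "ginv (f s t) \<otimes>\<^bsub>G\<^esub> e u v z \<otimes>\<^bsub>G\<^esub> f s t = e u v (z + (u * s + v * t))" for u v z s t
  proof -
    have "ginv (f s t) \<otimes>\<^bsub>G\<^esub> e u v z \<otimes>\<^bsub>G\<^esub> f s t = ginv (f s t) \<otimes>\<^bsub>G\<^esub> (e u v z \<otimes>\<^bsub>G\<^esub> f s t)"
      using eG fG by (intro m_assoc) auto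
    also have "e u v z \<otimes>\<^bsub>G\<^esub> f s t = f s t \<otimes>\<^bsub>G\<^esub> e u v (z + (u * s + v * t))" using ef by simp
    also have "ginv (f s t) \<otimes>\<^bsub>G\<^esub> (f s t \<otimes>\<^bsub>G\<^esub> e u v (z + (u * s + v * t)))
      = (ginv (f s t) \<otimes>\<^bsub>G\<^esub> f s t) \<otimes>\<^bsub>G\<^esub> e u v (z + (u * s + v * t))"
      using eG fG by (intro m_assoc[symmetric]) auto
    also have "\<dots> = e u v (z + (u * s + v * t))"
      using l_inv[OF fG] l_one[OF eG] by metis
    finally show ?thesis .
  qed
  have "inj (\<lambda>(s, t). f s t)"
  proof (rule injI, clarsimp)
    fix s t s' t' assume "f s t = f s' t'"
    then have TT: "T s t = T s' t'" unfolding f_def by (rule one_plus_inj[OF Tc Tc])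
    have "T s t $$ (j, l) = T s' t' $$ (j, l)" "T s t $$ (k, l) = T s' t' $$ (k, l)" using TT by auto
    then show "s = s' \<and> t = t'" using lt lts by (simp add: T_def elem_mat_index)
  qed
  then have "card S = q ^ 2"
    unfolding S_def by (simp add: card_image card_cartesian_product power2_eq_square UNIV_Times_UNIV[symmetric] del: UNIV_Times_UNIV)
  moreover have "card S \<le> d"
  proof (rule rep_degree_ge_card_conjugates[OF finite_G _ _ rep])
    show E: "subgroup E G"
    proof (rule finite_subgroupI)
      show sub: "E \<subseteq> carrier G" using eG by (auto simp: E_def)
      show "finite E" using sub finite_G finite_subset by blast
      show "E \<noteq> {}" by (auto simp: E_def)
      show "x \<otimes>\<^bsub>G\<^esub> y \<in> E" if "x \<in> E" "y \<in> E" for x y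
        using that ee unfolding E_def mult_G by blast
    qed
    show "x \<otimes>\<^bsub>G\<^esub> y = y \<otimes>\<^bsub>G\<^esub> x" if "x \<in> E" "y \<in> E" for x y
      using that unfolding E_def by (auto simp: ee add.commute)
    have e0: "I + elem_mat n i l z0 = e 0 0 z0"
      by (intro eq_matI) (auto simp: e_def R_def elem_mat_def)
    show "I + elem_mat n i l z0 \<in> E" unfolding e0 E_def by blast
    show "\<rho> (I + elem_mat n i l z0) \<noteq> 1\<^sub>m d" by (rule nt)
    show "S \<subseteq> carrier G" using fG by (auto simp: S_def)
    show "ginv s \<otimes>\<^bsub>G\<^esub> x \<otimes>\<^bsub>G\<^esub> s \<in> E" if sx: "s \<in> S" "x \<in> E" for s x
    proof -
      obtain a b where "s = f a b" using sx(1) by (auto simp: S_def)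
      moreover obtain u v z where "x = e u v z" using sx(2) by (auto simp: E_def)
      ultimately show ?thesis using conj unfolding E_def by auto
    qed
    show "\<exists>x\<in>E. w (ginv s \<otimes>\<^bsub>G\<^esub> x \<otimes>\<^bsub>G\<^esub> s) \<noteq> w (ginv t \<otimes>\<^bsub>G\<^esub> x \<otimes>\<^bsub>G\<^esub> t)"
      if w: "w \<in> lin_chars G E" "w (I + elem_mat n i l z0) \<noteq> 1" and st: "s \<in> S" "t \<in> S" "s \<noteq> t" for w s t
    proof -
      obtain a b a' b' where s: "s = f a b" and t: "t = f a' b'" using st by (auto simp: S_def)
      have wz: "w (e u v (z + z0)) \<noteq> w (e u v z)" for u v z
      proof -
        have "w (e u v z \<otimes>\<^bsub>G\<^esub> e 0 0 z0) = w (e u v z) * w (e 0 0 z0)"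
          by (rule lin_chars_mult[OF w(1)]) (auto simp: E_def)
        moreover have "w (e u v z) \<noteq> 0" by (rule lin_chars_nz[OF w(1)]) (auto simp: E_def)
        ultimately show ?thesis using w(2) unfolding e0 by (simp add: ee)
      qed
      have inE: "e u v z \<in> E" for u v z by (auto simp: E_def)
      show ?thesis
      proof (cases "a = a'")
        case False
        \<comment> \<open>With this u the conjugates of \<open>e u 0 0\<close> by s and t have
          entries at (i, l) that differ by exactly z0, the amount by which \<open>w\<close> is known
          to change its value. The other case uses v in the same way.\<close>
        define u where "u = z0 / (a - a')"
        have "u * (a - a') = z0" using False by (simp add: u_def)
        then have "0 + (u * a + 0 * b) = (0 + (u * a' + 0 * b')) + z0" by (simp add: algebra_simps)
        then show ?thesis using wz[of u 0 "0 + (u * a' + 0 * b')"] unfolding s t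
          by (intro bexI[OF _ inE[of u 0 0]]) (simp only: conj simp_thms)
      next
        case True
        then have "b \<noteq> b'" using st s t by auto
        define v where "v = z0 / (b - b')"
        have "v * (b - b') = z0" using \<open>b \<noteq> b'\<close> by (simp add: v_def)
        then have "0 + (0 * a + v * b) = (0 + (0 * a' + v * b')) + z0" by (simp add: algebra_simps)
        then show ?thesis using wz[of 0 v "0 + (0 * a' + v * b')"] unfolding s t
          by (intro bexI[OF _ inE[of 0 v 0]]) (simp only: conj simp_thms)
      qed
    qed
  qed
  ultimately show ?thesis by simp
qed

text \<open>The degree bound makes \<open>\<rho>\<close> trivial on each 1 + u E_kl with (k, l) in
  \<open>D O D O D\<close>. Pattern induction provides E_kl A = 0, so (1 + u E_kl)(1 + A) = 1 + (u
  E_kl + A) exactly, and triviality spreads to sums.\<close>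

lemma rep_trivial_on_N:
  assumes rep: "complex_rep G d \<rho>" and d: "d < q ^ 2" and x: "x \<in> N"
  shows "\<rho> x = 1\<^sub>m d"
proof -
  obtain A where A: "A \<in> a3" "x = I + A" using x by (auto simp: one_plus_def)
  have D3: "D O D O D \<subseteq> {(i, j). i < j \<and> j < n}" using DD D_less by blast
  have "\<rho> (I + A) = 1\<^sub>m d"
    using A(1) D3
  proof (induction A rule: pattern_induct)
    case zero
    then show ?case using complex_repD(2)[OF rep] by simp
  next
    case (step A k l u)
    obtain i j where ij: "(k, i) \<in> D" "(i, j) \<in> D" "(j, l) \<in> D" using step.hyps(2) by blast
    have E: "\<rho> (I + elem_mat n k l u) = 1\<^sub>m d"
      using rep_degree_ge_square[OF rep ij] d by (meson not_le)
    have e1: "elem_mat n k l u \<in> a1" using elem_mat_pattern[OF step.hyps(2)] a31 by blast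
    have A1: "A \<in> a1" using step.hyps(1) a31 by blast
    have "(I + elem_mat n k l u) * (I + A) = I + (elem_mat n k l u + A)"
      unfolding one_plus_mult[OF elem_mat_carrier carr[OF A1]] step.hyps(3)
      using right_add_zero_mat[of "elem_mat n k l u + A" n n] carr[OF A1] by simp
    then show ?case using complex_repD(3)[OF rep one_plus_G[OF e1] one_plus_G[OF A1]] E step.IH by simp
  qed
  then show ?thesis using A by simp
qed

text \<open>The set over which both characters and functionals are fibred, and in terms of which
  both are counted.\<close>

abbreviation chars2 :: "('f mat \<Rightarrow> complex) set" where
  "chars2 \<equiv> {w \<in> central_chars. card (mat_radical w) * q ^ 2 = card a1}"

lemma card_irr_chars:
  "card (irr_chars_of_degree G q) * card a2 * q ^ 2 =
    card chars2 * card a1"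
proof -
  have q: "q > 0" using q2 by simp
  have lt: "q < q ^ 2" using q2 by (simp add: power2_eq_square)
  have cZ: "card Z = card a2" by (rule card_one_plus) (use carr2 in blast)
  have "{w\<in>central_chars. card (radical w) * q ^ 2 = card (carrier G)} =
    chars2"
    using card_radical card_G by auto
  moreover have "card (irr_chars_of_degree G q) * card Z * q ^ 2 =
    card {w\<in>central_chars. card (radical w) * q ^ 2 = card (carrier G)} * card (carrier G)"
  proof (rule card_irr_chars_of_degree[OF q])
    show "\<rho> x = 1\<^sub>m q" if "irreducible_rep G q \<rho>" "x \<in> N" for \<rho> x
      using rep_trivial_on_N[OF _ lt that(2)] that(1) by (simp add: irreducible_rep_def)
  qed (rule polarization_exists)
  ultimately show ?thesis using cZ card_G by simp
qed

end

section \<open>Coadjoint orbits\<close>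

text \<open>Take any additive character with value different from 1 at 1. Its q rescalings x -> psi
  (c x) are distinct, and the additive group of the field has only q characters, so they are all of
  them.\<close>

lemma additive_character_exists:
  "\<exists>\<psi> :: 'f::{finite,field} \<Rightarrow> complex. (\<forall>x. \<psi> x \<noteq> 0) \<and> (\<forall>x y. \<psi> (x + y) = \<psi> x * \<psi> y) \<and>
    (\<exists>x. \<psi> x \<noteq> 1) \<and>
    (\<forall>\<theta>. (\<forall>x. \<theta> x \<noteq> 0) \<longrightarrow> (\<forall>x y. \<theta> (x + y) = \<theta> x * \<theta> y) \<longrightarrow> (\<exists>c. \<forall>x. \<theta> x = \<psi> (c * x)))"
proof -
  define A :: "'f monoid" where "A = \<lparr>carrier = UNIV, mult = (+), one = 0\<rparr>"
  have "group A"
    by (rule groupI) (auto simp: A_def add.assoc intro: exI[of _ "- _"])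
  then interpret A: group A .
  have fin: "finite (carrier A)" by (simp add: A_def)
  have sub: "subgroup (UNIV :: 'f set) A" using A.subgroup_self by (simp add: A_def)
  note ab = A.abelian_lin_chars[OF fin sub]
  have comm: "x \<otimes>\<^bsub>A\<^esub> y = y \<otimes>\<^bsub>A\<^esub> x" for x y by (simp add: A_def add.commute)
  have mem: "\<theta> \<in> lin_chars A UNIV \<longleftrightarrow> (\<forall>x. \<theta> x \<noteq> 0) \<and> (\<forall>x y. \<theta> (x + y) = \<theta> x * \<theta> y)" for \<theta>
    by (auto simp: lin_chars_def A_def)
  obtain \<psi> where \<psi>: "\<psi> \<in> lin_chars A UNIV" "\<psi> 1 \<noteq> 1"
    using ab(3)[of 1] comm by (auto simp: A_def)
  have \<psi>m: "\<psi> x \<noteq> 0" "\<psi> (x + y) = \<psi> x * \<psi> y" for x y using \<psi>(1) mem by auto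
  have inj: "inj (\<lambda>c x. \<psi> (c * x))"
  proof (rule injI)
    fix c d assume e: "(\<lambda>x. \<psi> (c * x)) = (\<lambda>x. \<psi> (d * x))"
    show "c = d"
    proof (rule ccontr)
      assume "c \<noteq> d"
      \<comment> \<open>At x = 1 / (c - d) the arguments c x and d x differ by 1, where
        \<open>\<psi>\<close> is nontrivial.\<close>
      then have "c * inverse (c - d) = d * inverse (c - d) + 1" by (simp add: field_simps)
      moreover have "\<psi> (c * inverse (c - d)) = \<psi> (d * inverse (c - d))" using e by metis
      ultimately show False using \<psi>m \<psi>(2) by simp
    qed
  qed
  have "range (\<lambda>c x. \<psi> (c * x)) \<subseteq> lin_chars A UNIV"
    using \<psi>m by (auto simp: mem distrib_left)
  moreover have "card (range (\<lambda>c x. \<psi> (c * x))) = card (lin_chars A UNIV)"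
    using card_image[OF inj] ab(2) comm by simp
  ultimately have "range (\<lambda>c x. \<psi> (c * x)) = lin_chars A UNIV"
    using ab(1) comm card_subset_eq by blast
  then have "\<exists>c. \<forall>x. \<theta> x = \<psi> (c * x)" if "\<forall>x. \<theta> x \<noteq> 0" "\<forall>x y. \<theta> (x + y) = \<theta> x * \<theta> y" for \<theta>
  proof -
    have "\<theta> \<in> range (\<lambda>c x. \<psi> (c * x))" using that mem \<open>range _ = _\<close> by blast
    then show ?thesis by auto
  qed
  then show ?thesis using \<psi>m \<psi>(2) by (intro exI[of _ \<psi>]) blast
qed

section \<open>The coadjoint action, its stabilizers and its orbits\<close>

context pattern
begin

abbreviation dual :: "('f mat \<Rightarrow> 'f) set" where "dual \<equiv> pattern_dual n D"

lemma dualD: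
  assumes "l \<in> dual"
  shows "X \<in> a1 \<Longrightarrow> Y \<in> a1 \<Longrightarrow> l (X + Y) = l X + l Y" "X \<in> a1 \<Longrightarrow> l (c \<cdot>\<^sub>m X) = c * l X"
    "X \<notin> a1 \<Longrightarrow> l X = 0"
  using assms by (auto simp: pattern_dual_def)

lemma dual_zero: assumes "l \<in> dual" shows "l (0\<^sub>m n n) = 0"
proof -
  have "l (0 \<cdot>\<^sub>m 0\<^sub>m n n) = 0" using dualD(2)[OF assms pattern_zero, of 0] by simp
  then show ?thesis by simp
qed

lemma dual_minus:
  assumes "l \<in> dual" "X \<in> a1" "Y \<in> a1" shows "l (X - Y) = l X - l Y"
proof -
  have "X - Y = X + (-1) \<cdot>\<^sub>m Y" using assms carr by (intro eq_matI) (auto simp: subset_eq)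
  then show ?thesis using dualD[OF assms(1)] assms pattern_smult[OF assms(3)] by simp
qed

lemma dual_eqI:
  assumes "l \<in> dual" "m \<in> dual" "\<And>X. X \<in> a1 \<Longrightarrow> l X = m X" shows "l = m"
proof
  fix X show "l X = m X" using assms(3) dualD(3)[OF assms(1)] dualD(3)[OF assms(2)] by (cases "X \<in> a1") auto
qed

definition dual_radical :: "('f mat \<Rightarrow> 'f) \<Rightarrow> 'f mat set" where
  "dual_radical l = {A \<in> a1. \<forall>B\<in>a1. l (bracket A B) = 0}"

abbreviation dual2 :: "('f mat \<Rightarrow> 'f) set" where
  "dual2 \<equiv> {l \<in> dual. card (dual_radical l) * q ^ 2 = card a1}"

lemma G_mult_a1:
  assumes "g \<in> carrier G" "X \<in> a1" shows "g * X \<in> a1" "X * g \<in> a1"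
proof -
  obtain A where A: "A \<in> a1" "g = I + A" using assms(1) by (rule GE)
  have "g * X = X + A * X"
    unfolding A(2) using add_mult_distrib_mat[OF one_carrier_mat carr[OF A(1)] carr[OF assms(2)]] carr[OF assms(2)] by simp
  then show "g * X \<in> a1" using assms(2) mult_in_a1[OF A(1)] by (simp add: pattern_add)
  have "X * g = X + X * A"
    unfolding A(2) using mult_add_distrib_mat[OF carr[OF assms(2)] one_carrier_mat carr[OF A(1)]] carr[OF assms(2)] by simp
  then show "X * g \<in> a1" using assms(2) mult_in_a1[OF _ A(1)] by (simp add: pattern_add)
qed

abbreviation co :: "'f mat \<Rightarrow> ('f mat \<Rightarrow> 'f) \<Rightarrow> 'f mat \<Rightarrow> 'f" where "co \<equiv> coadjoint n D"

lemma ginv_mult: assumes "g \<in> carrier G" shows "ginv g * g = I" "g * ginv g = I"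
  using l_inv[OF assms] r_inv[OF assms] by simp_all

lemma co_in: "X \<in> a1 \<Longrightarrow> co g l X = l (ginv g * X * g)"
  by (simp add: coadjoint_def)

lemma conj_a1: "g \<in> carrier G \<Longrightarrow> X \<in> a1 \<Longrightarrow> ginv g * X * g \<in> a1"
  by (intro G_mult_a1 inv_closed)

lemma co_dual:
  assumes g: "g \<in> carrier G" and l: "l \<in> dual" shows "co g l \<in> dual"
  unfolding pattern_dual_def mem_Collect_eq
proof (intro conjI ballI allI impI)
  note gc = carrier_G_mat[OF g] carrier_G_mat[OF inv_closed[OF g]]
  fix X Y assume X: "X \<in> a1" and Y: "Y \<in> a1"
  have "ginv g * (X + Y) = ginv g * X + ginv g * Y"
    by (rule mult_add_distrib_mat[OF gc(2) carr[OF X] carr[OF Y]])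
  then have "ginv g * (X + Y) * g = ginv g * X * g + ginv g * Y * g"
    using add_mult_distrib_mat[of "ginv g * X" n n "ginv g * Y" g n] gc carr[OF X] carr[OF Y] by simp
  then show "co g l (X + Y) = co g l X + co g l Y"
    using co_in[OF X] co_in[OF Y] co_in[OF pattern_add[OF X Y]] dualD(1)[OF l conj_a1[OF g X] conj_a1[OF g Y]]
    by simp
next
  note gc = carrier_G_mat[OF g] carrier_G_mat[OF inv_closed[OF g]]
  fix c X assume X: "X \<in> a1"
  have "ginv g * (c \<cdot>\<^sub>m X) = c \<cdot>\<^sub>m (ginv g * X)" by (rule mult_smult_distrib[OF gc(2) carr[OF X]])
  then have "ginv g * (c \<cdot>\<^sub>m X) * g = c \<cdot>\<^sub>m (ginv g * X * g)"
    using mult_smult_assoc_mat[of "ginv g * X" n n g n c] gc carr[OF X] by simp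
  then show "co g l (c \<cdot>\<^sub>m X) = c * co g l X"
    using co_in[OF X] co_in[OF pattern_smult[OF X]] dualD(2)[OF l conj_a1[OF g X]] by simp
next
  fix X assume "X \<notin> a1" then show "co g l X = 0" by (simp add: coadjoint_def)
qed

lemma co_mult:
  assumes g: "g \<in> carrier G" and h: "h \<in> carrier G" and l: "l \<in> dual"
  shows "co (g * h) l = co g (co h l)"
proof (rule dual_eqI)
  have gh: "g * h \<in> carrier G" using m_closed[OF g h] by simp
  show "co (g * h) l \<in> dual" by (rule co_dual[OF gh l])
  show "co g (co h l) \<in> dual" by (intro co_dual g h l)
  fix X assume X: "X \<in> a1"
  note c = carrier_G_mat[OF g] carrier_G_mat[OF h] carrier_G_mat[OF inv_closed[OF g]]
    carrier_G_mat[OF inv_closed[OF h]] carr[OF X]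
  have "ginv (g * h) = ginv h * ginv g" using inv_mult_group[OF g h] by simp
  then have "ginv (g * h) * X * (g * h) = ginv h * (ginv g * X * g) * h"
    using c by (simp add: assoc_mult_mat[of _ n n _ n _ n])
  then show "co (g * h) l X = co g (co h l) X"
    using co_in[OF X] co_in[OF conj_a1[OF g X]] by simp
qed

lemma co_one: assumes l: "l \<in> dual" shows "co (I) l = l"
proof (rule dual_eqI)
  have "ginv (I) = I" using inv_one by simp
  then show "co (I) l X = l X" if "X \<in> a1" for X using co_in[OF that] carr[OF that] by simp
  show "co (I) l \<in> dual" using co_dual[OF one_closed l] by simp
qed (rule l)

text \<open>Substituting X = g Y, which is possible as g maps the algebra onto itself, turns
  invariance of \<open>l\<close> into l (g Y) = l (Y g) for all Y. For g = 1 + A this reads l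
  ([A, Y]) = 0. The description is exact and involves no reduction modulo \<open>a3\<close>.\<close>

lemma stabilizer_eq:
  assumes l: "l \<in> dual" shows "{g \<in> carrier G. co g l = l} = one_plus n (dual_radical l)"
proof -
  have key: "co g l = l \<longleftrightarrow> A \<in> dual_radical l" if A: "A \<in> a1" "g = I + A" for g A
  proof -
    have g: "g \<in> carrier G" using one_plus_G[OF A(1)] A(2) by simp
    note c = carrier_G_mat[OF g] carrier_G_mat[OF inv_closed[OF g]] carr[OF A(1)]
    have br: "l (g * Y) = l (Y * g) \<longleftrightarrow> l (bracket A Y) = 0" if Y: "Y \<in> a1" for Y
    proof -
      note Yc = carr[OF Y]
      have "g * Y = Y + A * Y"
        unfolding A(2) using add_mult_distrib_mat[OF one_carrier_mat c(3) Yc] Yc by simp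
      moreover have "Y * g = Y + Y * A"
        unfolding A(2) using mult_add_distrib_mat[OF Yc one_carrier_mat c(3)] Yc by simp
      ultimately show ?thesis unfolding bracket_def
        using dualD(1)[OF l Y] dual_minus[OF l] mult_in_a1[OF A(1) Y] mult_in_a1[OF Y A(1)] by simp
    qed
    show ?thesis
    proof
      assume e: "co g l = l"
      have "l (bracket A Y) = 0" if Y: "Y \<in> a1" for Y
      proof -
        have "ginv g * (g * Y) = Y"
          using assoc_mult_mat[OF c(2,1) carr[OF Y]] ginv_mult[OF g] carr[OF Y] by simp
        then have "co g l (g * Y) = l (Y * g)" using co_in[OF G_mult_a1(1)[OF g Y]] by simp
        then show ?thesis using br[OF Y] e by simp
      qed
      then show "A \<in> dual_radical l" using A(1) by (simp add: dual_radical_def)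
    next
      assume "A \<in> dual_radical l"
      then have b: "\<And>Y. Y \<in> a1 \<Longrightarrow> l (bracket A Y) = 0" by (simp add: dual_radical_def)
      show "co g l = l"
      proof (rule dual_eqI[OF co_dual[OF g l] l])
        fix X assume X: "X \<in> a1"
        have Y: "ginv g * X \<in> a1" by (rule G_mult_a1(1)[OF inv_closed[OF g] X])
        have "g * (ginv g * X) = X"
          using assoc_mult_mat[OF c(1,2) carr[OF X]] ginv_mult[OF g] carr[OF X] by simp
        then have "l X = l (ginv g * X * g)" using br[OF Y] b[OF Y] by simp
        then show "co g l X = l X" using co_in[OF X] by simp
      qed
    qed
  qed
  show ?thesis
  proof (intro equalityI subsetI)
    fix g assume "g \<in> {g \<in> carrier G. co g l = l}"
    then have g: "g \<in> carrier G" "co g l = l" by auto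
    obtain A where A: "A \<in> a1" "g = I + A" using g(1) by (rule GE)
    then show "g \<in> one_plus n (dual_radical l)" using key[OF A] g(2) by (simp add: one_plus_def)
  next
    fix g assume "g \<in> one_plus n (dual_radical l)"
    then obtain A where A: "A \<in> dual_radical l" "g = I + A" by (auto simp: one_plus_def)
    then have "A \<in> a1" by (simp add: dual_radical_def)
    then show "g \<in> {g \<in> carrier G. co g l = l}" using key[of A g] A one_plus_G by simp
  qed
qed

abbreviation orb :: "('f mat \<Rightarrow> 'f) \<Rightarrow> ('f mat \<Rightarrow> 'f) set" where "orb \<equiv> coadjoint_orbit n D"

lemma orbit_eq_image: "orb l = (\<lambda>g. co g l) ` carrier G"
  by (auto simp: coadjoint_orbit_def)

text \<open>Orbit-stabilizer: the fibres of g -> co g l are the left cosets of the stabilizer, which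
  has as many elements as the radical by \<open>stabilizer_eq\<close>.\<close>

lemma card_orbit:
  assumes l: "l \<in> dual" shows "card (orb l) * card (dual_radical l) = card a1"
proof -
  let ?f = "\<lambda>g. co g l"
  have "card (carrier G) = (\<Sum>m\<in>?f ` carrier G. \<Sum>g\<in>{g \<in> carrier G. ?f g = m}. 1)"
    using sum.image_gen[OF finite_G, of "\<lambda>_. 1::nat" ?f] by simp
  also have "\<dots> = (\<Sum>m\<in>?f ` carrier G. card (dual_radical l))"
  proof (rule sum.cong[OF refl])
    fix m assume "m \<in> ?f ` carrier G"
    then obtain h where h: "h \<in> carrier G" "m = co h l" by blast
    have "{g \<in> carrier G. ?f g = m} = (\<lambda>s. h * s) ` {g \<in> carrier G. co g l = l}"
    proof (intro equalityI subsetI)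
      fix g assume "g \<in> {g \<in> carrier G. ?f g = m}"
      then have g: "g \<in> carrier G" "co g l = co h l" using h by auto
      let ?s = "ginv h * g"
      have s: "?s \<in> carrier G" using m_closed[OF inv_closed[OF h(1)] g(1)] by simp
      have "co ?s l = co (ginv h) (co h l)" using co_mult[OF inv_closed[OF h(1)] g(1) l] g(2) by simp
      also have "\<dots> = l" using co_mult[OF inv_closed[OF h(1)] h(1) l] ginv_mult[OF h(1)] co_one[OF l] by simp
      finally have "co ?s l = l" .
      moreover have "g = h * ?s"
        using assoc_mult_mat[OF carrier_G_mat[OF h(1)] carrier_G_mat[OF inv_closed[OF h(1)]] carrier_G_mat[OF g(1)]]
          ginv_mult[OF h(1)] carrier_G_mat[OF g(1)] by simp
      ultimately show "g \<in> (\<lambda>s. h * s) ` {g \<in> carrier G. co g l = l}" using s by blast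
    next
      fix g assume "g \<in> (\<lambda>s. h * s) ` {g \<in> carrier G. co g l = l}"
      then obtain s where s: "s \<in> carrier G" "co s l = l" "g = h * s" by auto
      then show "g \<in> {g \<in> carrier G. ?f g = m}" using h m_closed[OF h(1) s(1)] co_mult[OF h(1) s(1) l] by simp
    qed
    moreover have "inj_on (\<lambda>s. h * s) {g \<in> carrier G. co g l = l}"
    proof (rule inj_onI)
      fix s t assume "s \<in> {g \<in> carrier G. co g l = l}" "t \<in> {g \<in> carrier G. co g l = l}" "h * s = h * t"
      then show "s = t" using Units_l_cancel[of h s t] h(1) Units_eq by simp
    qed
    ultimately have "card {g \<in> carrier G. ?f g = m} = card (one_plus n (dual_radical l))"
      using stabilizer_eq[OF l] by (simp add: card_image)
    also have "\<dots> = card (dual_radical l)" by (rule card_one_plus) (auto simp: dual_radical_def carr)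
    finally show "(\<Sum>g\<in>{g \<in> carrier G. ?f g = m}. 1) = card (dual_radical l)" by simp
  qed
  finally show ?thesis using card_G by (simp add: orbit_eq_image)
qed

lemma orbit_self: "l \<in> dual \<Longrightarrow> l \<in> orb l"
  unfolding orbit_eq_image using co_one one_closed by (intro image_eqI[of _ _ "I"]) auto

lemma orbit_subset: "l \<in> dual \<Longrightarrow> orb l \<subseteq> dual"
  unfolding orbit_eq_image using co_dual by blast

lemma orbit_mem_eq:
  assumes l: "l \<in> dual" and m: "m \<in> orb l"
  shows "orb m = orb l"
proof -
  have sub: "orb (co g k) \<subseteq> orb k" if g: "g \<in> carrier G" and k: "k \<in> dual" for g k
  proof
    fix x assume "x \<in> orb (co g k)"
    then obtain h where h: "h \<in> carrier G" "x = co h (co g k)" by (auto simp: orbit_eq_image)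
    then have "x = co (h * g) k" using co_mult[OF h(1) g k] by simp
    then show "x \<in> orb k" using m_closed[OF h(1) g] by (auto simp: orbit_eq_image)
  qed
  obtain g where g: "g \<in> carrier G" "m = co g l" using m by (auto simp: orbit_eq_image)
  have "l = co (ginv g) m"
    using co_mult[OF inv_closed[OF g(1)] g(1) l] ginv_mult[OF g(1)] co_one[OF l] g(2) by simp
  then have "orb l \<subseteq> orb m"
    using sub[OF inv_closed[OF g(1)] co_dual[OF g(1) l]] g(2) by simp
  then show ?thesis using sub[OF g(1) l] g(2) by blast
qed

lemma card_dual_orbits:
  assumes fin: "finite dual"
  shows "k * card {Orb \<in> coadjoint_orbits n D. card Orb = k \<and> Orb \<subseteq> dual} =
    card {l \<in> dual. card (orb l) = k}"
proof -
  let ?C = "{Orb \<in> coadjoint_orbits n D. card Orb = k \<and> Orb \<subseteq> dual}"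
  have U: "\<Union> ?C = {l \<in> dual. card (orb l) = k}"
  proof (intro equalityI subsetI)
    fix m assume "m \<in> \<Union> ?C"
    then obtain l where l: "l \<in> dual" "card (orb l) = k" "m \<in> orb l"
      by (auto simp: coadjoint_orbits_def)
    then show "m \<in> {l \<in> dual. card (orb l) = k}"
      using orbit_mem_eq[OF l(1,3)] orbit_subset[OF l(1)] by auto
  next
    fix m assume "m \<in> {l \<in> dual. card (orb l) = k}"
    then show "m \<in> \<Union> ?C" using orbit_self[of m] orbit_subset[of m] by (auto simp: coadjoint_orbits_def)
  qed
  have "k * card ?C = card (\<Union> ?C)"
  proof (rule card_partition)
    show "finite ?C" using fin by (simp add: coadjoint_orbits_def)
    show "finite (\<Union> ?C)" unfolding U using fin by simp
    show "card c = k" if "c \<in> ?C" for c using that by simp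
    fix c1 c2 assume c: "c1 \<in> ?C" "c2 \<in> ?C" "c1 \<noteq> c2"
    then obtain l1 l2 where l: "l1 \<in> dual" "c1 = orb l1" "l2 \<in> dual" "c2 = orb l2"
      by (auto simp: coadjoint_orbits_def)
    show "c1 \<inter> c2 = {}"
    proof (rule ccontr)
      assume "c1 \<inter> c2 \<noteq> {}"
      then obtain x where "x \<in> c1" "x \<in> c2" by blast
      then show False using orbit_mem_eq[OF l(1), of x] orbit_mem_eq[OF l(3), of x] l c(3) by simp
    qed
  qed
  then show ?thesis unfolding U .
qed

lemma dual_radical_space:
  assumes l: "l \<in> dual" and A: "A \<in> dual_radical l" and B: "B \<in> dual_radical l"
  shows "A - B \<in> dual_radical l"
proof -
  have AB: "A \<in> a1" "B \<in> a1" using A B by (auto simp: dual_radical_def)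
  have "l (bracket (A - B) Y) = 0" if Y: "Y \<in> a1" for Y
  proof -
    have "A - B = A + (-1) \<cdot>\<^sub>m B" using AB[THEN carr] by (intro eq_matI) auto
    then have "bracket (A - B) Y = bracket A Y + (-1) \<cdot>\<^sub>m bracket B Y"
      using bracket_add_left[OF AB(1) pattern_smult[OF AB(2)] Y] bracket_smult(1)[OF AB(2) Y] by simp
    moreover have b: "bracket A Y \<in> a1" "bracket B Y \<in> a1" using bracket_in_a2 AB Y a21 by blast+
    moreover have "l (bracket A Y) = 0" "l (bracket B Y) = 0" using A B Y by (auto simp: dual_radical_def)
    ultimately show ?thesis
      using dualD(1)[OF l b(1) pattern_smult[OF b(2), of "-1"]] dualD(2)[OF l b(2), of "-1"] by simp
  qed
  then show ?thesis using AB by (simp add: dual_radical_def pattern_minus)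
qed

text \<open>A three-dimensional space meets the radical only in 0, so radical and space add up
  injectively inside the algebra. By orbit-stabilizer the orbit has at least q^3 elements.\<close>

lemma card_dual_radical_le:
  assumes l: "l \<in> dual" and D: "(i, j) \<in> D" "(j, k) \<in> D" "(k, h) \<in> D" and nz: "l (elem_mat n i h 1) \<noteq> 0"
  shows "card (dual_radical l) * q ^ 3 \<le> card a1"
proof -
  have lt: "i < j" "j < k" "k < h" "h < n" using D D_less by auto
  then have lts: "i < n" "j < n" "k < n" "i < k" "i < h" "j < h" by auto
  have D': "(i, k) \<in> D" "(j, h) \<in> D" "(i, h) \<in> D" using D DD by blast+
  \<comment> \<open>The directions E_jh, E_kh and E_ij are detected by bracketing with E_ij, E_ik
    and E_jh, which gives -s, -t and u times E_ih. The first two alone would be compatible with an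
    orbit of size q^2; E_ij makes the bound strict.\<close>
  define T where "T s t u = elem_mat n j h s + (elem_mat n k h t + elem_mat n i j u)" for s t u :: 'f
  have T1: "T s t u \<in> a1" for s t u
    unfolding T_def by (intro pattern_add elem_mat_pattern D D')
  note dist = add_mult_distrib_mat[of _ n n _ _ n] mult_add_distrib_mat[of _ n n _ n] elem_mat_mult
  have e1: "elem_mat n a b v \<in> a1" if "(a, b) \<in> D" for a b and v :: 'f using that by (rule elem_mat_pattern)
  have lE: "l (elem_mat n i h v) = v * l (elem_mat n i h 1)" for v
    using dualD(2)[OF l e1[OF D'(3)], of v 1] by (simp add: elem_mat_smult)
  have nE: "0\<^sub>m n n - elem_mat n i h v = elem_mat n i h (- v)" for v :: 'f
    by (intro eq_matI) (auto simp: elem_mat_def)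
  have b1: "bracket (T s t u) (elem_mat n i j 1) = elem_mat n i h (- s)" for s t u
    using lt lts by (simp add: bracket_def T_def dist nE)
  have b2: "bracket (T s t u) (elem_mat n i k 1) = elem_mat n i h (- t)" for s t u
    using lt lts by (simp add: bracket_def T_def dist nE)
  have mE: "elem_mat n i h v - 0\<^sub>m n n = elem_mat n i h v" for v :: 'f
    by (intro eq_matI) (auto simp: elem_mat_def)
  have b3: "bracket (T s t u) (elem_mat n j h 1) = elem_mat n i h u" for s t u
    using lt lts by (simp add: bracket_def T_def dist mE)
  have triv: "s = 0 \<and> t = 0 \<and> u = 0" if T: "T s t u \<in> dual_radical l" for s t u
  proof -
    have z: "\<And>Y. Y \<in> a1 \<Longrightarrow> l (bracket (T s t u) Y) = 0" using T by (simp add: dual_radical_def)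
    show ?thesis
      using z[OF e1[OF D(1), of 1]] z[OF e1[OF D'(1), of 1]] z[OF e1[OF D'(2), of 1]] nz
      unfolding b1 b2 b3 lE[of "- s"] lE[of "- t"] lE[of u] by simp
  qed
  have Rc: "\<And>R. R \<in> dual_radical l \<Longrightarrow> R \<in> carrier_mat n n" by (auto simp: dual_radical_def carr)
  have Tc: "T s t u \<in> carrier_mat n n" for s t u by (rule carr[OF T1])
  let ?g = "\<lambda>(R, s, t, u). R + T s t u"
  have "inj_on ?g (dual_radical l \<times> UNIV)"
  proof (rule inj_onI, clarsimp)
    fix R s t u R' s' t' u'
    assume R: "R \<in> dual_radical l" "R' \<in> dual_radical l" and e: "R + T s t u = R' + T s' t' u'"
    have "T (s - s') (t - t') (u - u') = R' - R"
    proof (rule eq_matI)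
      fix a b assume "a < dim_row (R' - R)" "b < dim_col (R' - R)"
      then have ab: "a < n" "b < n" using Rc[OF R(1)] by auto
      have "(R + T s t u) $$ (a, b) = (R' + T s' t' u') $$ (a, b)" using e by simp
      then show "T (s - s') (t - t') (u - u') $$ (a, b) = (R' - R) $$ (a, b)"
        using ab Rc[OF R(1)] Rc[OF R(2)] by (auto simp: T_def elem_mat_index algebra_simps split: if_splits)
    qed (use Rc[OF R(1)] Tc[of "s - s'" "t - t'" "u - u'"] in auto)
    then have "T (s - s') (t - t') (u - u') \<in> dual_radical l" using dual_radical_space[OF l R(2,1)] by simp
    then have st: "s = s'" "t = t'" "u = u'" using triv by fastforce+
    have "R = R'"
    proof (rule eq_matI)
      fix a b assume "a < dim_row R'" "b < dim_col R'"
      then have ab: "a < n" "b < n" using Rc[OF R(2)] by auto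
      have "(R + T s t u) $$ (a, b) = (R' + T s t u) $$ (a, b)" using e st by simp
      then show "R $$ (a, b) = R' $$ (a, b)" using ab Rc[OF R(1)] Rc[OF R(2)] Tc[of s t u] by simp
    qed (use Rc[OF R(1)] Rc[OF R(2)] in auto)
    then show "R = R' \<and> s = s' \<and> t = t' \<and> u = u'" using st by simp
  qed
  moreover have "?g ` (dual_radical l \<times> UNIV) \<subseteq> a1"
    using T1 by (auto simp: dual_radical_def intro!: pattern_add)
  ultimately have "card (dual_radical l \<times> (UNIV :: ('f \<times> 'f \<times> 'f) set)) \<le> card a1"
    using card_inj_on_le[OF _ _ finite_pattern_algebra] by blast
  then show ?thesis
    by (simp add: card_cartesian_product power3_eq_cube mult.assoc UNIV_Times_UNIV[symmetric] del: UNIV_Times_UNIV)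
qed

lemma dual_zero_on_a3:
  assumes l: "l \<in> dual" and card: "card (dual_radical l) * q ^ 2 = card a1" and A: "A \<in> a3"
  shows "l A = 0"
proof -
  have D3: "D O D O D \<subseteq> {(i, j). i < j \<and> j < n}" using DD D_less by blast
  have pos: "card a1 > 0" by (rule card_pattern_pos)
  have lt: "card a1 < card (dual_radical l) * q ^ 3"
  proof -
    have "card (dual_radical l) * q ^ 3 = card a1 * q" using card by (simp add: power2_eq_square power3_eq_cube mult.assoc[symmetric])
    moreover have "card a1 * q \<ge> card a1 * 2" using q2 by (intro mult_le_mono2)
    ultimately show ?thesis using pos by linarith
  qed
  show ?thesis
    using A D3
  proof (induction A rule: pattern_induct)
    case zero show ?case by (rule dual_zero[OF l])
  next
    case (step A k h u)
    obtain i j where ij: "(k, i) \<in> D" "(i, j) \<in> D" "(j, h) \<in> D" using step.hyps(2) by blast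
    have z: "l (elem_mat n k h 1) = 0"
      using card_dual_radical_le[OF l ij] lt by (meson not_le)
    have e1: "elem_mat n k h v \<in> a1" for v :: 'f using elem_mat_pattern[OF step.hyps(2)] a31 by blast
    have "l (elem_mat n k h u) = 0"
      using dualD(2)[OF l e1, of u 1] z by (simp add: elem_mat_smult)
    moreover have "A \<in> a1" using step.hyps(1) a31 by blast
    ultimately show ?case using dualD(1)[OF l e1] step.IH by simp
  qed
qed

lemma orbit_card_iff:
  assumes l: "l \<in> dual"
  shows "card (orb l) = q ^ 2 \<longleftrightarrow> card (dual_radical l) * q ^ 2 = card a1"
proof -
  have "card a1 > 0" by (rule card_pattern_pos)
  then have "card (dual_radical l) > 0" using card_orbit[OF l] by (metis gr0I mult_is_0 less_irrefl)
  then show ?thesis using card_orbit[OF l] by (metis mult.commute mult_cancel1 less_irrefl)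
qed

section \<open>Additive characters of the algebra\<close>

definition add_group :: "'f mat monoid" where
  "add_group = \<lparr>carrier = a1, mult = (+), one = 0\<^sub>m n n\<rparr>"

lemma group_add_group: "group add_group"
proof (rule groupI)
  fix x assume "x \<in> carrier add_group"
  then have x: "x \<in> a1" by (simp add: add_group_def)
  show "\<exists>y\<in>carrier add_group. y \<otimes>\<^bsub>add_group\<^esub> x = \<one>\<^bsub>add_group\<^esub>"
  proof (rule bexI)
    show "(-1) \<cdot>\<^sub>m x \<otimes>\<^bsub>add_group\<^esub> x = \<one>\<^bsub>add_group\<^esub>"
      using carr[OF x] by (auto simp: add_group_def intro!: eq_matI)
    show "(-1) \<cdot>\<^sub>m x \<in> carrier add_group" using pattern_smult[OF x] by (simp add: add_group_def)
  qed
qed (auto simp: add_group_def pattern_add pattern_zero dest!: carr)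

lemma add_subgroup:
  assumes "V \<subseteq> a1" "0\<^sub>m n n \<in> V" "\<And>A B. A \<in> V \<Longrightarrow> B \<in> V \<Longrightarrow> A + B \<in> V"
  shows "subgroup V add_group"
proof (rule group.finite_subgroupI[OF group_add_group])
  show "finite V" using assms(1) finite_pattern_algebra finite_subset by blast
qed (use assms in \<open>auto simp: add_group_def\<close>)

lemma a1_subgroup: "subgroup a1 add_group" and a2_subgroup: "subgroup a2 add_group"
  using a21 by (auto intro!: add_subgroup pattern_zero pattern_add)

lemma lin_chars_add_group:
  "V \<subseteq> a1 \<Longrightarrow> w \<in> lin_chars add_group V \<longleftrightarrow> (\<forall>A\<in>V. w A \<noteq> 0) \<and> (\<forall>A. A \<notin> V \<longrightarrow> w A = 0) \<and>
    (\<forall>A\<in>V. \<forall>B\<in>V. w (A + B) = w A * w B)"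
  by (auto simp: lin_chars_def add_group_def)

text \<open>The transport of \<open>w\<close> along 1 + A -> A. Regarded as a character of a
  subgroup of \<open>add_group\<close>, it can be extended to the whole algebra by the same counting
  lemma that serves the group.\<close>

definition central_lift :: "('f mat \<Rightarrow> complex) \<Rightarrow> 'f mat \<Rightarrow> complex" where
  "central_lift w = (\<lambda>A. if A \<in> a2 then w (I + A) else 0)"

lemma central_lift_lin_char:
  assumes w: "w \<in> central_chars" shows "central_lift w \<in> lin_chars add_group a2"
proof -
  have "w (I + A) \<noteq> 0" if "A \<in> a2" for A
    by (rule lin_chars_nz[OF central_charsD(1)[OF w]]) (use that in \<open>auto simp: one_plus_def\<close>)
  then show ?thesis using central_char_add[OF w] pattern_add
    by (auto simp: lin_chars_add_group[OF a21] central_lift_def)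
qed

lemma card_central_lift_exts:
  assumes w: "w \<in> central_chars"
  shows "finite (lin_exts add_group (central_lift w) a2 a1)"
    "card (lin_exts add_group (central_lift w) a2 a1) * card a2 = card a1"
proof -
  interpret A: group add_group by (rule group_add_group)
  have "finite (lin_exts add_group (central_lift w) a2 a1) \<and>
    card (lin_exts add_group (central_lift w) a2 a1) * card a2 = card a1"
  proof (rule A.card_lin_exts[OF _ a2_subgroup a1_subgroup a21 central_lift_lin_char[OF w]])
    show "finite (carrier add_group)" by (simp add: add_group_def finite_pattern_algebra)
    fix x y assume xy: "x \<in> a1" "y \<in> a1"
    have "x \<otimes>\<^bsub>add_group\<^esub> y = y \<otimes>\<^bsub>add_group\<^esub> x \<otimes>\<^bsub>add_group\<^esub> \<one>\<^bsub>add_group\<^esub>"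
      using xy[THEN carr] comm_add_mat[of x n n y] by (simp add: add_group_def)
    then show "\<exists>c\<in>a2. x \<otimes>\<^bsub>add_group\<^esub> y = y \<otimes>\<^bsub>add_group\<^esub> x \<otimes>\<^bsub>add_group\<^esub> c \<and> central_lift w c = 1"
      using subgroup.one_closed[OF a2_subgroup] A.lin_chars_one[OF central_lift_lin_char[OF w] a2_subgroup] by blast
  qed
  then show "finite (lin_exts add_group (central_lift w) a2 a1)"
    "card (lin_exts add_group (central_lift w) a2 a1) * card a2 = card a1" by auto
qed

lemma central_lift_inj:
  assumes "v \<in> central_chars" "w \<in> central_chars" "\<And>A. A \<in> a2 \<Longrightarrow> central_lift v A = central_lift w A"
  shows "v = w"
proof
  fix x show "v x = w x"
  proof (cases "x \<in> Z")
    case True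
    then obtain A where "A \<in> a2" "x = I + A" by (auto simp: one_plus_def)
    then show ?thesis using assms(3)[of A] by (simp add: central_lift_def)
  next
    case False
    then show ?thesis using lin_chars_out[OF central_charsD(1)[OF assms(1)]] lin_chars_out[OF central_charsD(1)[OF assms(2)]] by simp
  qed
qed

end

section \<open>Functionals as additive characters\<close>

locale pattern_char = pattern n D F q
  for n D and F :: "'f::{finite,field} itself" and q +
  fixes \<psi> :: "'f \<Rightarrow> complex"
  assumes psi_nz: "\<psi> x \<noteq> 0" and psi_add: "\<psi> (x + y) = \<psi> x * \<psi> y" and psi_nontriv: "\<exists>x. \<psi> x \<noteq> 1"
    and psi_all: "(\<And>x. \<theta> x \<noteq> 0) \<Longrightarrow> (\<And>x y. \<theta> (x + y) = \<theta> x * \<theta> y) \<Longrightarrow> \<exists>c. \<forall>x. \<theta> x = \<psi> (c * x)"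
begin

lemma psi_zero: "\<psi> 0 = 1"
  using psi_add[of 0 0] psi_nz[of 0] by simp

lemma psi_trivial: assumes "\<And>c. \<psi> (c * x) = 1" shows "x = 0"
proof (rule ccontr)
  assume x: "x \<noteq> 0"
  obtain y where "\<psi> y \<noteq> 1" using psi_nontriv by blast
  moreover have "\<psi> y = \<psi> ((y / x) * x)" using x by simp
  ultimately show False using assms by metis
qed

lemma psi_inj: assumes "\<And>c. \<psi> (c * x) = \<psi> (c * y)" shows "x = y"
proof -
  have "\<psi> (c * (x - y)) = 1" for c
  proof -
    have "\<psi> (c * x) = \<psi> (c * (x - y)) * \<psi> (c * y)" unfolding psi_add[symmetric] by (simp add: algebra_simps)
    then show ?thesis using assms[of c] psi_nz by simp
  qed
  then show ?thesis using psi_trivial[of "x - y"] by simp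
qed

definition psi_char :: "('f mat \<Rightarrow> 'f) \<Rightarrow> 'f mat \<Rightarrow> complex" where
  "psi_char l = (\<lambda>X. if X \<in> a1 then \<psi> (l X) else 0)"

lemma psi_char_lin: "l \<in> dual \<Longrightarrow> psi_char l \<in> lin_chars add_group a1"
  by (auto simp: lin_chars_add_group psi_char_def psi_nz psi_add pattern_add dualD)

lemma psi_char_inj: "inj_on psi_char dual"
proof (rule inj_onI)
  fix l m assume l: "l \<in> dual" and m: "m \<in> dual" and e: "psi_char l = psi_char m"
  show "l = m"
  proof (rule dual_eqI[OF l m])
    fix X assume X: "X \<in> a1"
    show "l X = m X"
    proof (rule psi_inj)
      fix c
      have "psi_char l (c \<cdot>\<^sub>m X) = psi_char m (c \<cdot>\<^sub>m X)" using e by simp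
      then show "\<psi> (c * l X) = \<psi> (c * m X)"
        using pattern_smult[OF X] dualD(2)[OF l X] dualD(2)[OF m X] by (simp add: psi_char_def)
    qed
  qed
qed

text \<open>On each line t -> t X an additive character \<open>w\<close> restricts to a character of
  the field, hence to t -> psi (c t) by \<open>psi_all\<close>; this c is taken as l X. Since c is
  determined by the function t -> psi (c t), additivity of \<open>w\<close> and rescaling of the
  line make l linear.\<close>

lemma psi_char_surj:
  assumes w: "w \<in> lin_chars add_group a1" shows "\<exists>l\<in>dual. w = psi_char l"
proof -
  have wm: "\<And>A. A \<in> a1 \<Longrightarrow> w A \<noteq> 0" "\<And>A. A \<notin> a1 \<Longrightarrow> w A = 0"
    "\<And>A B. A \<in> a1 \<Longrightarrow> B \<in> a1 \<Longrightarrow> w (A + B) = w A * w B"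
    using w by (auto simp: lin_chars_add_group)
  have ex: "\<exists>c. \<forall>t. w (t \<cdot>\<^sub>m X) = \<psi> (c * t)" if X: "X \<in> a1" for X
  proof (rule psi_all)
    show "w (t \<cdot>\<^sub>m X) \<noteq> 0" for t by (rule wm(1)[OF pattern_smult[OF X]])
    show "w ((s + t) \<cdot>\<^sub>m X) = w (s \<cdot>\<^sub>m X) * w (t \<cdot>\<^sub>m X)" for s t
    proof -
      have "(s + t) \<cdot>\<^sub>m X = s \<cdot>\<^sub>m X + t \<cdot>\<^sub>m X" using carr[OF X] by (intro eq_matI) (auto simp: algebra_simps)
      then show ?thesis using wm(3)[OF pattern_smult[OF X] pattern_smult[OF X]] by simp
    qed
  qed
  define l where "l X = (if X \<in> a1 then SOME c. \<forall>t. w (t \<cdot>\<^sub>m X) = \<psi> (c * t) else 0)" for X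
  have lX: "w (t \<cdot>\<^sub>m X) = \<psi> (l X * t)" if X: "X \<in> a1" for X t
  proof -
    have "l X = (SOME c. \<forall>t. w (t \<cdot>\<^sub>m X) = \<psi> (c * t))" unfolding l_def using X by (rule if_P)
    then show ?thesis using spec[OF someI_ex[OF ex[OF X]], of t] by (simp only:)
  qed
  have add: "l (X + Y) = l X + l Y" if X: "X \<in> a1" and Y: "Y \<in> a1" for X Y
  proof (rule psi_inj)
    fix t
    have "t \<cdot>\<^sub>m (X + Y) = t \<cdot>\<^sub>m X + t \<cdot>\<^sub>m Y" using carr[OF X] carr[OF Y] by (intro eq_matI) (auto simp: algebra_simps)
    then have "\<psi> (l (X + Y) * t) = \<psi> (l X * t) * \<psi> (l Y * t)"
      using lX[OF pattern_add[OF X Y], of t] lX[OF X, of t] lX[OF Y, of t]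
        wm(3)[OF pattern_smult[OF X] pattern_smult[OF Y]] by simp
    then show "\<psi> (t * l (X + Y)) = \<psi> (t * (l X + l Y))"
      by (simp add: psi_add[symmetric] algebra_simps)
  qed
  have smult: "l (c \<cdot>\<^sub>m X) = c * l X" if X: "X \<in> a1" for c X
  proof (rule psi_inj)
    fix t
    have "t \<cdot>\<^sub>m (c \<cdot>\<^sub>m X) = (t * c) \<cdot>\<^sub>m X" by (intro eq_matI) auto
    then have "\<psi> (l (c \<cdot>\<^sub>m X) * t) = \<psi> (l X * (t * c))"
      using lX[OF pattern_smult[OF X], of t c] lX[OF X, of "t * c"] by simp
    then show "\<psi> (t * l (c \<cdot>\<^sub>m X)) = \<psi> (t * (c * l X))" by (simp add: ac_simps)
  qed
  have "l \<in> dual" using add smult by (auto simp: pattern_dual_def l_def)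
  moreover have "w = psi_char l"
  proof
    fix X show "w X = psi_char l X"
    proof (cases "X \<in> a1")
      case True
      have "1 \<cdot>\<^sub>m X = X" by (intro eq_matI) auto
      then show ?thesis using lX[OF True, of 1] True by (simp add: psi_char_def)
    next
      case False
      then show ?thesis using wm(2) by (simp add: psi_char_def)
    qed
  qed
  ultimately show ?thesis by blast
qed

lemma finite_dual: "finite dual"
proof -
  interpret A: group add_group by (rule group_add_group)
  have "finite (lin_chars add_group a1)"
  proof (rule A.abelian_lin_chars(1)[OF _ a1_subgroup])
    show "finite (carrier add_group)" by (simp add: add_group_def finite_pattern_algebra)
    show "x \<otimes>\<^bsub>add_group\<^esub> y = y \<otimes>\<^bsub>add_group\<^esub> x" if "x \<in> a1" "y \<in> a1" for x y
      using that[THEN carr] comm_add_mat[of x n n y] by (simp add: add_group_def)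
  qed
  moreover have "psi_char ` dual \<subseteq> lin_chars add_group a1" using psi_char_lin by blast
  ultimately show ?thesis using psi_char_inj finite_imageD finite_subset by blast
qed

text \<open>For one direction B is replaced by c B: psi is then 1 on all multiples of l ([A, B]),
  and a nontrivial psi forces l ([A, B]) = 0. This is where additive triviality over the complex
  numbers becomes vanishing over the field.\<close>

lemma radicals_agree:
  assumes l: "l \<in> dual" and w: "\<And>A. A \<in> a2 \<Longrightarrow> w (I + A) = \<psi> (l A)"
  shows "mat_radical w = dual_radical l"
proof -
  have "(\<forall>B\<in>a1. w (I + bracket A B) = 1) \<longleftrightarrow> (\<forall>B\<in>a1. l (bracket A B) = 0)" if A: "A \<in> a1" for A
  proof
    assume r: "\<forall>B\<in>a1. w (I + bracket A B) = 1"
    show "\<forall>B\<in>a1. l (bracket A B) = 0"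
    proof
      fix B assume B: "B \<in> a1"
      show "l (bracket A B) = 0"
      proof (rule psi_trivial)
        fix c
        have cB: "c \<cdot>\<^sub>m B \<in> a1" by (rule pattern_smult[OF B])
        have "bracket A B \<in> a1" using bracket_in_a2[OF A B] a21 by blast
        then have "l (bracket A (c \<cdot>\<^sub>m B)) = c * l (bracket A B)"
          using bracket_smult(2)[OF A B] dualD(2)[OF l] by simp
        then show "\<psi> (c * l (bracket A B)) = 1" using r cB w[OF bracket_in_a2[OF A cB]] by simp
      qed
    qed
  next
    assume "\<forall>B\<in>a1. l (bracket A B) = 0"
    then show "\<forall>B\<in>a1. w (I + bracket A B) = 1" using w[OF bracket_in_a2[OF A]] psi_zero by simp
  qed
  then show ?thesis unfolding mat_radical_def dual_radical_def by blast
qed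

text \<open>From \<open>l\<close> one sets w (1 + A) = psi (l A) on \<open>Z\<close>; this is
  multiplicative and trivial on \<open>N\<close> because \<open>l\<close> vanishes on
  \<open>a3\<close>, in particular on the products A B. Conversely an extension of
  \<open>central_lift w\<close> is psi composed with a functional. In both directions
  \<open>radicals_agree\<close> carries the index q^2 across.\<close>

lemma psi_char_image:
  "psi_char ` dual2 = (\<Union>w\<in>chars2. lin_exts add_group (central_lift w) a2 a1)"
proof (intro equalityI subsetI)
  fix \<theta> assume "\<theta> \<in> psi_char ` dual2"
  then obtain l where l: "l \<in> dual" "card (dual_radical l) * q ^ 2 = card a1" "\<theta> = psi_char l" by blast
  have l3: "l A = 0" if "A \<in> a3" for A by (rule dual_zero_on_a3[OF l(1,2) that])
  define w where "w x = (if x \<in> Z then \<psi> (l (x - I)) else 0)" for x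
  have wA: "w (I + A) = \<psi> (l A)" if A: "A \<in> a2" for A
  proof -
    have "I + A - I = A" using carr2[OF A] by (intro eq_matI) auto
    then show ?thesis using A by (simp add: w_def one_plus_def)
  qed
  have "w \<in> lin_chars G Z"
  proof (rule lin_charsI)
    show "w x \<noteq> 0" if "x \<in> Z" for x using that by (simp add: w_def psi_nz)
    show "w x = 0" if "x \<notin> Z" for x using that by (simp add: w_def)
    fix x y assume "x \<in> Z" "y \<in> Z"
    then obtain A B where A: "A \<in> a2" "x = I + A" and B: "B \<in> a2" "y = I + B" by (auto simp: one_plus_def)
    have A1: "A \<in> a1" and B1: "B \<in> a1" using A B a21 by auto
    have AB: "A * B \<in> a3" by (rule mult_a1_a2[OF A1 B(1)])
    have "w (x \<otimes>\<^bsub>G\<^esub> y) = \<psi> (l (A + B + A * B))"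
      using one_plus_mult[OF carr2[OF A(1)] carr2[OF B(1)]] A B wA AB a32 by (auto simp: pattern_add subset_eq)
    also have "l (A + B + A * B) = l A + l B"
      using dualD(1)[OF l(1) pattern_add[OF A1 B1], of "A * B"] dualD(1)[OF l(1) A1 B1] AB a31 l3[OF AB] by auto
    finally show "w (x \<otimes>\<^bsub>G\<^esub> y) = w x * w y" using A B wA by (simp add: psi_add)
  qed
  moreover have "w x = 1" if x: "x \<in> N" for x
  proof -
    obtain A where "A \<in> a3" "x = I + A" using x by (auto simp: one_plus_def)
    then show ?thesis using wA[of A] a32 l3[of A] psi_zero by auto
  qed
  ultimately have w: "w \<in> central_chars" by (simp add: central_chars_def)
  moreover have "card (mat_radical w) * q ^ 2 = card a1"
    using radicals_agree[OF l(1) wA] l(2) by simp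
  moreover have "\<theta> \<in> lin_exts add_group (central_lift w) a2 a1"
    unfolding l(3) lin_exts_def using psi_char_lin[OF l(1)] a21 wA by (auto simp: central_lift_def psi_char_def)
  ultimately show "\<theta> \<in> (\<Union>w\<in>chars2. lin_exts add_group (central_lift w) a2 a1)"
    by blast
next
  fix \<theta> assume "\<theta> \<in> (\<Union>w\<in>chars2. lin_exts add_group (central_lift w) a2 a1)"
  then obtain w where w: "w \<in> central_chars" "card (mat_radical w) * q ^ 2 = card a1"
    and t: "\<theta> \<in> lin_chars add_group a1" "\<And>A. A \<in> a2 \<Longrightarrow> \<theta> A = central_lift w A"
    by (auto simp: lin_exts_def)
  obtain l where l: "l \<in> dual" "\<theta> = psi_char l" using psi_char_surj[OF t(1)] by blast
  have "w (I + A) = \<psi> (l A)" if "A \<in> a2" for A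
    using t(2)[OF that] l(2) that a21 by (auto simp: central_lift_def psi_char_def)
  then have "mat_radical w = dual_radical l" by (rule radicals_agree[OF l(1)])
  then show "\<theta> \<in> psi_char ` dual2" using l w by auto
qed

lemma card_dual_rank_two:
  "card dual2 * card a2 = card chars2 * card a1"
proof -
  let ?E = "\<lambda>w. lin_exts add_group (central_lift w) a2 a1"
  have "card dual2 = card (psi_char ` dual2)"
    by (rule card_image[symmetric, OF inj_on_subset[OF psi_char_inj]]) auto
  also have "\<dots> = (\<Sum>w\<in>chars2. card (?E w))"
    unfolding psi_char_image
  proof (rule card_UN_disjoint)
    show "finite chars2" using finite_central_chars by simp
    show "\<forall>w\<in>chars2. finite (?E w)" using card_central_lift_exts(1) by blast
    show "\<forall>v\<in>chars2. \<forall>w\<in>chars2. v \<noteq> w \<longrightarrow> ?E v \<inter> ?E w = {}"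
    proof (intro ballI impI, rule ccontr)
      fix v w assume vw: "v \<in> chars2" "w \<in> chars2" "v \<noteq> w" "?E v \<inter> ?E w \<noteq> {}"
      then have "\<forall>A\<in>a2. central_lift v A = central_lift w A" unfolding lin_exts_def by fastforce
      then show False using central_lift_inj[of v w] vw by blast
    qed
  qed
  finally have "card dual2 * card a2 = (\<Sum>w\<in>chars2. card (?E w) * card a2)" by (simp add: sum_distrib_right)
  also have "\<dots> = (\<Sum>w\<in>chars2. card a1)"
    using card_central_lift_exts(2) by (intro sum.cong refl) blast
  finally show ?thesis by simp
qed

lemma card_irr_chars_eq_card_orbits:
  "card (irr_chars_of_degree G q) = card {Orb \<in> coadjoint_orbits n D :: ('f mat \<Rightarrow> 'f) set set. card Orb = q ^ 2}"
proof -
  let ?O = "{Orb \<in> coadjoint_orbits n D :: ('f mat \<Rightarrow> 'f) set set. card Orb = q ^ 2}"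
  \<comment> \<open>Orbits of functionals consist of functionals; adding this condition puts the set
    in the form counted by \<open>card_dual_orbits\<close>.\<close>
  have "?O = {Orb \<in> coadjoint_orbits n D. card Orb = q ^ 2 \<and> Orb \<subseteq> dual}"
    using orbit_subset by (auto simp: coadjoint_orbits_def)
  then have "q ^ 2 * card ?O = card {l \<in> dual. card (orb l) = q ^ 2}"
    using card_dual_orbits[OF finite_dual, of "q ^ 2"] by simp
  also have "{l \<in> dual. card (orb l) = q ^ 2} = dual2"
    using orbit_card_iff by auto
  \<comment> \<open>Both sides equal |chars2| |a1|; the common factor q^2 |a2| is positive and
    cancels.\<close>
  finally have "q ^ 2 * card ?O * card a2 = card (irr_chars_of_degree G q) * card a2 * q ^ 2"
    using card_dual_rank_two card_irr_chars by simp
  moreover have "card a2 > 0" by (rule card_pattern_pos)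
  moreover have "q ^ 2 > 0" using q2 by simp
  ultimately show ?thesis by simp
qed

end

theorem theorem3p9:
  fixes n :: nat and D :: "(nat \<times> nat) set"
  assumes "closed_pattern n D"
  defines "q \<equiv> card (UNIV :: 'f::{finite,field} set)"
  shows "card (irr_chars_of_degree (pattern_group n D :: 'f mat monoid) q) =
         card {Orb \<in> (coadjoint_orbits n D :: ('f mat \<Rightarrow> 'f) set set). card Orb = q ^ 2}"
proof -
  obtain \<psi> :: "'f \<Rightarrow> complex" where "\<forall>x. \<psi> x \<noteq> 0" "\<forall>x y. \<psi> (x + y) = \<psi> x * \<psi> y" "\<exists>x. \<psi> x \<noteq> 1"
    "\<forall>\<theta>. (\<forall>x. \<theta> x \<noteq> 0) \<longrightarrow> (\<forall>x y. \<theta> (x + y) = \<theta> x * \<theta> y) \<longrightarrow> (\<exists>c. \<forall>x. \<theta> x = \<psi> (c * x))"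
    using additive_character_exists[where 'f = 'f] by auto
  then interpret pattern_char n D "TYPE('f)" q \<psi>
    by unfold_locales (use assms in auto)
  show ?thesis by (rule card_irr_chars_eq_card_orbits)
qed

end
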